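(* Let $h_1,h_2,h_3\in\mathbb R$ and $P>0$. If a rate tuple $(R_{12},R_{13},R_{21},R_{23},R_{31},R_{32})$ is achievable in the (non-restricted) Gaussian Y-channel with gains $h_1,h_2,h_3$ and power $P$, then there exists a joint distribution $p(x_1,x_2,x_3,x_r)$ of real random variables $(X_1,X_2,X_3,X_r)$ with $\mathbb E[X_a^2]\le P$ for $a\in\{1,2,3,r\}$ such that, for all distinct $j,k,l\in\{1,2,3\}$, $$R_{jk}+R_{jl}\leq\min\{I(X_j;Y_r|X_k,X_l,X_r),\ I(X_r;Y_k,Y_l|X_k,X_l)\},$$ $$R_{jl}+R_{kl}\leq\min\{I(X_j,X_k;Y_r|X_l,X_r),\ I(X_r;Y_l|X_l)\},$$ where $Y_r=h_1X_1+h_2X_2+h_3X_3+Z_r$ and $Y_m=h_mX_r+Z_m$ for $m\in\{1,2,3\}$, with $Z_r,Z_1,Z_2,Z_3$ i.i.d. $\mathcal N(0,1)$ independent of $(X_1,X_2,X_3,X_r)$.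
   Context: The (non-restricted, reciprocal) Gaussian Y-channel with real gains $h_1,h_2,h_3$ and power $P>0$: users $1,2,3$ and a relay $r$. For each ordered pair $(j,k)$ of distinct indices in $\{1,2,3\}$, user $j$ holds a message $m_{jk}$, uniform on $\{1,\dots,2^{nR_{jk}}\}$, intended for user $k$; the six messages are mutually independent. Over channel uses $i=1,\dots,n$, the relay receives $Y_{ri}=h_1X_{1i}+h_2X_{2i}+h_3X_{3i}+Z_{ri}$ and user $j$ receives $Y_{ji}=h_jX_{ri}+Z_{ji}$, all noise samples i.i.d. $\mathcal N(0,1)$ independent of the messages. Encoders $X_{ji}=f_{ji}(m_{jk},m_{jl},Y_j^{i-1})$ ($\{k,l\}=\{1,2,3\}\setminus\{j\}$), relay $X_{ri}=f_{ri}(Y_r^{i-1})$, power constraints $\frac1n\sum_i\mathbb E[X_{ai}^2]\le P$ for $a\in\{1,2,3,r\}$; user $j$ estimates $(m_{kj},m_{lj})$ from $(Y_j^n,m_{jk},m_{jl})$. A rate tuple is achievable if codes exist whose error probability (some message decoded wrongly) tends to $0$ as $n\to\infty$. Mutual informations are in bits. *)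

theory Defs
  imports "HOL-Probability.Probability"
begin

datatype user = U1 | U2 | U3

datatype node = Rly | Usr user

definition stdN :: "real measure" where
  "stdN = density lborel std_normal_density"

text \<open>A length-n code.  Time indices are 0..n-1.  Past outputs are passed as a
  sequence nat => real that is padded with 0 from the current time on, so that
  causality is structural.
  enc j i w y: transmit symbol of user j at time i, w k = m_jk (own messages),
               y = past received outputs Y_j^(i-1).
  rel i y:     relay symbol at time i from the past relay outputs.
  dec k w y:   estimates of the incoming messages, j |-> estimate of m_jk,
               from own messages w and the output sequence Y_k^n.\<close>
record code =
  enc :: "user \<Rightarrow> nat \<Rightarrow> (user \<Rightarrow> nat) \<Rightarrow> (nat \<Rightarrow> real) \<Rightarrow> real"
  rel :: "nat \<Rightarrow> (nat \<Rightarrow> real) \<Rightarrow> real"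
  dec :: "user \<Rightarrow> (user \<Rightarrow> nat) \<Rightarrow> (nat \<Rightarrow> real) \<Rightarrow> (user \<Rightarrow> nat)"

definition yout :: "(user \<Rightarrow> real) \<Rightarrow> (nat \<Rightarrow> node \<Rightarrow> real) \<Rightarrow> (node \<times> nat \<Rightarrow> real)
    \<Rightarrow> node \<Rightarrow> nat \<Rightarrow> real" where
  "yout h H z a t = (case a of
      Rly \<Rightarrow> h U1 * H t (Usr U1) + h U2 * H t (Usr U2) + h U3 * H t (Usr U3) + z (Rly, t)
    | Usr j \<Rightarrow> h j * H t Rly + z (Usr j, t))"

text \<open>xhist c h m z i t a = transmitted symbol X_{a,t} for t < i (0 for t >= i),
  given messages m (m j k = m_jk) and noise realisation z.\<close>
fun xhist :: "code \<Rightarrow> (user \<Rightarrow> real) \<Rightarrow> (user \<Rightarrow> user \<Rightarrow> nat) \<Rightarrow> (node \<times> nat \<Rightarrow> real)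
    \<Rightarrow> nat \<Rightarrow> nat \<Rightarrow> node \<Rightarrow> real" where
  "xhist c h m z 0 = (\<lambda>t a. 0)"
| "xhist c h m z (Suc i) =
    (let H = xhist c h m z i;
         Y = (\<lambda>a t. if t < i then yout h H z a t else 0)
     in H(i := (\<lambda>a. case a of Rly \<Rightarrow> rel c i (Y Rly)
                             | Usr j \<Rightarrow> enc c j i (m j) (Y (Usr j)))))"

definition yseq :: "code \<Rightarrow> (user \<Rightarrow> real) \<Rightarrow> nat \<Rightarrow> (user \<Rightarrow> user \<Rightarrow> nat) \<Rightarrow> (node \<times> nat \<Rightarrow> real)
    \<Rightarrow> node \<Rightarrow> nat \<Rightarrow> real" where
  "yseq c h n m z a t = (if t < n then yout h (xhist c h m z n) z a t else 0)"

definition msize :: "nat \<Rightarrow> (user \<Rightarrow> user \<Rightarrow> real) \<Rightarrow> user \<Rightarrow> user \<Rightarrow> nat" where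
  "msize n R j k = nat \<lceil>2 powr (real n * R j k)\<rceil>"

definition Msgs :: "nat \<Rightarrow> (user \<Rightarrow> user \<Rightarrow> real) \<Rightarrow> (user \<Rightarrow> user \<Rightarrow> nat) set" where
  "Msgs n R = {m. \<forall>j k. (j = k \<longrightarrow> m j k = 0) \<and> (j \<noteq> k \<longrightarrow> m j k < msize n R j k)}"

definition Omega :: "nat \<Rightarrow> (user \<Rightarrow> user \<Rightarrow> real) \<Rightarrow> ((user \<Rightarrow> user \<Rightarrow> nat) \<times> (node \<times> nat \<Rightarrow> real)) measure" where
  "Omega n R = measure_pmf (pmf_of_set (Msgs n R)) \<Otimes>\<^sub>M (\<Pi>\<^sub>M i\<in>UNIV. stdN)"

definition code_measurable :: "code \<Rightarrow> bool" where
  "code_measurable c \<longleftrightarrow>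
     (\<forall>j i w. enc c j i w \<in> borel_measurable (\<Pi>\<^sub>M t\<in>UNIV. (borel :: real measure))) \<and>
     (\<forall>i. rel c i \<in> borel_measurable (\<Pi>\<^sub>M t\<in>UNIV. (borel :: real measure))) \<and>
     (\<forall>k w. dec c k w \<in> measurable (\<Pi>\<^sub>M t\<in>UNIV. (borel :: real measure)) (count_space UNIV))"

definition power_ok :: "code \<Rightarrow> (user \<Rightarrow> real) \<Rightarrow> real \<Rightarrow> (user \<Rightarrow> user \<Rightarrow> real) \<Rightarrow> nat \<Rightarrow> bool" where
  "power_ok c h P R n \<longleftrightarrow>
     (\<forall>a. (\<Sum>i<n. \<integral>\<^sup>+ \<omega>. ennreal ((xhist c h (fst \<omega>) (snd \<omega>) n i a)\<^sup>2) \<partial>Omega n R)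
            \<le> ennreal (real n * P))"

definition err_prob :: "code \<Rightarrow> (user \<Rightarrow> real) \<Rightarrow> (user \<Rightarrow> user \<Rightarrow> real) \<Rightarrow> nat \<Rightarrow> real" where
  "err_prob c h R n = measure (Omega n R)
     {\<omega> \<in> space (Omega n R). \<exists>j k. j \<noteq> k \<and>
        dec c k (fst \<omega> k) (yseq c h n (fst \<omega>) (snd \<omega>) (Usr k)) j \<noteq> fst \<omega> j k}"

definition achievable :: "(user \<Rightarrow> real) \<Rightarrow> real \<Rightarrow> (user \<Rightarrow> user \<Rightarrow> real) \<Rightarrow> bool" where
  "achievable h P R \<longleftrightarrow>
     (\<exists>c :: nat \<Rightarrow> code.
        (\<forall>n. code_measurable (c n) \<and> power_ok (c n) h P R n) \<and>
        (\<lambda>n. err_prob (c n) h R n) \<longlonglongrightarrow> 0)"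

definition Mjoint :: "(node \<Rightarrow> real) measure \<Rightarrow> ((node \<Rightarrow> real) \<times> (node \<Rightarrow> real)) measure" where
  "Mjoint \<mu> = \<mu> \<Otimes>\<^sub>M (\<Pi>\<^sub>M a\<in>UNIV. stdN)"

definition Xv :: "node \<Rightarrow> (node \<Rightarrow> real) \<times> (node \<Rightarrow> real) \<Rightarrow> real" where
  "Xv a \<omega> = fst \<omega> a"

definition Yv :: "(user \<Rightarrow> real) \<Rightarrow> node \<Rightarrow> (node \<Rightarrow> real) \<times> (node \<Rightarrow> real) \<Rightarrow> real" where
  "Yv h a \<omega> = (case a of
      Rly \<Rightarrow> h U1 * fst \<omega> (Usr U1) + h U2 * fst \<omega> (Usr U2) + h U3 * fst \<omega> (Usr U3) + snd \<omega> Rly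
    | Usr j \<Rightarrow> h j * fst \<omega> Rly + snd \<omega> (Usr j))"

text \<open>CMI mu MA MB MC A B C denotes I(A;B|C) in bits on Mjoint mu.  It is computed
  with the library notion as I(B;A|C) = I(B;(A,C)) - I(B;C) (symmetry of conditional
  mutual information); in every use below B is a channel output, so both terms are finite.\<close>
definition CMI :: "(node \<Rightarrow> real) measure \<Rightarrow> 'a measure \<Rightarrow> 'b measure \<Rightarrow> 'c measure
    \<Rightarrow> ((node \<Rightarrow> real) \<times> (node \<Rightarrow> real) \<Rightarrow> 'a) \<Rightarrow> ((node \<Rightarrow> real) \<times> (node \<Rightarrow> real) \<Rightarrow> 'b)
    \<Rightarrow> ((node \<Rightarrow> real) \<times> (node \<Rightarrow> real) \<Rightarrow> 'c) \<Rightarrow> real" where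
  "CMI \<mu> MA MB MC A B C = prob_space.conditional_mutual_information (Mjoint \<mu>) 2 MB MA MC B A C"

end

theory Submission
  imports Defs
begin

text \<open>For every cut of the network, the nodes on the receiving side can run their part of the code from the
  innovations at their channel outputs. Passing from the noise to the innovations is a triangular
  shift, so the noise law can be changed to one under which the innovations are independent
  Gaussians that carry no information on the messages crossing the cut. Comparing the two laws
  through \<open>u \<le> exp u - 1\<close> bounds the rate sum by the logarithm of the standard deviations of
  the innovations, with no differential entropy involved.

  Let \<open>j\<^sub>0\<close> have the largest gain, let \<open>p\<close>, \<open>q\<close> be the other users, and let \<open>\<rho> P\<close> be a limit point of
  the empirical correlations of the inputs of \<open>p\<close> and \<open>q\<close>. The input law is Gaussian with all powers
  \<open>P\<close> and only these two inputs correlated, with coefficient \<open>\<rho>\<close>. Predicting the input of \<open>p\<close> by \<open>\<rho>\<close> times that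
  of \<open>q\<close>, and conversely, gives the uplink cuts out of \<open>p\<close> and \<open>q\<close>; the uplink cuts into \<open>p\<close> and
  \<open>q\<close> are weaker than the downlink cuts into them because \<open>j\<^sub>0\<close> has the largest gain.\<close>

section \<open>Triangular shifts of Gaussian coordinates\<close>

text \<open>One input law has to serve all cuts at once, although feedback may correlate the inputs
  in any way. The correlation of \<open>p\<close> and \<open>q\<close> acts in two directions: it
  can raise the cut into \<open>j\<^sub>0\<close>, where both transmit, and it lowers the cuts out
  of \<open>p\<close> and out of \<open>q\<close>, where the other input is known. These three cuts
  must therefore be evaluated at the same empirical correlation. All other correlations can be
  discarded: the cuts out of \<open>j\<^sub>0\<close> and the downlink cuts take their largest
  values for uncorrelated inputs, the cuts out of \<open>p\<close> and \<open>q\<close> need only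
  one of the two known inputs as predictor, and a cut into \<open>p\<close> or \<open>q\<close>
  contains the full power of the uncorrelated input of \<open>j\<^sub>0\<close>. Fano's inequality
  is replaced by counting: under the changed law the receiving side ignores the crossing messages,
  so it is right for at most one in M of their M values. This costs a constant 1, which disappears
  after division by the block length.\<close>

lemma sets_stdN [measurable_cong, simp]: "sets stdN = sets borel"
  by (simp add: stdN_def)

lemma space_stdN [simp]: "space stdN = UNIV"
  by (simp add: stdN_def)

lemma prob_space_stdN: "prob_space stdN"
  unfolding stdN_def by (rule prob_space_normal_density) simp

text \<open>Fubini in coordinate \<open>i\<close>, with the outer integral kept over all
  coordinates: its integrand ignores coordinate \<open>i\<close>, so that coordinate may carry
  either law there. The law at \<open>i\<close> can thus be exchanged while every function stays
  defined on the full space, which is what an induction over coordinates needs.\<close>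

lemma nn_integral_PiM_fun_upd:
  fixes M M' :: "'i \<Rightarrow> real measure"
  assumes M: "\<And>j. prob_space (M j)" and M': "prob_space (M' i)" "\<And>j. j \<noteq> i \<Longrightarrow> M' j = M j"
    and sets: "\<And>j. sets (M j) = sets borel" "sets (M' i) = sets borel"
    and F: "F \<in> borel_measurable (\<Pi>\<^sub>M j\<in>UNIV. borel)"
  shows "(\<integral>\<^sup>+ z. F z \<partial>PiM UNIV M') = (\<integral>\<^sup>+ z. (\<integral>\<^sup>+ x. F (z(i := x)) \<partial>M' i) \<partial>PiM UNIV M)"
proof -
  have pM': "prob_space (M' j)" for j using M M' by (cases "j = i") auto
  have sM': "sets (M' j) = sets borel" for j using sets M' by (cases "j = i") auto
  interpret M'i: prob_space "M' i" by (rule pM')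
  let ?I = "- {i}"
  interpret MI: prob_space "PiM ?I M'" by (rule prob_space_PiM) (rule pM')
  interpret pair_sigma_finite "M' i" "PiM ?I M'" ..
  have F': "F \<in> borel_measurable (PiM UNIV M')"
    using F by (subst measurable_cong_sets[OF sets_PiM_cong[OF refl sM'] refl]) simp
  have ins: "insert i ?I = UNIV" by auto
  have upd: "(\<lambda>(x, X). X(i := x)) \<in> M' i \<Otimes>\<^sub>M PiM ?I M' \<rightarrow>\<^sub>M PiM UNIV M'"
    using measurable_add_dim[of i ?I M'] unfolding ins
    by (subst measurable_pair_swap_iff) (simp add: case_prod_unfold)
  have "(\<integral>\<^sup>+ z. F z \<partial>PiM UNIV M')
      = (\<integral>\<^sup>+ z. F z \<partial>distr (M' i \<Otimes>\<^sub>M PiM ?I M') (PiM UNIV M') (\<lambda>(x, X). X(i := x)))"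
    using distr_pair_PiM_eq_PiM[of ?I M' i] pM' by (simp add: ins)
  also have "\<dots> = (\<integral>\<^sup>+ p. F ((\<lambda>(x, X). X(i := x)) p) \<partial>(M' i \<Otimes>\<^sub>M PiM ?I M'))"
    by (rule nn_integral_distr[OF upd]) (use F' in simp)
  also have "\<dots> = (\<integral>\<^sup>+ X. (\<integral>\<^sup>+ x. F (X(i := x)) \<partial>M' i) \<partial>PiM ?I M')"
    by (subst nn_integral_snd[symmetric]) (use measurable_compose[OF upd F'] in \<open>auto simp: case_prod_unfold\<close>)
  also have "PiM ?I M' = PiM ?I M"
    by (intro PiM_cong) (auto simp: M')
  also have "\<dots> = distr (PiM UNIV M) (PiM ?I M) (\<lambda>z. restrict z ?I)"
    using distr_PiM_reindex[of UNIV M "\<lambda>i. i" ?I] M by (simp add: restrict_def)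
  also have "(\<integral>\<^sup>+ X. (\<integral>\<^sup>+ x. F (X(i := x)) \<partial>M' i) \<partial>distr (PiM UNIV M) (PiM ?I M) (\<lambda>z. restrict z ?I))
    = (\<integral>\<^sup>+ z. (\<integral>\<^sup>+ x. F ((restrict z ?I)(i := x)) \<partial>M' i) \<partial>PiM UNIV M)"
  proof (subst nn_integral_distr)
    show "(\<lambda>z. restrict z ?I) \<in> PiM UNIV M \<rightarrow>\<^sub>M PiM ?I M"
      by (rule measurable_restrict_subset) simp
    have "PiM ?I M' = PiM ?I M" by (intro PiM_cong) (auto simp: M')
    moreover have "(\<lambda>X. \<integral>\<^sup>+ x. F (X(i := x)) \<partial>M' i) \<in> borel_measurable (PiM ?I M')"
      using measurable_compose[OF upd F'] by (intro M'i.borel_measurable_nn_integral)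
        (subst measurable_pair_swap_iff, simp add: case_prod_unfold)
    ultimately show "(\<lambda>X. \<integral>\<^sup>+ x. F (X(i := x)) \<partial>M' i)
        \<in> borel_measurable (distr (PiM UNIV M) (PiM ?I M) (\<lambda>z. restrict z ?I))" by simp
  qed simp
  also have "\<dots> = (\<integral>\<^sup>+ z. (\<integral>\<^sup>+ x. F (z(i := x)) \<partial>M' i) \<partial>PiM UNIV M)"
    by (intro nn_integral_cong arg_cong[where f = F]) auto
  finally show ?thesis .
qed

definition normal_coords :: "'i set \<Rightarrow> ('i \<Rightarrow> real) \<Rightarrow> 'i \<Rightarrow> real measure" where
  "normal_coords C \<sigma> c = (if c \<in> C then density lborel (normal_density 0 (\<sigma> c)) else stdN)"

lemma sets_normal_coords [simp, measurable_cong]: "sets (normal_coords C \<sigma> c) = sets borel"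
  by (simp add: normal_coords_def)

lemma prob_space_normal_coords: "(\<And>c. \<sigma> c > 0) \<Longrightarrow> prob_space (normal_coords C \<sigma> c)"
  by (simp add: normal_coords_def prob_space_stdN prob_space_normal_density)

definition shift_coords :: "'i set \<Rightarrow> ('i \<Rightarrow> ('i \<Rightarrow> real) \<Rightarrow> real) \<Rightarrow> ('i \<Rightarrow> real) \<Rightarrow> 'i \<Rightarrow> real" where
  "shift_coords C g z c = (if c \<in> C then z c + g c z else z c)"

lemma measurable_shift_coords:
  assumes "\<And>c. c \<in> C \<Longrightarrow> g c \<in> borel_measurable (\<Pi>\<^sub>M j\<in>UNIV. borel)"
  shows "shift_coords C g \<in> (\<Pi>\<^sub>M j\<in>UNIV. borel) \<rightarrow>\<^sub>M (\<Pi>\<^sub>M j\<in>UNIV. borel)"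
proof (rule measurable_PiM_single')
  fix c show "(\<lambda>z. shift_coords C g z c) \<in> borel_measurable (\<Pi>\<^sub>M j\<in>UNIV. borel)"
    using assms[of c] by (cases "c \<in> C") (auto simp: shift_coords_def)
qed simp

lemma sets_PiM_stdN: "sets (\<Pi>\<^sub>M j\<in>UNIV. stdN) = sets (\<Pi>\<^sub>M j\<in>UNIV. borel)"
  by (intro sets_PiM_cong) simp_all

lemma measurable_fun_upd2:
  "(\<lambda>(z, x). z(i := x)) \<in> (\<Pi>\<^sub>M j\<in>UNIV. borel) \<Otimes>\<^sub>M borel \<rightarrow>\<^sub>M (\<Pi>\<^sub>M j\<in>UNIV. borel :: real measure)"
proof (rule measurable_PiM_single')
  fix c show "(\<lambda>p. (case p of (z, x) \<Rightarrow> z(i := x)) c) \<in> borel_measurable ((\<Pi>\<^sub>M j\<in>UNIV. borel) \<Otimes>\<^sub>M borel)"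
    by (cases "c = i") (auto simp: case_prod_unfold)
qed simp

text \<open>A triangular shift has unit Jacobian, so only a ratio of densities appears. Instead of a
  Jacobian formula, the last coordinate of \<open>cs\<close> is peeled off: no other shift depends
  on it, and its own shift is a translation once the other coordinates are fixed. In
  \<open>tri\<close>, earlier shifts ignore later coordinates, while later shifts may read earlier
  ones.\<close>

lemma nn_integral_shift_coords:
  fixes g :: "'i \<Rightarrow> ('i \<Rightarrow> real) \<Rightarrow> real" and F :: "('i \<Rightarrow> real) \<Rightarrow> ennreal"
  assumes \<sigma>: "\<And>c. \<sigma> c > 0"
    and g: "\<And>c. c \<in> set cs \<Longrightarrow> g c \<in> borel_measurable (\<Pi>\<^sub>M j\<in>UNIV. borel)"
    and self: "\<And>c z x. c \<in> set cs \<Longrightarrow> g c (z(c := x)) = g c z"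
    and tri: "sorted_wrt (\<lambda>c d. \<forall>z x. g c (z(d := x)) = g c z) cs"
    and dist: "distinct cs"
    and F: "F \<in> borel_measurable (\<Pi>\<^sub>M j\<in>UNIV. borel)"
  shows "(\<integral>\<^sup>+ z. F (shift_coords (set cs) g z) * (\<Prod>c\<in>set cs. ennreal (normal_density 0 (\<sigma> c) (z c + g c z)
            / std_normal_density (z c))) \<partial>(\<Pi>\<^sub>M j\<in>UNIV. stdN))
       = (\<integral>\<^sup>+ z. F z \<partial>PiM UNIV (normal_coords (set cs) \<sigma>))"
  using g self tri dist F
proof (induction cs arbitrary: F rule: rev_induct)
  case Nil
  have "normal_coords {} \<sigma> = (\<lambda>j. stdN)" "shift_coords {} g = (\<lambda>z. z)"
    by (auto simp: normal_coords_def shift_coords_def fun_eq_iff)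
  then show ?case by simp
next
  case (snoc c cs)
  let ?B = "\<Pi>\<^sub>M j\<in>UNIV. borel :: real measure" and ?N = "\<Pi>\<^sub>M j\<in>(UNIV :: 'i set). stdN"
  let ?q = "normal_density 0 (\<sigma> c)"
  note F[measurable] = snoc.prems(5)
  have c: "c \<notin> set cs" "distinct cs" using snoc.prems(4) by auto
  have gc[measurable]: "g c \<in> borel_measurable ?B" using snoc.prems(1) by simp
  have g': "\<And>d. d \<in> set cs \<Longrightarrow> g d \<in> borel_measurable ?B" using snoc.prems(1) by simp
  have indep: "g d (z(c := x)) = g d z" if "d \<in> insert c (set cs)" for d z x
    using snoc.prems(2)[of c z x] snoc.prems(3) that by (auto simp: sorted_wrt_append fun_upd_def)
  let ?\<Phi> = "shift_coords (set cs) g"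
  let ?r = "\<lambda>z. \<Prod>c\<in>set cs. ennreal (normal_density 0 (\<sigma> c) (z c + g c z) / std_normal_density (z c))"
  have \<Phi>[measurable]: "?\<Phi> \<in> ?B \<rightarrow>\<^sub>M ?B" by (intro measurable_shift_coords g')
  have \<Phi>1[measurable]: "shift_coords (set (cs @ [c])) g \<in> ?B \<rightarrow>\<^sub>M ?B"
    by (intro measurable_shift_coords snoc.prems(1))
  have r1[measurable]: "(\<lambda>z. \<Prod>d\<in>set (cs @ [c]). ennreal (normal_density 0 (\<sigma> d) (z d + g d z) / std_normal_density (z d))) \<in> borel_measurable ?B"
    using snoc.prems(1) by (intro borel_measurable_prod_ennreal) auto
  \<comment> \<open>\<open>F'\<close> is \<open>F\<close> with coordinate \<open>c\<close> already
    integrated under its target law. The induction hypothesis is applied to it, hence the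
    generalisation over \<open>F\<close>.\<close>
  define F' where "F' w = (\<integral>\<^sup>+ x. F (w(c := x)) * ennreal (?q x) \<partial>lborel)" for w
  have upd[measurable]: "(\<lambda>(z, x). z(c := x)) \<in> ?B \<Otimes>\<^sub>M borel \<rightarrow>\<^sub>M ?B" by (rule measurable_fun_upd2)
  have updz[measurable]: "(\<lambda>x. z(c := x)) \<in> borel \<rightarrow>\<^sub>M ?B" for z :: "'i \<Rightarrow> real"
    using measurable_compose[OF measurable_Pair1' upd, of z] by (simp add: space_PiM)
  have F'm: "F' \<in> borel_measurable ?B"
    unfolding F'_def using measurable_compose[OF upd F] by (simp add: case_prod_unfold)
  have "(\<integral>\<^sup>+ z. F (shift_coords (set (cs @ [c])) g z) * (\<Prod>d\<in>set (cs @ [c]). ennreal (normal_density 0 (\<sigma> d) (z d + g d z)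
            / std_normal_density (z d))) \<partial>?N)
     = (\<integral>\<^sup>+ z. (\<integral>\<^sup>+ x. F (shift_coords (set (cs @ [c])) g (z(c := x))) * (\<Prod>d\<in>set (cs @ [c]). ennreal (normal_density 0 (\<sigma> d) ((z(c := x)) d + g d (z(c := x)))
            / std_normal_density ((z(c := x)) d))) \<partial>stdN) \<partial>?N)"
    by (rule nn_integral_PiM_fun_upd[OF _ _ _ _ _ borel_measurable_times_ennreal[OF measurable_compose[OF \<Phi>1 F] r1]])
      (simp_all add: prob_space_stdN)
  also have "\<dots> = (\<integral>\<^sup>+ z. (\<integral>\<^sup>+ x. F ((?\<Phi> z)(c := x + g c z)) * (ennreal (?q (x + g c z) / std_normal_density x) * ?r z) \<partial>stdN) \<partial>?N)"
  proof (intro nn_integral_cong arg_cong2[where f="(*)"] arg_cong[where f=F])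
    fix z :: "'i \<Rightarrow> real" and x
    show "shift_coords (set (cs @ [c])) g (z(c := x)) = (?\<Phi> z)(c := x + g c z)"
      using c by (auto simp: shift_coords_def indep)
    show "(\<Prod>d\<in>set (cs @ [c]). ennreal (normal_density 0 (\<sigma> d) ((z(c := x)) d + g d (z(c := x))) / std_normal_density ((z(c := x)) d)))
       = ennreal (?q (x + g c z) / std_normal_density x) * ?r z"
    proof -
      have "(\<Prod>d\<in>set cs. ennreal (normal_density 0 (\<sigma> d) ((z(c := x)) d + g d (z(c := x))) / std_normal_density ((z(c := x)) d))) = ?r z"
        by (rule prod.cong) (use c in \<open>auto simp: indep\<close>)
      moreover have "set (cs @ [c]) = insert c (set cs)" by simp
      ultimately show ?thesis using c by (simp only: prod.insert finite_set fun_upd_same indep insertI1 simp_thms)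
    qed
  qed
  also have "\<dots> = (\<integral>\<^sup>+ z. F' (?\<Phi> z) * ?r z \<partial>?N)"
  proof (intro nn_integral_cong)
    fix z :: "'i \<Rightarrow> real"
    have "(\<integral>\<^sup>+ x. F ((?\<Phi> z)(c := x + g c z)) * (ennreal (?q (x + g c z) / std_normal_density x) * ?r z) \<partial>stdN)
       = (\<integral>\<^sup>+ x. ennreal (std_normal_density x) * (F ((?\<Phi> z)(c := x + g c z)) * (ennreal (?q (x + g c z) / std_normal_density x) * ?r z)) \<partial>lborel)"
      unfolding stdN_def by (rule nn_integral_density) simp_all
    also have "\<dots> = (\<integral>\<^sup>+ x. (F ((?\<Phi> z)(c := x + g c z)) * ennreal (?q (x + g c z))) * ?r z \<partial>lborel)"
    proof (intro nn_integral_cong)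
      fix x
      have p: "std_normal_density x > 0" by (simp add: normal_density_pos)
      have e: "ennreal (std_normal_density x) * ennreal (?q (x + g c z) / std_normal_density x) = ennreal (?q (x + g c z))"
        using p by (subst ennreal_mult[symmetric]) (auto simp: normal_density_nonneg)
      have "ennreal (std_normal_density x) * (F ((?\<Phi> z)(c := x + g c z)) * (ennreal (?q (x + g c z) / std_normal_density x) * ?r z))
        = (ennreal (std_normal_density x) * ennreal (?q (x + g c z) / std_normal_density x)) * (F ((?\<Phi> z)(c := x + g c z)) * ?r z)"
        by (simp only: ac_simps)
      with e show "ennreal (std_normal_density x) * (F ((?\<Phi> z)(c := x + g c z)) * (ennreal (?q (x + g c z) / std_normal_density x) * ?r z))
        = (F ((?\<Phi> z)(c := x + g c z)) * ennreal (?q (x + g c z))) * ?r z"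
        by (simp only: mult.assoc mult.commute mult.left_commute)
    qed
    also have "\<dots> = (\<integral>\<^sup>+ x. F ((?\<Phi> z)(c := x + g c z)) * ennreal (?q (x + g c z)) \<partial>lborel) * ?r z"
      by (rule nn_integral_multc) simp
    also have "(\<integral>\<^sup>+ x. F ((?\<Phi> z)(c := x + g c z)) * ennreal (?q (x + g c z)) \<partial>lborel) = F' (?\<Phi> z)"
      unfolding F'_def by (subst nn_integral_real_affine[where c = 1 and t = "g c z"]) (simp_all add: add.commute)
    finally show "(\<integral>\<^sup>+ x. F ((?\<Phi> z)(c := x + g c z)) * (ennreal (?q (x + g c z) / std_normal_density x) * ?r z) \<partial>stdN) = F' (?\<Phi> z) * ?r z" .
  qed
  also have "\<dots> = (\<integral>\<^sup>+ z. F' z \<partial>PiM UNIV (normal_coords (set cs) \<sigma>))"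
    by (rule snoc.IH[OF g' _ _ c(2) F'm]) (use snoc.prems(2,3) in \<open>auto simp: sorted_wrt_append fun_upd_def\<close>)
  also have "\<dots> = (\<integral>\<^sup>+ z. (\<integral>\<^sup>+ x. F (z(c := x)) \<partial>normal_coords (set (cs @ [c])) \<sigma> c) \<partial>PiM UNIV (normal_coords (set cs) \<sigma>))"
    unfolding F'_def normal_coords_def[of "set (cs @ [c])" \<sigma> c]
    by (intro nn_integral_cong) (simp add: nn_integral_density mult.commute)
  also have "\<dots> = (\<integral>\<^sup>+ z. F z \<partial>PiM UNIV (normal_coords (set (cs @ [c])) \<sigma>))"
    by (rule nn_integral_PiM_fun_upd[symmetric])
       (simp_all add: prob_space_normal_coords \<sigma> F, simp add: normal_coords_def)
  finally show ?case .
qed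

section \<open>Second moments and the change-of-measure inequality\<close>

lemma prob_space_PiM_stdN: "prob_space (\<Pi>\<^sub>M j\<in>UNIV. stdN)"
  by (intro prob_space_PiM prob_space_stdN)

lemma nn_integral_stdN_affine_square: "(\<integral>\<^sup>+ x. ennreal ((r + a * x)\<^sup>2) \<partial>stdN) = ennreal (r\<^sup>2 + a\<^sup>2)"
proof -
  have 0: "has_bochner_integral lborel (\<lambda>x::real. std_normal_density x) 1"
    using integral_normal_density[of 1 0] integrable_normal_density[of 1 0]
    by (simp add: has_bochner_integral_iff)
  have 1: "has_bochner_integral lborel (\<lambda>x::real. std_normal_density x * x) 0"
    using integral_std_normal_moment_odd[of 0] integrable_std_normal_moment[of 1]
    by (simp add: has_bochner_integral_iff)
  have 2: "has_bochner_integral lborel (\<lambda>x::real. std_normal_density x * x\<^sup>2) 1"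
    using integral_std_normal_moment_even[of 1] integrable_std_normal_moment[of 2]
    by (simp add: has_bochner_integral_iff)
  have "has_bochner_integral lborel (\<lambda>x. r\<^sup>2 * std_normal_density x + (2 * r * a) * (std_normal_density x * x)
      + a\<^sup>2 * (std_normal_density x * x\<^sup>2)) (r\<^sup>2 * 1 + (2 * r * a) * 0 + a\<^sup>2 * 1)"
    by (intro has_bochner_integral_add has_bochner_integral_mult_right 0 1 2)
  then have b: "has_bochner_integral lborel (\<lambda>x. std_normal_density x * (r + a * x)\<^sup>2) (r\<^sup>2 + a\<^sup>2)"
    by (simp add: algebra_simps power2_eq_square)
  have "(\<integral>\<^sup>+ x. ennreal ((r + a * x)\<^sup>2) \<partial>stdN) = (\<integral>\<^sup>+ x. ennreal (std_normal_density x * (r + a * x)\<^sup>2) \<partial>lborel)"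
    unfolding stdN_def by (subst nn_integral_density) (auto simp: ennreal_mult)
  also have "\<dots> = ennreal (r\<^sup>2 + a\<^sup>2)"
    using b by (subst nn_integral_eq_integral) (auto simp: has_bochner_integral_iff)
  finally show ?thesis .
qed

text \<open>The cross term vanishes already in the inner integral over coordinate \<open>p\<close>,
  pointwise in the remaining coordinates. Hence no integrability of \<open>u\<close> is required and
  the identity also holds when both sides are infinite.\<close>

lemma nn_integral_add_coord_square:
  fixes u :: "('i \<Rightarrow> real) \<Rightarrow> real"
  assumes u[measurable]: "u \<in> borel_measurable (\<Pi>\<^sub>M j\<in>UNIV. borel)"
    and indep: "\<And>z x. u (z(p := x)) = u z"
  shows "(\<integral>\<^sup>+ z. ennreal ((u z + a * z p)\<^sup>2) \<partial>(\<Pi>\<^sub>M j\<in>UNIV. stdN))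
       = (\<integral>\<^sup>+ z. ennreal ((u z)\<^sup>2) \<partial>(\<Pi>\<^sub>M j\<in>UNIV. stdN)) + ennreal (a\<^sup>2)"
proof -
  interpret N: prob_space "\<Pi>\<^sub>M j\<in>(UNIV :: 'i set). stdN" by (rule prob_space_PiM_stdN)
  have "(\<integral>\<^sup>+ z. ennreal ((u z + a * z p)\<^sup>2) \<partial>(\<Pi>\<^sub>M j\<in>UNIV. stdN))
      = (\<integral>\<^sup>+ z. (\<integral>\<^sup>+ x. ennreal ((u (z(p := x)) + a * (z(p := x)) p)\<^sup>2) \<partial>stdN) \<partial>(\<Pi>\<^sub>M j\<in>UNIV. stdN))"
    by (rule nn_integral_PiM_fun_upd) (simp_all add: prob_space_stdN)
  also have "\<dots> = (\<integral>\<^sup>+ z. ennreal ((u z)\<^sup>2) + ennreal (a\<^sup>2) \<partial>(\<Pi>\<^sub>M j\<in>UNIV. stdN))"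
    by (simp add: indep nn_integral_stdN_affine_square)
  also have "\<dots> = (\<integral>\<^sup>+ z. ennreal ((u z)\<^sup>2) \<partial>(\<Pi>\<^sub>M j\<in>UNIV. stdN)) + ennreal (a\<^sup>2)"
    by (subst nn_integral_add) (simp_all add: N.emeasure_space_1 cong: measurable_cong_sets)
  finally show ?thesis .
qed

lemma ln_std_normal_density: "ln (std_normal_density x) = - ln (sqrt (2 * pi)) - x\<^sup>2 / 2"
  by (simp add: std_normal_density_def ln_mult ln_div)

lemma ln_normal_density: "\<sigma> > 0 \<Longrightarrow> ln (normal_density 0 \<sigma> x) = - ln (sqrt (2 * pi)) - ln \<sigma> - x\<^sup>2 / (2 * \<sigma>\<^sup>2)"
  by (simp add: normal_density_def ln_mult ln_div real_sqrt_mult)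

text \<open>With \<open>L\<close> the information density, take expectations in \<open>u \<le> exp u - 1\<close> for
  \<open>u = - L + 1\<^sub>A ln M\<close>: the factor \<open>exp (- L)\<close> changes the noise law to the one under which the
  shifted coordinates are independent Gaussians.\<close>
lemma information_density_bound:
  fixes g :: "'i \<Rightarrow> ('i \<Rightarrow> real) \<Rightarrow> real" and M :: real
  assumes \<sigma>: "\<And>c. \<sigma> c > 0"
    and g: "\<And>c. c \<in> set cs \<Longrightarrow> g c \<in> borel_measurable (\<Pi>\<^sub>M j\<in>UNIV. borel)"
    and self: "\<And>c z x. c \<in> set cs \<Longrightarrow> g c (z(c := x)) = g c z"
    and tri: "sorted_wrt (\<lambda>c d. \<forall>z x. g c (z(d := x)) = g c z) cs"
    and dist: "distinct cs"
    and A[measurable]: "A \<in> sets (\<Pi>\<^sub>M j\<in>UNIV. borel)"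
    and M: "M \<ge> 1"
    and fin: "\<And>c. c \<in> set cs \<Longrightarrow> (\<integral>\<^sup>+ z. ennreal ((z c + g c z)\<^sup>2) \<partial>(\<Pi>\<^sub>M j\<in>UNIV. stdN)) = ennreal (e c)"
    and e: "\<And>c. c \<in> set cs \<Longrightarrow> e c \<ge> 0"
  shows "measure (\<Pi>\<^sub>M j\<in>UNIV. stdN) {z. shift_coords (set cs) g z \<in> A} * ln M
    \<le> (\<Sum>c\<in>set cs. ln (\<sigma> c) + e c / (2 * (\<sigma> c)\<^sup>2) - 1 / 2)
       + M * measure (PiM UNIV (normal_coords (set cs) \<sigma>)) A"
proof -
  let ?B = "\<Pi>\<^sub>M j\<in>UNIV. borel :: real measure" and ?N = "\<Pi>\<^sub>M j\<in>(UNIV :: 'i set). stdN"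
  let ?Q = "PiM UNIV (normal_coords (set cs) \<sigma>)"
  interpret N: prob_space ?N by (rule prob_space_PiM_stdN)
  interpret Q: prob_space ?Q using \<sigma> by (intro prob_space_PiM prob_space_normal_coords)
  have sN[measurable_cong]: "sets ?N = sets ?B" by (rule sets_PiM_stdN)
  have sQ[measurable_cong]: "sets ?Q = sets ?B" by (intro sets_PiM_cong) simp_all
  let ?\<Phi> = "shift_coords (set cs) g"
  have [measurable]: "?\<Phi> \<in> ?B \<rightarrow>\<^sub>M ?B" by (intro measurable_shift_coords g)
  let ?E = "{z. ?\<Phi> z \<in> A}"
  have E[measurable]: "?E \<in> sets ?N"
  proof -
    have "?\<Phi> -` A \<inter> space ?B \<in> sets ?B" by measurable
    then show ?thesis by (simp add: vimage_def space_PiM sN)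
  qed
  \<comment> \<open>The logarithm of the true density of coordinate \<open>c\<close> over the target
    density of its shifted value; the constants ln (sqrt (2 pi)) cancel.\<close>
  define l where "l c z = ln (\<sigma> c) + (z c + g c z)\<^sup>2 / (2 * (\<sigma> c)\<^sup>2) - (z c)\<^sup>2 / 2" for c z
  define u where "u z = - (\<Sum>c\<in>set cs. l c z) + indicator ?E z * ln M" for z
  have l: "has_bochner_integral ?N (l c) (ln (\<sigma> c) + e c / (2 * (\<sigma> c)\<^sup>2) - 1 / 2)" if "c \<in> set cs" for c
  proof -
    note [measurable] = g[OF that]
    have "has_bochner_integral ?N (\<lambda>z. (z c + g c z)\<^sup>2) (e c)"
      using fin[OF that] e[OF that] by (intro has_bochner_integral_nn_integral) simp_all
    moreover have "has_bochner_integral ?N (\<lambda>z. (z c)\<^sup>2) 1"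
      using nn_integral_add_coord_square[of "\<lambda>_. 0" c 1] by (intro has_bochner_integral_nn_integral) simp_all
    moreover have "has_bochner_integral ?N (\<lambda>z. ln (\<sigma> c)) (ln (\<sigma> c))"
      by (simp add: has_bochner_integral_iff N.prob_space)
    ultimately show ?thesis unfolding l_def
      by (intro has_bochner_integral_diff has_bochner_integral_add has_bochner_integral_divide) simp_all
  qed
  have u: "has_bochner_integral ?N u (- (\<Sum>c\<in>set cs. ln (\<sigma> c) + e c / (2 * (\<sigma> c)\<^sup>2) - 1 / 2) + measure ?N ?E * ln M)"
    unfolding u_def
    by (intro has_bochner_integral_add has_bochner_integral_minus has_bochner_integral_sum l
        has_bochner_integral_mult_left)
       (use has_bochner_integral_real_indicator[OF E] in \<open>simp_all add: less_top[symmetric]\<close>)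
  let ?r = "\<lambda>z. \<Prod>c\<in>set cs. normal_density 0 (\<sigma> c) (z c + g c z) / std_normal_density (z c)"
  \<comment> \<open>The factor exp (indicator * ln M) is M on the event and 1 off it, so 1 + M *
    indicator dominates it. After integration the constant 1 cancels the 1 in u + 1 \<le> exp
    u.\<close>
  let ?w = "\<lambda>z. (1 + M * indicator A (?\<Phi> z)) * ?r z"
  have r0: "?r z \<ge> 0" for z by (intro prod_nonneg) (simp add: normal_density_nonneg)
  have "exp (- l c z) = normal_density 0 (\<sigma> c) (z c + g c z) / std_normal_density (z c)" for c z
  proof -
    have p: "normal_density 0 (\<sigma> c) (z c + g c z) > 0" "std_normal_density (z c) > 0"
      using \<sigma> by (simp_all add: normal_density_pos)
    have "- l c z = ln (normal_density 0 (\<sigma> c) (z c + g c z) / std_normal_density (z c))"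
      using p \<sigma> unfolding l_def by (subst ln_div) (auto simp: ln_std_normal_density ln_normal_density)
    then show ?thesis using p by simp
  qed
  then have exps: "exp (- (\<Sum>c\<in>set cs. l c z)) = ?r z" for z
    by (simp add: exp_sum sum_negf[symmetric])
  have le: "u z + 1 \<le> ?w z" for z
  proof -
    have "u z + 1 \<le> exp (u z)" using exp_ge_add_one_self[of "u z"] by linarith
    also have "\<dots> = ?r z * exp (indicator ?E z * ln M)" by (simp only: u_def exp_add exps)
    also have "\<dots> \<le> ?w z"
      using M r0[of z] by (subst mult.commute, intro mult_right_mono) (auto simp: indicator_def)
    finally show ?thesis .
  qed
  have wm[measurable]: "?w \<in> borel_measurable ?B" using g by simp
  have w0: "?w z \<ge> 0" for z using M r0 by (intro mult_nonneg_nonneg) auto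
  have "(\<integral>\<^sup>+ z. ennreal (?w z) \<partial>?N)
     = (\<integral>\<^sup>+ z. ennreal (1 + M * indicator A (?\<Phi> z)) * (\<Prod>c\<in>set cs. ennreal (normal_density 0 (\<sigma> c) (z c + g c z) / std_normal_density (z c))) \<partial>?N)"
    using M r0 by (intro nn_integral_cong) (subst ennreal_mult, auto simp: prod_ennreal normal_density_nonneg)
  also have "\<dots> = (\<integral>\<^sup>+ z. ennreal (1 + M * indicator A z) \<partial>?Q)"
    by (rule nn_integral_shift_coords[where \<sigma> = \<sigma> and cs = cs and g = g, OF \<sigma> g self tri dist]) simp_all
  also have "\<dots> = ennreal (1 + M * measure ?Q A)"
  proof -
    have "has_bochner_integral ?Q (\<lambda>z. 1 + M * indicator A z) (1 + M * measure ?Q A)"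
      by (intro has_bochner_integral_add has_bochner_integral_mult_right has_bochner_integral_real_indicator)
         (auto simp: has_bochner_integral_iff Q.prob_space less_top[symmetric])
    then show ?thesis using M by (subst nn_integral_eq_integral) (auto simp: has_bochner_integral_iff)
  qed
  finally have w: "has_bochner_integral ?N ?w (1 + M * measure ?Q A)"
    using w0 M by (intro has_bochner_integral_nn_integral) (simp_all add: measure_nonneg)
  have "has_bochner_integral ?N (\<lambda>z. u z + 1) (- (\<Sum>c\<in>set cs. ln (\<sigma> c) + e c / (2 * (\<sigma> c)\<^sup>2) - 1 / 2) + measure ?N ?E * ln M + 1)"
    by (intro has_bochner_integral_add u) (simp add: has_bochner_integral_iff N.prob_space)
  then have "- (\<Sum>c\<in>set cs. ln (\<sigma> c) + e c / (2 * (\<sigma> c)\<^sup>2) - 1 / 2) + measure ?N ?E * ln M + 1 \<le> 1 + M * measure ?Q A"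
    using w le by (auto simp: has_bochner_integral_iff dest!: integral_mono[where f = "\<lambda>z. u z + 1" and g = ?w])
  then show ?thesis by simp
qed

section \<open>Coded systems driven by noise\<close>

definition obs :: "(user \<Rightarrow> real) \<Rightarrow> (node \<Rightarrow> real) \<Rightarrow> (node \<Rightarrow> real) \<Rightarrow> node \<Rightarrow> real" where
  "obs h x \<zeta> a = (case a of
      Rly \<Rightarrow> h U1 * x (Usr U1) + h U2 * x (Usr U2) + h U3 * x (Usr U3) + \<zeta> Rly
    | Usr j \<Rightarrow> h j * x Rly + \<zeta> (Usr j))"

text \<open>The output map \<open>F\<close> is a parameter so that the same code can be run on two
  systems: \<open>obs h\<close> gives the real network, while in a cut argument \<open>F\<close>
  computes the outputs of the receiving side from innovations alone.\<close>

function signal :: "code \<Rightarrow> ((node \<Rightarrow> real) \<Rightarrow> (node \<Rightarrow> real) \<Rightarrow> node \<Rightarrow> real) \<Rightarrow> (user \<Rightarrow> user \<Rightarrow> nat)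
    \<Rightarrow> (node \<times> nat \<Rightarrow> real) \<Rightarrow> nat \<Rightarrow> node \<Rightarrow> real" where
  "signal c F m z t a = (case a of
      Rly \<Rightarrow> rel c t (\<lambda>s. if s < t then F (signal c F m z s) (\<lambda>b. z (b, s)) Rly else 0)
    | Usr j \<Rightarrow> enc c j t (m j) (\<lambda>s. if s < t then F (signal c F m z s) (\<lambda>b. z (b, s)) (Usr j) else 0))"
  by pat_completeness auto
termination by (relation "Wellfounded.measure (\<lambda>(c, F, m, z, t, a). t)") auto

declare signal.simps [simp del]

lemma xhist_eq_signal: "xhist c h m z n t = (if t < n then signal c (obs h) m z t else (\<lambda>a. 0))"
proof (induction n arbitrary: t)
  case (Suc n)
  have "(\<lambda>s. if s < n then yout h (xhist c h m z n) z a s else 0)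
      = (\<lambda>s. if s < n then obs h (signal c (obs h) m z s) (\<lambda>b. z (b, s)) a else 0)" for a
    by (auto simp: Suc yout_def obs_def fun_eq_iff split: node.split)
  then show ?case
    by (auto simp: Let_def Suc less_Suc_eq fun_eq_iff signal.simps[of c "obs h" m z n] split: node.split)
qed simp

lemma yseq_eq_obs:
  "yseq c h n m z a = (\<lambda>t. if t < n then obs h (signal c (obs h) m z t) (\<lambda>b. z (b, t)) a else 0)"
  by (auto simp: fun_eq_iff yseq_def yout_def obs_def xhist_eq_signal split: node.split)

text \<open>The two systems may differ outside \<open>S\<close> in messages, noise, output map and
  inputs; this is why \<open>out\<close> quantifies over all \<open>x'\<close> that agree on
  \<open>S\<close> only. It yields causality (with \<open>S = UNIV\<close>), independence of
  messages held outside \<open>S\<close>, and the identification of the innovation-driven system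
  with the network on \<open>S\<close>.\<close>

lemma signal_coupling:
  assumes msgs: "\<And>j. Usr j \<in> S \<Longrightarrow> m' j = m j"
    and out: "\<And>s a x'. s < t \<Longrightarrow> a \<in> S \<Longrightarrow> (\<And>b. b \<in> S \<Longrightarrow> x' b = signal c F m z s b) \<Longrightarrow>
        F' x' (\<lambda>b. z' (b, s)) a = F (signal c F m z s) (\<lambda>b. z (b, s)) a"
    and "a \<in> S"
  shows "signal c F' m' z' t a = signal c F m z t a"
  using out \<open>a \<in> S\<close>
proof (induction t arbitrary: a rule: less_induct)
  case (less t)
  have "(\<lambda>s. if s < t then F' (signal c F' m' z' s) (\<lambda>b. z' (b, s)) a else 0)
      = (\<lambda>s. if s < t then F (signal c F m z s) (\<lambda>b. z (b, s)) a else 0)"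
  proof
    fix s
    have "F' (signal c F' m' z' s) (\<lambda>b. z' (b, s)) a = F (signal c F m z s) (\<lambda>b. z (b, s)) a" if "s < t"
      by (rule less.prems(1)[OF that \<open>a \<in> S\<close>], rule less.IH[OF that])
         (use less.prems(1) that in \<open>force dest: less_trans\<close>)+
    then show "(if s < t then F' (signal c F' m' z' s) (\<lambda>b. z' (b, s)) a else 0)
      = (if s < t then F (signal c F m z s) (\<lambda>b. z (b, s)) a else 0)" by simp
  qed
  then show ?case
    using less.prems(2) msgs
    by (cases a) (simp_all add: signal.simps[of c F m z t] signal.simps[of c F' m' z' t] cong del: if_weak_cong)
qed

lemma signal_causal:
  assumes "\<And>b s. s < t \<Longrightarrow> z' (b, s) = z (b, s)"
  shows "signal c F m z' t = signal c F m z t"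
proof
  fix a show "signal c F m z' t a = signal c F m z t a"
  proof (rule signal_coupling[where S = UNIV])
    fix s a x' assume s: "s < t" and "\<And>b. b \<in> UNIV \<Longrightarrow> x' b = signal c F m z s b"
    then have "x' = signal c F m z s" by auto
    then show "F x' (\<lambda>b. z' (b, s)) a = F (signal c F m z s) (\<lambda>b. z (b, s)) a"
      using assms s by simp
  qed simp_all
qed

definition measurable_map :: "((node \<Rightarrow> real) \<Rightarrow> (node \<Rightarrow> real) \<Rightarrow> real) \<Rightarrow> bool" where
  "measurable_map f \<longleftrightarrow> (\<lambda>p. f (fst p) (snd p)) \<in> borel_measurable ((\<Pi>\<^sub>M b\<in>UNIV. borel) \<Otimes>\<^sub>M (\<Pi>\<^sub>M b\<in>UNIV. borel))"

lemma measurable_map_obs: "measurable_map (\<lambda>x \<zeta>. obs h x \<zeta> a)"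
  unfolding measurable_map_def obs_def by (cases a) simp_all

lemma measurable_signal_map:
  assumes f: "measurable_map f" and X: "\<And>b. (\<lambda>z. X z b) \<in> borel_measurable (\<Pi>\<^sub>M j\<in>UNIV. borel)"
  shows "(\<lambda>z. f (X z) (\<lambda>b. z (b, s))) \<in> borel_measurable (\<Pi>\<^sub>M j\<in>UNIV. borel)"
proof -
  have "(\<lambda>z. (X z, \<lambda>b. z (b, s))) \<in> (\<Pi>\<^sub>M j\<in>UNIV. borel) \<rightarrow>\<^sub>M (\<Pi>\<^sub>M b\<in>UNIV. borel) \<Otimes>\<^sub>M (\<Pi>\<^sub>M b\<in>UNIV. borel)"
    by (intro measurable_Pair measurable_PiM_single' X) simp_all
  from measurable_compose[OF this f[unfolded measurable_map_def]] show ?thesis by simp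
qed

lemma measurable_signal:
  assumes c: "code_measurable c" and F: "\<And>a. measurable_map (\<lambda>x \<zeta>. F x \<zeta> a)"
  shows "(\<lambda>z. signal c F m z t a) \<in> borel_measurable (\<Pi>\<^sub>M j\<in>UNIV. borel)"
proof (induction t arbitrary: a rule: less_induct)
  case (less t)
  have "(\<lambda>z. \<lambda>s. if s < t then F (signal c F m z s) (\<lambda>b. z (b, s)) a else 0)
      \<in> (\<Pi>\<^sub>M j\<in>UNIV. borel) \<rightarrow>\<^sub>M (\<Pi>\<^sub>M s\<in>UNIV. borel)"
  proof (rule measurable_PiM_single')
    fix s :: nat
    show "(\<lambda>z. if s < t then F (signal c F m z s) (\<lambda>b. z (b, s)) a else 0) \<in> borel_measurable (\<Pi>\<^sub>M j\<in>UNIV. borel)"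
      using measurable_signal_map[OF F less.IH] by (cases "s < t") simp_all
  qed simp
  note Y = measurable_compose[OF this]
  show ?case
  proof (cases a)
    case Rly
    with c Y[of "rel c t" borel] show ?thesis
      by (simp add: signal.simps[of c F m _ t] code_measurable_def cong del: if_weak_cong)
  next
    case (Usr j)
    with c Y[of "enc c j t (m j)" borel] show ?thesis
      by (simp add: signal.simps[of c F m _ t] code_measurable_def cong del: if_weak_cong)
  qed
qed

lemma measurable_yseq:
  assumes c: "code_measurable c" and F: "\<And>a. measurable_map (\<lambda>x \<zeta>. F x \<zeta> a)"
  shows "(\<lambda>z. \<lambda>t. if t < n then F (signal c F m z t) (\<lambda>b. z (b, t)) a else 0)
     \<in> (\<Pi>\<^sub>M j\<in>UNIV. borel) \<rightarrow>\<^sub>M (\<Pi>\<^sub>M s\<in>UNIV. borel)"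
proof (rule measurable_PiM_single')
  fix t :: nat
  show "(\<lambda>z. if t < n then F (signal c F m z t) (\<lambda>b. z (b, t)) a else 0) \<in> borel_measurable (\<Pi>\<^sub>M j\<in>UNIV. borel)"
    using measurable_signal_map[OF F measurable_signal[OF c F]] by (cases "t < n") simp_all
qed simp

section \<open>The message set and averages over it\<close>

lemma msize_pos: "msize n R j k > 0"
  by (simp add: msize_def)

lemma UNIV_user: "(UNIV :: user set) = {U1, U2, U3}"
  using user.exhaust by auto

instance user :: finite
  by standard (simp add: UNIV_user)

lemma UNIV_node: "(UNIV :: node set) = insert Rly (Usr ` UNIV)"
  using node.exhaust by auto

instance node :: finite
  by standard (simp add: UNIV_node)

lemma finite_Msgs: "finite (Msgs n R)"
proof (rule finite_subset)
  show "Msgs n R \<subseteq> (\<Pi>\<^sub>E j\<in>UNIV. \<Pi>\<^sub>E k\<in>UNIV. {..msize n R j k})"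
    by (auto simp: Msgs_def PiE_iff) (metis le0 less_imp_le)
qed (intro finite_PiE, auto)

lemma Msgs_nonempty: "Msgs n R \<noteq> {}"
proof -
  have "(\<lambda>j k. 0) \<in> Msgs n R" by (auto simp: Msgs_def msize_pos)
  then show ?thesis by blast
qed

lemma nn_integral_Omega:
  assumes f: "f \<in> borel_measurable (Omega n R)"
  shows "(\<integral>\<^sup>+ \<omega>. f \<omega> \<partial>Omega n R)
     = (\<Sum>m\<in>Msgs n R. \<integral>\<^sup>+ z. f (m, z) \<partial>(\<Pi>\<^sub>M i\<in>UNIV. stdN)) / ennreal (card (Msgs n R))"
proof -
  interpret N: prob_space "\<Pi>\<^sub>M i\<in>(UNIV :: (node \<times> nat) set). stdN" by (rule prob_space_PiM_stdN)
  have "(\<integral>\<^sup>+ \<omega>. f \<omega> \<partial>Omega n R) = (\<integral>\<^sup>+ m. \<integral>\<^sup>+ z. f (m, z) \<partial>(\<Pi>\<^sub>M i\<in>UNIV. stdN) \<partial>measure_pmf (pmf_of_set (Msgs n R)))"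
    using f unfolding Omega_def by (subst N.nn_integral_fst[symmetric]) simp_all
  also have "\<dots> = (\<Sum>m\<in>Msgs n R. \<integral>\<^sup>+ z. f (m, z) \<partial>(\<Pi>\<^sub>M i\<in>UNIV. stdN)) / ennreal (card (Msgs n R))"
    by (subst nn_integral_pmf_of_set[OF Msgs_nonempty finite_Msgs])
       (simp add: ennreal_of_nat_eq_real_of_nat)
  finally show ?thesis .
qed

lemma measurable_Omega:
  assumes "\<And>m. (\<lambda>z. f (m, z)) \<in> (\<Pi>\<^sub>M j\<in>UNIV. borel) \<rightarrow>\<^sub>M B"
  shows "f \<in> Omega n R \<rightarrow>\<^sub>M B"
proof -
  \<comment> \<open>Message matrices form a countable type because \<open>user\<close> is finite, so
    measurability can be checked for one matrix at a time.\<close>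
  have "f \<in> (count_space UNIV \<Otimes>\<^sub>M (\<Pi>\<^sub>M j\<in>UNIV. borel)) \<rightarrow>\<^sub>M B"
    using assms by (intro measurable_pair_measure_countable1) auto
  also have "measurable (count_space UNIV \<Otimes>\<^sub>M (\<Pi>\<^sub>M j\<in>UNIV. borel)) B = measurable (Omega n R) B"
    unfolding Omega_def by (intro measurable_cong_sets sets_pair_measure_cong) (simp_all add: sets_PiM_stdN)
  finally show ?thesis .
qed

section \<open>Cut-set bounds\<close>

text \<open>A decision \<open>D\<close> that ignores two entries of the message matrix is right
  about them for at most one pair of values, the other entries being fixed. Formally, overwriting
  the two entries of a correctly decoded matrix by an arbitrary pair is injective, because
  \<open>D\<close> restores what was overwritten.\<close>

lemma card_decodable_messages:
  fixes j\<^sub>1 k\<^sub>1 j\<^sub>2 k\<^sub>2 :: user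
  assumes d: "j\<^sub>1 \<noteq> k\<^sub>1" "j\<^sub>2 \<noteq> k\<^sub>2" "(j\<^sub>1, k\<^sub>1) \<noteq> (j\<^sub>2, k\<^sub>2)"
    and D: "\<And>m m'. (\<And>j k. (j, k) \<noteq> (j\<^sub>1, k\<^sub>1) \<Longrightarrow> (j, k) \<noteq> (j\<^sub>2, k\<^sub>2) \<Longrightarrow> m' j k = m j k) \<Longrightarrow> D m' = D m"
  shows "card {m \<in> Msgs n R. D m j\<^sub>1 k\<^sub>1 = m j\<^sub>1 k\<^sub>1 \<and> D m j\<^sub>2 k\<^sub>2 = m j\<^sub>2 k\<^sub>2} * (msize n R j\<^sub>1 k\<^sub>1 * msize n R j\<^sub>2 k\<^sub>2)
    \<le> card (Msgs n R)"
proof -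
  let ?E = "{m \<in> Msgs n R. D m j\<^sub>1 k\<^sub>1 = m j\<^sub>1 k\<^sub>1 \<and> D m j\<^sub>2 k\<^sub>2 = m j\<^sub>2 k\<^sub>2}"
  let ?A = "?E \<times> {..<msize n R j\<^sub>1 k\<^sub>1} \<times> {..<msize n R j\<^sub>2 k\<^sub>2}"
  define f where "f = (\<lambda>(m :: user \<Rightarrow> user \<Rightarrow> nat, a :: nat, b :: nat) j k.
    if (j, k) = (j\<^sub>1, k\<^sub>1) then a else if (j, k) = (j\<^sub>2, k\<^sub>2) then b else m j k)"
  have "inj_on f ?A"
  proof (rule inj_onI)
    fix x y assume x: "x \<in> ?A" and y: "y \<in> ?A" and eq: "f x = f y"
    obtain m a b m' a' b' where xy: "x = (m, a, b)" "y = (m', a', b')" by (metis prod_cases3)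
    have e: "f x j k = f y j k" for j k using eq by simp
    have off: "m' j k = m j k" if "(j, k) \<noteq> (j\<^sub>1, k\<^sub>1)" "(j, k) \<noteq> (j\<^sub>2, k\<^sub>2)" for j k
      using e[of j k] that by (auto simp: f_def xy split: if_splits)
    then have "D m' = D m" by (rule D)
    then have "m' j\<^sub>1 k\<^sub>1 = m j\<^sub>1 k\<^sub>1" "m' j\<^sub>2 k\<^sub>2 = m j\<^sub>2 k\<^sub>2" using x y by (simp_all add: xy)
    with off have "m' j k = m j k" for j k
      by (cases "(j, k) = (j\<^sub>1, k\<^sub>1)"; cases "(j, k) = (j\<^sub>2, k\<^sub>2)") auto
    then have "m' = m" by (intro ext)
    moreover have "a = a'" "b = b'"
      using e[of j\<^sub>1 k\<^sub>1] e[of j\<^sub>2 k\<^sub>2] d(3) by (auto simp: f_def xy split: if_splits)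
    ultimately show "x = y" by (simp add: xy)
  qed
  moreover have "f ` ?A \<subseteq> Msgs n R"
    using d by (auto simp: f_def Msgs_def)
  ultimately have "card ?A \<le> card (Msgs n R)"
    by (intro card_inj_on_le finite_Msgs)
  then show ?thesis by (simp add: card_cartesian_product)
qed

locale y_code =
  fixes c :: code and h :: "user \<Rightarrow> real" and P :: real and R :: "user \<Rightarrow> user \<Rightarrow> real" and n :: nat
  assumes meas: "code_measurable c"
    and pow: "power_ok c h P R n"
    and P_pos: "P > 0"
    and n_pos: "n > 0"
begin

abbreviation "noise \<equiv> \<Pi>\<^sub>M i\<in>(UNIV :: (node \<times> nat) set). stdN"
abbreviation "X \<equiv> signal c (obs h)"

lemma borel_signal: "(\<lambda>z. X m z t a) \<in> borel_measurable (\<Pi>\<^sub>M j\<in>UNIV. borel)"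
  by (intro measurable_signal meas measurable_map_obs)

lemma prob_Omega: "prob_space (Omega n R)"
proof -
  interpret N: prob_space noise by (rule prob_space_PiM_stdN)
  interpret pair_prob_space "measure_pmf (pmf_of_set (Msgs n R))" noise ..
  show ?thesis unfolding Omega_def by (rule prob_space_axioms)
qed

lemma decode_measurable [measurable]:
  assumes "Y \<in> M \<rightarrow>\<^sub>M (\<Pi>\<^sub>M s\<in>UNIV. borel)"
  shows "Measurable.pred M (\<lambda>z. dec c k w (Y z) j = i)"
proof -
  have "dec c k w \<in> (\<Pi>\<^sub>M s\<in>UNIV. borel) \<rightarrow>\<^sub>M count_space UNIV"
    using meas by (simp add: code_measurable_def)
  from measurable_compose[OF assms this] have "(\<lambda>z. dec c k w (Y z)) \<in> M \<rightarrow>\<^sub>M count_space UNIV" .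
  from measurable_compose[OF this, of "\<lambda>f. f j = i" "count_space UNIV"] show ?thesis by simp
qed

text \<open>A cut concerns only two of the six messages, so the event that every message is decoded
  correctly is relaxed to any \<open>G m\<close> containing it.\<close>

lemma one_minus_err_prob_le:
  assumes G: "\<And>m. G m \<in> sets (\<Pi>\<^sub>M j\<in>UNIV. borel)"
    and sub: "\<And>m z. (\<And>j k. j \<noteq> k \<Longrightarrow> dec c k (m k) (yseq c h n m z (Usr k)) j = m j k) \<Longrightarrow> z \<in> G m"
  shows "(1 - err_prob c h R n) * card (Msgs n R) \<le> (\<Sum>m\<in>Msgs n R. measure noise (G m))"
proof -
  interpret N: prob_space noise by (rule prob_space_PiM_stdN)
  interpret O: prob_space "Omega n R" by (rule prob_Omega)
  let ?Err = "{\<omega> \<in> space (Omega n R). \<exists>j k. j \<noteq> k \<and>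
        dec c k (fst \<omega> k) (yseq c h n (fst \<omega>) (snd \<omega>) (Usr k)) j \<noteq> fst \<omega> j k}"
  have "Measurable.pred (Omega n R) (\<lambda>\<omega>. \<exists>j k. j \<noteq> k \<and>
        dec c k (fst \<omega> k) (yseq c h n (fst \<omega>) (snd \<omega>) (Usr k)) j \<noteq> fst \<omega> j k)"
  proof (rule measurable_Omega)
    fix m
    have [measurable]: "(\<lambda>z. yseq c h n m z a) \<in> (\<Pi>\<^sub>M j\<in>UNIV. borel) \<rightarrow>\<^sub>M (\<Pi>\<^sub>M s\<in>UNIV. borel)" for a
      unfolding yseq_eq_obs by (intro measurable_yseq meas measurable_map_obs)
    show "Measurable.pred (\<Pi>\<^sub>M j\<in>UNIV. borel) (\<lambda>z. \<exists>j k. j \<noteq> k \<and>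
        dec c k (fst (m, z) k) (yseq c h n (fst (m, z)) (snd (m, z)) (Usr k)) j \<noteq> fst (m, z) j k)"
      by simp
  qed
  then have Err: "?Err \<in> O.events" by (simp add: pred_def)
  let ?G = "{\<omega> \<in> space (Omega n R). snd \<omega> \<in> G (fst \<omega>)}"
  have Gm: "Measurable.pred (Omega n R) (\<lambda>\<omega>. snd \<omega> \<in> G (fst \<omega>))"
    by (rule measurable_Omega) (use G in simp)
  then have Gs: "?G \<in> O.events" by (simp add: pred_def)
  have "1 - err_prob c h R n = O.prob (space (Omega n R) - ?Err)"
    unfolding err_prob_def by (rule O.prob_compl[OF Err, symmetric])
  also have "\<dots> \<le> O.prob ?G"
    by (rule O.finite_measure_mono[OF _ Gs]) (use sub in auto)
  finally have le: "1 - err_prob c h R n \<le> O.prob ?G" .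
  have c0: "card (Msgs n R) > 0" using finite_Msgs Msgs_nonempty by (simp add: card_gt_0_iff)
  have "ennreal (O.prob ?G) = (\<integral>\<^sup>+ \<omega>. indicator ?G \<omega> \<partial>Omega n R)"
    using Gs by (simp add: O.emeasure_eq_measure)
  also have "\<dots> = (\<integral>\<^sup>+ \<omega>. indicator (G (fst \<omega>)) (snd \<omega>) \<partial>Omega n R)"
    by (intro nn_integral_cong) (auto simp: indicator_def)
  also have "\<dots> = (\<Sum>m\<in>Msgs n R. \<integral>\<^sup>+ z. indicator (G (fst (m, z))) (snd (m, z)) \<partial>noise) / ennreal (card (Msgs n R))"
    using G by (intro nn_integral_Omega measurable_Omega) simp_all
  also have "\<dots> = ennreal ((\<Sum>m\<in>Msgs n R. measure noise (G m)) / card (Msgs n R))"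
    using G c0 by (simp add: sets_PiM_stdN N.emeasure_eq_measure sum_nonneg divide_ennreal)
  finally have "O.prob ?G = (\<Sum>m\<in>Msgs n R. measure noise (G m)) / card (Msgs n R)"
    by (simp add: sum_nonneg)
  with le c0 show ?thesis by (simp add: field_simps)
qed

text \<open>\<open>S\<close> is the receiving side of the cut. The shifts \<open>sh\<close> turn the noise at the nodes \<open>qs\<close> into
  innovations from which \<open>S\<close> can run its part of the network through the maps \<open>F\<close> alone.\<close>
lemma cut_bound:
  fixes S :: "node set" and F :: "(node \<Rightarrow> real) \<Rightarrow> (node \<Rightarrow> real) \<Rightarrow> node \<Rightarrow> real"
    and sh :: "node \<Rightarrow> (node \<Rightarrow> real) \<Rightarrow> (node \<Rightarrow> real) \<Rightarrow> real" and \<sigma> :: "node \<Rightarrow> real"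
  assumes rx: "Usr k\<^sub>1 \<in> S" "Usr k\<^sub>2 \<in> S" and tx: "Usr j\<^sub>1 \<notin> S" "Usr j\<^sub>2 \<notin> S"
    and neq: "(j\<^sub>1, k\<^sub>1) \<noteq> (j\<^sub>2, k\<^sub>2)"
    and F: "\<And>a. measurable_map (\<lambda>x \<zeta>. F x \<zeta> a)"
    and sh: "\<And>q. q \<in> set qs \<Longrightarrow> measurable_map (sh q)"
    and self: "\<And>q x \<zeta> y. q \<in> set qs \<Longrightarrow> sh q x (\<zeta>(q := y)) = sh q x \<zeta>"
    and tri: "sorted_wrt (\<lambda>q r. \<forall>x \<zeta> y. sh q x (\<zeta>(r := y)) = sh q x \<zeta>) qs"
    and dist: "distinct qs"
    and F_local: "\<And>a x x' \<zeta>. a \<in> S \<Longrightarrow> (\<And>b. b \<in> S \<Longrightarrow> x' b = x b) \<Longrightarrow> F x' \<zeta> a = F x \<zeta> a"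
    and F_obs: "\<And>a x \<zeta>. a \<in> S \<Longrightarrow> F x (\<lambda>b. if b \<in> set qs then \<zeta> b + sh b x \<zeta> else \<zeta> b) a = obs h x \<zeta> a"
    and \<sigma>: "\<And>q. \<sigma> q > 0"
    and power: "\<And>q. q \<in> set qs \<Longrightarrow>
      (\<Sum>m\<in>Msgs n R. \<Sum>t<n. \<integral>\<^sup>+ z. ennreal ((z (q, t) + sh q (X m z t) (\<lambda>b. z (b, t)))\<^sup>2) \<partial>noise)
        \<le> ennreal (card (Msgs n R) * (n * (\<sigma> q)\<^sup>2))"
  shows "(1 - err_prob c h R n) * ln (msize n R j\<^sub>1 k\<^sub>1 * msize n R j\<^sub>2 k\<^sub>2) \<le> n * (\<Sum>q\<in>set qs. ln (\<sigma> q)) + 1"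
proof -
  interpret N: prob_space noise by (rule prob_space_PiM_stdN)
  let ?B = "\<Pi>\<^sub>M j\<in>(UNIV :: (node \<times> nat) set). borel :: real measure"
  let ?K = "Msgs n R"
  define M where "M = real (msize n R j\<^sub>1 k\<^sub>1 * msize n R j\<^sub>2 k\<^sub>2)"
  have "1 \<le> msize n R j\<^sub>1 k\<^sub>1 * msize n R j\<^sub>2 k\<^sub>2" using msize_pos by (simp add: Suc_le_eq)
  then have M: "M \<ge> 1" unfolding M_def by (subst of_nat_1[symmetric], subst of_nat_le_iff)
  \<comment> \<open>Ordered by time, and within one time as in \<open>qs\<close>. A shift at time t
    reads the noise before t through the inputs, and at time t only the nodes that precede it in
    \<open>qs\<close>; this is what makes the shifts triangular.\<close>
  define cs where "cs = concat (map (\<lambda>t. map (\<lambda>q. (q, t)) qs) [0..<n])"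
  have set_cs: "set cs = set qs \<times> {..<n}" by (auto simp: cs_def)
  define g where "g m = (\<lambda>(q, t) z. sh q (X m z t) (\<lambda>b. z (b, t)))" for m
  define \<sigma>' where "\<sigma>' = (\<lambda>(q :: node, t :: nat). \<sigma> q)"
  let ?Q = "PiM UNIV (normal_coords (set cs) \<sigma>')"
  interpret Q: prob_space ?Q using \<sigma> by (intro prob_space_PiM prob_space_normal_coords) (auto simp: \<sigma>'_def)
  have sQ[measurable_cong]: "sets ?Q = sets ?B" by (intro sets_PiM_cong) simp_all
  have g: "g m d \<in> borel_measurable ?B" if cs: "d \<in> set cs" for m d
  proof -
    obtain q t where d: "d = (q, t)" "q \<in> set qs" using cs by (auto simp: set_cs)
    then show ?thesis using measurable_signal_map[OF sh[OF d(2)] borel_signal] by (simp add: g_def)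
  qed
  \<comment> \<open>The inputs at time t ignore the noise at time t as well, since they use strictly
    earlier outputs.\<close>
  have causal: "X m (z((r, t') := y)) t = X m z t" if "t \<le> t'" for m z r t t' y
    by (rule signal_causal) (use that in auto)
  have gself: "g m d (z(d := y)) = g m d z" if cs: "d \<in> set cs" for m d z y
  proof -
    obtain q t where d: "d = (q, t)" "q \<in> set qs" using cs by (auto simp: set_cs)
    have "(\<lambda>b. (z(d := y)) (b, t)) = (\<lambda>b. z (b, t))(q := y)" by (auto simp: d)
    then show ?thesis using self[OF d(2)] causal[of t t m z q y] by (simp add: g_def d)
  qed
  have gtri: "sorted_wrt (\<lambda>d e. \<forall>z y. g m d (z(e := y)) = g m d z) cs" for m
    unfolding cs_def
  proof (induction n)
    case (Suc n)
    have "sorted_wrt (\<lambda>d e. \<forall>z y. g m d (z(e := y)) = g m d z) (map (\<lambda>q. (q, n)) qs)"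
      unfolding sorted_wrt_map
    proof (rule sorted_wrt_mono_rel[OF _ tri])
      fix q r assume *: "\<forall>x \<zeta> y. sh q x (\<zeta>(r := y)) = sh q x \<zeta>"
      have "(\<lambda>b. (z((r, n) := y)) (b, n)) = (\<lambda>b. z (b, n))(r := y)" for z :: "node \<times> nat \<Rightarrow> real" and y by auto
      then show "\<forall>z y. g m (q, n) (z((r, n) := y)) = g m (q, n) z"
        using * causal[of n n m] by (simp add: g_def)
    qed
    moreover have "g m (q, t) (z((r, n) := y)) = g m (q, t) z" if "t < n" for q r t z y
      using that causal[of t n m z r y] by (simp add: g_def)
    ultimately show ?case using Suc by (auto simp: sorted_wrt_append fun_upd_def)
  qed simp
  have dcs: "distinct cs"
    unfolding cs_def by (induction n) (auto simp: distinct_map dist inj_on_def)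
  \<comment> \<open>Here \<open>v\<close> stands for the innovations, and \<open>Y m v k\<close> for
    what user \<open>k\<close> sees when the code is driven by them. Under \<open>?Q\<close> the law
    of \<open>v\<close> is the same for all messages, and for receivers in \<open>S\<close> the
    value ignores messages held outside \<open>S\<close>.\<close>
  define Y where "Y m v k = (\<lambda>t. if t < n then F (signal c F m v t) (\<lambda>b. v (b, t)) (Usr k) else 0)" for m v k
  have Ym[measurable]: "(\<lambda>v. Y m v k) \<in> ?B \<rightarrow>\<^sub>M (\<Pi>\<^sub>M s\<in>UNIV. borel)" for m k
    unfolding Y_def by (intro measurable_yseq meas F)
  define D where "D v m j k = dec c k (m k) (Y m v k) j" for v m j k
  define A where "A m = {v. D v m j\<^sub>1 k\<^sub>1 = m j\<^sub>1 k\<^sub>1 \<and> D v m j\<^sub>2 k\<^sub>2 = m j\<^sub>2 k\<^sub>2}" for m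
  have A: "A m \<in> sets ?B" for m
  proof -
    have "Measurable.pred ?B (\<lambda>v. D v m j\<^sub>1 k\<^sub>1 = m j\<^sub>1 k\<^sub>1 \<and> D v m j\<^sub>2 k\<^sub>2 = m j\<^sub>2 k\<^sub>2)"
      unfolding D_def by simp
    then show ?thesis by (simp add: A_def pred_def space_PiM)
  qed
  have Y_local: "Y m' v k = Y m v k" if "Usr k \<in> S" "\<And>j. Usr j \<in> S \<Longrightarrow> m' j = m j" for m m' v k
  proof -
    have "signal c F m' v t a = signal c F m v t a" if "a \<in> S" for t a
      by (rule signal_coupling[OF _ _ that]) (auto simp: \<open>\<And>j. Usr j \<in> S \<Longrightarrow> m' j = m j\<close> intro!: F_local)
    then have "F (signal c F m' v t) (\<lambda>b. v (b, t)) (Usr k) = F (signal c F m v t) (\<lambda>b. v (b, t)) (Usr k)" for t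
      by (intro F_local that(1)) auto
    then show ?thesis by (simp add: Y_def cong del: if_weak_cong)
  qed
  let ?\<Phi> = "\<lambda>m. shift_coords (set cs) (g m)"
  have Y_obs: "Y m (?\<Phi> m z) k = yseq c h n m z (Usr k)" if k: "Usr k \<in> S" for m z k
  proof -
    have \<Phi>: "(\<lambda>b. ?\<Phi> m z (b, s)) = (\<lambda>b. if b \<in> set qs then z (b, s) + sh b (X m z s) (\<lambda>b. z (b, s)) else z (b, s))"
      if "s < n" for s using that by (auto simp: shift_coords_def set_cs g_def)
    have step: "F x' (\<lambda>b. ?\<Phi> m z (b, s)) a = obs h (X m z s) (\<lambda>b. z (b, s)) a"
      if "s < n" "a \<in> S" "\<And>b. b \<in> S \<Longrightarrow> x' b = X m z s b" for s a x'
      using F_local[OF that(2,3)] F_obs[OF that(2)] by (simp add: \<Phi>[OF that(1)])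
    have "signal c F m (?\<Phi> m z) t a = X m z t a" if "t < n" "a \<in> S" for t a
      by (rule signal_coupling[where S = S]) (use that in \<open>auto intro!: step\<close>)
    then show ?thesis
      unfolding Y_def yseq_eq_obs by (intro ext) (auto intro!: step k)
  qed
  \<comment> \<open>Counting is done for each fixed \<open>v\<close>, where the decisions across the
    cut do not depend on the crossing messages; the result is then integrated under
    \<open>?Q\<close>.\<close>
  have sum_A: "M * (\<Sum>m\<in>?K. measure ?Q (A m)) \<le> card ?K"
  proof -
    have pt: "M * (\<Sum>m\<in>?K. indicator (A m) v) \<le> card ?K" for v
    proof -
      \<comment> \<open>The counting lemma compares decisions as whole functions. A node outside
        \<open>S\<close> may use the crossing messages in its own decoder, so the decisions of all
        users other than the two receivers are set to 0.\<close>
      define D' where "D' m j k = (if k = k\<^sub>1 \<or> k = k\<^sub>2 then D v m j k else 0)" for m j k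
      have "card {m \<in> ?K. D' m j\<^sub>1 k\<^sub>1 = m j\<^sub>1 k\<^sub>1 \<and> D' m j\<^sub>2 k\<^sub>2 = m j\<^sub>2 k\<^sub>2} * (msize n R j\<^sub>1 k\<^sub>1 * msize n R j\<^sub>2 k\<^sub>2) \<le> card ?K"
      proof (rule card_decodable_messages)
        show "j\<^sub>1 \<noteq> k\<^sub>1" "j\<^sub>2 \<noteq> k\<^sub>2" using rx tx by auto
        show "(j\<^sub>1, k\<^sub>1) \<noteq> (j\<^sub>2, k\<^sub>2)" by (rule neq)
        fix m m' :: "user \<Rightarrow> user \<Rightarrow> nat"
        assume *: "\<And>j k. (j, k) \<noteq> (j\<^sub>1, k\<^sub>1) \<Longrightarrow> (j, k) \<noteq> (j\<^sub>2, k\<^sub>2) \<Longrightarrow> m' j k = m j k"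
        have eq: "m' j = m j" if "Usr j \<in> S" for j
          using that tx by (intro ext *) auto
        have "D v m' j k = D v m j k" if "k = k\<^sub>1 \<or> k = k\<^sub>2" for j k
          using that rx eq Y_local[of k m' m v] by (auto simp: D_def)
        then show "D' m' = D' m" by (auto simp: fun_eq_iff D'_def)
      qed
      then have "card {m \<in> ?K. D v m j\<^sub>1 k\<^sub>1 = m j\<^sub>1 k\<^sub>1 \<and> D v m j\<^sub>2 k\<^sub>2 = m j\<^sub>2 k\<^sub>2} * (msize n R j\<^sub>1 k\<^sub>1 * msize n R j\<^sub>2 k\<^sub>2) \<le> card ?K"
        by (simp add: D'_def)
      moreover have "(\<Sum>m\<in>?K. indicator (A m) v) = real (card {m \<in> ?K. D v m j\<^sub>1 k\<^sub>1 = m j\<^sub>1 k\<^sub>1 \<and> D v m j\<^sub>2 k\<^sub>2 = m j\<^sub>2 k\<^sub>2})"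
        by (simp add: A_def indicator_def sum.If_cases finite_Msgs Int_def)
      ultimately show ?thesis unfolding M_def by (simp only: of_nat_mult[symmetric] of_nat_le_iff mult.commute)
    qed
    have b: "has_bochner_integral ?Q (\<lambda>v. M * (\<Sum>m\<in>?K. indicator (A m) v)) (M * (\<Sum>m\<in>?K. measure ?Q (A m)))"
      using A by (intro has_bochner_integral_mult_right has_bochner_integral_sum has_bochner_integral_real_indicator)
        (simp_all add: sQ less_top[symmetric])
    have "(\<integral>v. M * (\<Sum>m\<in>?K. indicator (A m) v) \<partial>?Q) \<le> (\<integral>v. real (card ?K) \<partial>?Q)"
      using b pt by (intro integral_mono) (auto simp: has_bochner_integral_iff)
    then show ?thesis using b M by (auto simp: has_bochner_integral_iff Q.prob_space)
  qed
  let ?I = "\<lambda>m q t. \<integral>\<^sup>+ z. ennreal ((z (q, t) + sh q (X m z t) (\<lambda>b. z (b, t)))\<^sup>2) \<partial>noise"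
  \<comment> \<open>\<open>enn2real\<close> would turn an infinite moment into 0; fact
    \<open>I\<close> excludes this where \<open>e\<close> is used, because the power bound controls
    the sum of all these nonnegative moments.\<close>
  define e where "e m = (\<lambda>(q, t). enn2real (?I m q t))" for m
  have e0: "e m d \<ge> 0" for m d by (simp add: e_def case_prod_unfold)
  have I: "?I m q t = ennreal (e m (q, t))" if "m \<in> ?K" "q \<in> set qs" "t < n" for m q t
  proof -
    have "?I m q t \<le> (\<Sum>t<n. ?I m q t)" using that by (intro member_le_sum) auto
    also have "\<dots> \<le> (\<Sum>m\<in>?K. \<Sum>t<n. ?I m q t)"
      using that finite_Msgs by (intro member_le_sum[of m ?K "\<lambda>m. \<Sum>t<n. ?I m q t"]) auto
    also have "\<dots> < \<top>" using power[OF that(2)] by (rule le_less_trans) simp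
    finally show ?thesis by (simp add: e_def)
  qed
  have bnd: "measure noise {z. ?\<Phi> m z \<in> A m} * ln M
    \<le> (\<Sum>d\<in>set cs. ln (\<sigma>' d) + e m d / (2 * (\<sigma>' d)\<^sup>2) - 1 / 2) + M * measure ?Q (A m)" if m: "m \<in> ?K" for m
  proof (rule information_density_bound[where cs = cs and g = "g m" and \<sigma> = \<sigma>' and e = "e m", OF _ g gself gtri dcs A M _ e0])
    show "\<sigma>' d > 0" for d using \<sigma> by (cases d) (simp add: \<sigma>'_def)
    show "(\<integral>\<^sup>+ z. ennreal ((z d + g m d z)\<^sup>2) \<partial>noise) = ennreal (e m d)" if "d \<in> set cs" for d
      using that I[OF m] by (auto simp: set_cs g_def)
  qed
  have esum: "(\<Sum>m\<in>?K. \<Sum>t<n. e m (q, t)) \<le> card ?K * (n * (\<sigma> q)\<^sup>2)" if "q \<in> set qs" for q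
  proof -
    have "(\<Sum>m\<in>?K. \<Sum>t<n. ?I m q t) = (\<Sum>m\<in>?K. \<Sum>t<n. ennreal (e m (q, t)))"
      by (intro sum.cong refl I that) auto
    also have "\<dots> = ennreal (\<Sum>m\<in>?K. \<Sum>t<n. e m (q, t))"
      by (simp add: e0 sum_nonneg)
    finally show ?thesis using power[OF that] by (simp add: ennreal_le_iff)
  qed
  have "(\<Sum>m\<in>?K. \<Sum>d\<in>set cs. ln (\<sigma>' d) + e m d / (2 * (\<sigma>' d)\<^sup>2) - 1 / 2)
      = (\<Sum>m\<in>?K. \<Sum>q\<in>set qs. \<Sum>t<n. ln (\<sigma> q) + e m (q, t) / (2 * (\<sigma> q)\<^sup>2) - 1 / 2)"
    unfolding set_cs sum.cartesian_product \<sigma>'_def by (simp add: case_prod_unfold)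
  also have "\<dots> = (\<Sum>q\<in>set qs. \<Sum>m\<in>?K. \<Sum>t<n. ln (\<sigma> q) + e m (q, t) / (2 * (\<sigma> q)\<^sup>2) - 1 / 2)"
    by (rule sum.swap)
  also have "\<dots> = (\<Sum>q\<in>set qs. card ?K * n * ln (\<sigma> q) + (\<Sum>m\<in>?K. \<Sum>t<n. e m (q, t)) / (2 * (\<sigma> q)\<^sup>2) - card ?K * n / 2)"
    by (simp add: sum.distrib sum_subtractf sum_divide_distrib mult.assoc)
  \<comment> \<open>The target variance bounds the averaged second moment of the innovation, so the
    quadratic terms average to at most 1/2 and are absorbed by the -1/2. Only ln \<sigma>
    survives.\<close>
  also have "\<dots> \<le> (\<Sum>q\<in>set qs. card ?K * n * ln (\<sigma> q))"
  proof (rule sum_mono)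
    fix q assume "q \<in> set qs"
    then have "(\<Sum>m\<in>?K. \<Sum>t<n. e m (q, t)) / (2 * (\<sigma> q)\<^sup>2) \<le> (card ?K * (n * (\<sigma> q)\<^sup>2)) / (2 * (\<sigma> q)\<^sup>2)"
      using esum by (intro divide_right_mono) auto
    also have "\<dots> = card ?K * n / 2" using \<sigma>[of q] by (simp add: field_simps)
    finally show "card ?K * n * ln (\<sigma> q) + (\<Sum>m\<in>?K. \<Sum>t<n. e m (q, t)) / (2 * (\<sigma> q)\<^sup>2) - card ?K * n / 2
      \<le> card ?K * n * ln (\<sigma> q)" by simp
  qed
  finally have div: "(\<Sum>m\<in>?K. \<Sum>d\<in>set cs. ln (\<sigma>' d) + e m d / (2 * (\<sigma>' d)\<^sup>2) - 1 / 2)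
      \<le> card ?K * (n * (\<Sum>q\<in>set qs. ln (\<sigma> q)))" by (simp add: sum_distrib_left mult.assoc)
  have "(1 - err_prob c h R n) * card ?K \<le> (\<Sum>m\<in>?K. measure noise {z. ?\<Phi> m z \<in> A m})"
  proof (rule one_minus_err_prob_le)
    fix m
    have "?\<Phi> m \<in> ?B \<rightarrow>\<^sub>M ?B" by (intro measurable_shift_coords g)
    from measurable_sets[OF this A] show "{z. ?\<Phi> m z \<in> A m} \<in> sets ?B"
      by (simp add: vimage_def space_PiM)
    fix z assume ok: "\<And>j k. j \<noteq> k \<Longrightarrow> dec c k (m k) (yseq c h n m z (Usr k)) j = m j k"
    have "j\<^sub>1 \<noteq> k\<^sub>1" "j\<^sub>2 \<noteq> k\<^sub>2" using rx tx by auto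
    then show "z \<in> {z. ?\<Phi> m z \<in> A m}"
      using ok rx by (simp add: A_def D_def Y_obs)
  qed
  then have "(1 - err_prob c h R n) * card ?K * ln M \<le> (\<Sum>m\<in>?K. measure noise {z. ?\<Phi> m z \<in> A m}) * ln M"
    using M by (intro mult_right_mono) auto
  also have "\<dots> \<le> (\<Sum>m\<in>?K. (\<Sum>d\<in>set cs. ln (\<sigma>' d) + e m d / (2 * (\<sigma>' d)\<^sup>2) - 1 / 2) + M * measure ?Q (A m))"
    unfolding sum_distrib_right by (intro sum_mono bnd)
  \<comment> \<open>By \<open>sum_A\<close> the terms M * Q(A) amount to at most 1 per message on
    average; this is the additive 1 in the conclusion.\<close>
  also have "\<dots> \<le> card ?K * (n * (\<Sum>q\<in>set qs. ln (\<sigma> q))) + card ?K"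
    using div sum_A by (simp add: sum.distrib sum_distrib_left)
  finally have "card ?K * ((1 - err_prob c h R n) * ln M) \<le> card ?K * (n * (\<Sum>q\<in>set qs. ln (\<sigma> q)) + 1)"
    by (simp add: algebra_simps)
  moreover have "card ?K > 0" using finite_Msgs Msgs_nonempty by (simp add: card_gt_0_iff)
  ultimately show ?thesis by (simp add: M_def)
qed

end

text \<open>Two outputs a X + Z and c X + Z', with X of power P and independent unit noises, have a
  covariance matrix of determinant (1 + a^2 P)(1 + c^2 P) - (a c P)^2. The left side is the same
  determinant, written as the variance of the first output times the residual variance of the second
  after regression with coefficient b.\<close>

lemma regression_identity:
  fixes a c P :: real
  assumes "P > 0"
  defines "b \<equiv> c * a * P / (1 + a\<^sup>2 * P)"
  shows "(1 + a\<^sup>2 * P) * (1 + b\<^sup>2 + (c - b * a)\<^sup>2 * P) = 1 + a\<^sup>2 * P + c\<^sup>2 * P"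
proof -
  have "1 + a\<^sup>2 * P > 0" using assms(1) by (simp add: add_pos_nonneg)
  then have bb: "b * (1 + a\<^sup>2 * P) = c * a * P" by (simp add: b_def)
  have "(1 + a\<^sup>2 * P) * (1 + b\<^sup>2 + (c - b * a)\<^sup>2 * P)
     = (1 + a\<^sup>2 * P) * (1 + c\<^sup>2 * P) - 2 * (b * (1 + a\<^sup>2 * P)) * (c * a * P) + (b * (1 + a\<^sup>2 * P))\<^sup>2"
    by (simp add: power2_eq_square algebra_simps)
  then show ?thesis unfolding bb by (simp add: power2_eq_square algebra_simps)
qed

lemma obs_Rly:
  assumes "j \<noteq> k" "j \<noteq> l" "k \<noteq> l"
  shows "obs h x \<zeta> Rly = h j * x (Usr j) + h k * x (Usr k) + h l * x (Usr l) + \<zeta> Rly"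
  using assms by (cases j; cases k; cases l) (simp_all add: obs_def)

lemma obs_Usr: "obs h x \<zeta> (Usr j) = h j * x Rly + \<zeta> (Usr j)"
  by (simp add: obs_def)

section \<open>Averaged second moments of the inputs and the individual cuts\<close>

context y_code
begin

text \<open>Uncentred, and averaged over messages and time jointly, since only this average enters
  the innovation variances.\<close>

definition correlation :: "node \<Rightarrow> node \<Rightarrow> real" where
  "correlation a b = (\<Sum>m\<in>Msgs n R. \<Sum>t<n. \<integral>z. X m z t a * X m z t b \<partial>noise) / (card (Msgs n R) * n)"

lemma correlation_commute: "correlation a b = correlation b a"
  by (simp add: correlation_def mult.commute)

lemma card_Msgs_pos: "card (Msgs n R) > 0"
  using finite_Msgs Msgs_nonempty by (simp add: card_gt_0_iff)

lemma borel_signal_noise [measurable]: "(\<lambda>z. X m z t a) \<in> borel_measurable noise"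
  using borel_signal by (simp add: sets_PiM_stdN cong: measurable_cong_sets)

lemma signal_fun_upd: "t \<le> s \<Longrightarrow> X m (z((q, s) := y)) t = X m z t"
  by (rule signal_causal) auto

lemma total_power_le:
  "(\<Sum>m\<in>Msgs n R. \<Sum>t<n. \<integral>\<^sup>+ z. ennreal ((X m z t a)\<^sup>2) \<partial>noise) \<le> ennreal (card (Msgs n R) * (n * P))"
proof -
  let ?K = "Msgs n R"
  let ?I = "\<lambda>m t. \<integral>\<^sup>+ z. ennreal ((X m z t a)\<^sup>2) \<partial>noise"
  have "(\<integral>\<^sup>+ \<omega>. ennreal ((xhist c h (fst \<omega>) (snd \<omega>) n t a)\<^sup>2) \<partial>Omega n R) = (\<Sum>m\<in>?K. ?I m t) / ennreal (card ?K)"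
    if "t < n" for t
    using that borel_signal unfolding xhist_eq_signal
    by (subst nn_integral_Omega) (auto intro!: measurable_Omega)
  then have "(\<Sum>t<n. \<integral>\<^sup>+ \<omega>. ennreal ((xhist c h (fst \<omega>) (snd \<omega>) n t a)\<^sup>2) \<partial>Omega n R)
      = (\<Sum>t<n. (\<Sum>m\<in>?K. ?I m t) / ennreal (card ?K))" by simp
  also have "\<dots> = (\<Sum>m\<in>?K. \<Sum>t<n. ?I m t) / ennreal (card ?K)"
    by (subst sum.swap) (simp add: divide_ennreal_def sum_distrib_right)
  finally have "(\<Sum>m\<in>?K. \<Sum>t<n. ?I m t) / ennreal (card ?K) \<le> ennreal (n * P)"
    using pow[unfolded power_ok_def, rule_format, of a] by simp
  then have "(\<Sum>m\<in>?K. \<Sum>t<n. ?I m t) / ennreal (card ?K) * ennreal (card ?K) \<le> ennreal (n * P) * ennreal (card ?K)"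
    by (rule mult_right_mono) simp
  moreover have "x / ennreal (card ?K) * ennreal (card ?K) = x" for x
    using card_Msgs_pos by (simp add: ennreal_divide_times ennreal_divide_self mult.commute ennreal_mult_divide_eq ennreal_times_divide)
  ultimately show ?thesis using P_pos by (simp add: ennreal_mult mult.commute)
qed

lemma square_integrable_signal:
  assumes "m \<in> Msgs n R" "t < n"
  shows "integrable noise (\<lambda>z. (X m z t a)\<^sup>2)"
proof -
  let ?I = "\<lambda>m t. \<integral>\<^sup>+ z. ennreal ((X m z t a)\<^sup>2) \<partial>noise"
  have "?I m t \<le> (\<Sum>t<n. ?I m t)" using assms by (intro member_le_sum) auto
  also have "\<dots> \<le> (\<Sum>m\<in>Msgs n R. \<Sum>t<n. ?I m t)"
    using assms finite_Msgs by (intro member_le_sum[of m "Msgs n R" "\<lambda>m. \<Sum>t<n. ?I m t"]) auto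
  also have "\<dots> < \<top>" using total_power_le by (rule le_less_trans) simp
  finally show ?thesis by (intro integrableI_nonneg) auto
qed

text \<open>The individual powers are replaced by their bound P, whereas the cross term is kept
  exactly, so that all cuts refer to the same \<open>correlation\<close>. Nonnegativity of the
  resulting form makes its square roots and logarithms meaningful and bounds the correlation by
  P.\<close>

lemma linear_power:
  shows linear_power_le: "(\<Sum>m\<in>Msgs n R. \<Sum>t<n. \<integral>\<^sup>+ z. ennreal ((\<alpha> * X m z t a + \<beta> * X m z t b)\<^sup>2) \<partial>noise)
     \<le> ennreal (card (Msgs n R) * (n * (\<alpha>\<^sup>2 * P + 2 * \<alpha> * \<beta> * correlation a b + \<beta>\<^sup>2 * P)))"
    and linear_power_nonneg: "0 \<le> \<alpha>\<^sup>2 * P + 2 * \<alpha> * \<beta> * correlation a b + \<beta>\<^sup>2 * P"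
proof -
  let ?K = "Msgs n R"
  let ?E = "\<lambda>m t a b. \<integral>z. X m z t a * X m z t b \<partial>noise"
  have tot: "(\<Sum>m\<in>?K. \<Sum>t<n. ?E m t a a) \<le> card ?K * (n * P)" for a
  proof -
    have "(\<Sum>m\<in>?K. \<Sum>t<n. \<integral>\<^sup>+ z. ennreal ((X m z t a)\<^sup>2) \<partial>noise) = (\<Sum>m\<in>?K. \<Sum>t<n. ennreal (?E m t a a))"
      by (intro sum.cong refl, subst nn_integral_eq_integral)
         (auto simp: square_integrable_signal power2_eq_square[symmetric])
    also have "\<dots> = ennreal (\<Sum>m\<in>?K. \<Sum>t<n. ?E m t a a)"
      by (simp add: sum_nonneg)
    finally show ?thesis using total_power_le[of a] P_pos by (simp add: ennreal_le_iff)
  qed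
  have sq: "has_bochner_integral noise (\<lambda>z. (\<alpha> * X m z t a + \<beta> * X m z t b)\<^sup>2)
      (\<alpha>\<^sup>2 * ?E m t a a + 2 * \<alpha> * \<beta> * ?E m t a b + \<beta>\<^sup>2 * ?E m t b b)"
    if mt: "m \<in> ?K" "t < n" for m t
  proof -
    note sq = square_integrable_signal[OF mt]
    have ab: "integrable noise (\<lambda>z. X m z t a * X m z t b)"
    proof (rule Bochner_Integration.integrable_bound)
      show "integrable noise (\<lambda>z. (X m z t a)\<^sup>2 + (X m z t b)\<^sup>2)" by (intro Bochner_Integration.integrable_add sq)
      have "\<bar>x * y\<bar> \<le> x\<^sup>2 + y\<^sup>2" for x y :: real
        using sum_squares_bound[of "\<bar>x\<bar>" "\<bar>y\<bar>"] mult_nonneg_nonneg[OF abs_ge_zero[of x] abs_ge_zero[of y]]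
        by (simp only: abs_mult power2_abs)
      then show "AE z in noise. norm (X m z t a * X m z t b) \<le> norm ((X m z t a)\<^sup>2 + (X m z t b)\<^sup>2)" by simp
    qed simp
    have "has_bochner_integral noise (\<lambda>z. \<alpha>\<^sup>2 * (X m z t a * X m z t a) + 2 * \<alpha> * \<beta> * (X m z t a * X m z t b) + \<beta>\<^sup>2 * (X m z t b * X m z t b))
      (\<alpha>\<^sup>2 * ?E m t a a + 2 * \<alpha> * \<beta> * ?E m t a b + \<beta>\<^sup>2 * ?E m t b b)"
      using sq[of a] sq[of b] ab
      by (intro has_bochner_integral_add has_bochner_integral_mult_right has_bochner_integral_integrable)
         (simp_all add: power2_eq_square)
    moreover have "(\<lambda>z. \<alpha>\<^sup>2 * (X m z t a * X m z t a) + 2 * \<alpha> * \<beta> * (X m z t a * X m z t b) + \<beta>\<^sup>2 * (X m z t b * X m z t b))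
       = (\<lambda>z. (\<alpha> * X m z t a + \<beta> * X m z t b)\<^sup>2)"
      by (auto simp: algebra_simps power2_eq_square)
    ultimately show ?thesis by simp
  qed
  have I: "(\<integral>\<^sup>+ z. ennreal ((\<alpha> * X m z t a + \<beta> * X m z t b)\<^sup>2) \<partial>noise)
      = ennreal (\<alpha>\<^sup>2 * ?E m t a a + 2 * \<alpha> * \<beta> * ?E m t a b + \<beta>\<^sup>2 * ?E m t b b)"
    if "m \<in> ?K" "t < n" for m t
    using sq[OF that] by (subst nn_integral_eq_integral) (auto simp: has_bochner_integral_iff)
  have nn: "\<alpha>\<^sup>2 * ?E m t a a + 2 * \<alpha> * \<beta> * ?E m t a b + \<beta>\<^sup>2 * ?E m t b b \<ge> 0" if "m \<in> ?K" "t < n" for m t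
  proof -
    have "0 \<le> (\<integral>z. (\<alpha> * X m z t a + \<beta> * X m z t b)\<^sup>2 \<partial>noise)" by simp
    then show ?thesis using sq[OF that] by (simp only: has_bochner_integral_iff)
  qed
  have cn: "card ?K * real n > 0" using card_Msgs_pos n_pos by simp
  have "(\<Sum>m\<in>?K. \<Sum>t<n. \<alpha>\<^sup>2 * ?E m t a a + 2 * \<alpha> * \<beta> * ?E m t a b + \<beta>\<^sup>2 * ?E m t b b)
     = \<alpha>\<^sup>2 * (\<Sum>m\<in>?K. \<Sum>t<n. ?E m t a a) + 2 * \<alpha> * \<beta> * (\<Sum>m\<in>?K. \<Sum>t<n. ?E m t a b) + \<beta>\<^sup>2 * (\<Sum>m\<in>?K. \<Sum>t<n. ?E m t b b)"
    by (simp add: sum.distrib sum_distrib_left)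
  also have "\<dots> \<le> \<alpha>\<^sup>2 * (card ?K * (n * P)) + 2 * \<alpha> * \<beta> * (card ?K * n * correlation a b) + \<beta>\<^sup>2 * (card ?K * (n * P))"
    using card_Msgs_pos n_pos by (intro add_mono mult_left_mono[OF tot]) (simp_all add: correlation_def)
  finally have le: "(\<Sum>m\<in>?K. \<Sum>t<n. \<alpha>\<^sup>2 * ?E m t a a + 2 * \<alpha> * \<beta> * ?E m t a b + \<beta>\<^sup>2 * ?E m t b b)
     \<le> card ?K * (n * (\<alpha>\<^sup>2 * P + 2 * \<alpha> * \<beta> * correlation a b + \<beta>\<^sup>2 * P))"
    by (simp add: algebra_simps)
  have "0 \<le> (\<Sum>m\<in>?K. \<Sum>t<n. \<alpha>\<^sup>2 * ?E m t a a + 2 * \<alpha> * \<beta> * ?E m t a b + \<beta>\<^sup>2 * ?E m t b b)"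
    by (intro sum_nonneg nn) auto
  with le have "0 \<le> (card ?K * real n) * (\<alpha>\<^sup>2 * P + 2 * \<alpha> * \<beta> * correlation a b + \<beta>\<^sup>2 * P)"
    by (simp add: mult.assoc)
  with cn show "0 \<le> \<alpha>\<^sup>2 * P + 2 * \<alpha> * \<beta> * correlation a b + \<beta>\<^sup>2 * P"
    by (simp only: zero_le_mult_iff) linarith
  have "(\<Sum>m\<in>?K. \<Sum>t<n. \<integral>\<^sup>+ z. ennreal ((\<alpha> * X m z t a + \<beta> * X m z t b)\<^sup>2) \<partial>noise)
     = (\<Sum>m\<in>?K. \<Sum>t<n. ennreal (\<alpha>\<^sup>2 * ?E m t a a + 2 * \<alpha> * \<beta> * ?E m t a b + \<beta>\<^sup>2 * ?E m t b b))"
    by (intro sum.cong refl I) auto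
  also have "\<dots> = (\<Sum>m\<in>?K. ennreal (\<Sum>t<n. \<alpha>\<^sup>2 * ?E m t a a + 2 * \<alpha> * \<beta> * ?E m t a b + \<beta>\<^sup>2 * ?E m t b b))"
    by (intro sum.cong refl sum_ennreal nn) auto
  also have "\<dots> = ennreal (\<Sum>m\<in>?K. \<Sum>t<n. \<alpha>\<^sup>2 * ?E m t a a + 2 * \<alpha> * \<beta> * ?E m t a b + \<beta>\<^sup>2 * ?E m t b b)"
    by (intro sum_ennreal sum_nonneg nn) auto
  also have "\<dots> \<le> ennreal (card ?K * (n * (\<alpha>\<^sup>2 * P + 2 * \<alpha> * \<beta> * correlation a b + \<beta>\<^sup>2 * P)))"
    by (rule ennreal_leI[OF le])
  finally show "(\<Sum>m\<in>?K. \<Sum>t<n. \<integral>\<^sup>+ z. ennreal ((\<alpha> * X m z t a + \<beta> * X m z t b)\<^sup>2) \<partial>noise)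
     \<le> ennreal (card ?K * (n * (\<alpha>\<^sup>2 * P + 2 * \<alpha> * \<beta> * correlation a b + \<beta>\<^sup>2 * P)))" .
qed

lemma abs_correlation_le: "\<bar>correlation a b\<bar> \<le> P"
  using linear_power_nonneg[of 1 1 a b] linear_power_nonneg[of 1 "-1" a b] by simp

text \<open>Passes from nats for message counts to bits per channel use. Rounding up in
  \<open>msize\<close> goes in the right direction, because only a lower bound on the number of
  messages is needed.\<close>

lemma rate_sum_bound:
  fixes B :: real
  assumes "(1 - err_prob c h R n) * ln (msize n R j\<^sub>1 k\<^sub>1 * msize n R j\<^sub>2 k\<^sub>2) \<le> n * B + 1"
  shows "(1 - err_prob c h R n) * (R j\<^sub>1 k\<^sub>1 + R j\<^sub>2 k\<^sub>2) \<le> B / ln 2 + 1 / (n * ln 2)"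
proof -
  interpret O: prob_space "Omega n R" by (rule prob_Omega)
  have e: "1 - err_prob c h R n \<ge> 0" by (simp add: err_prob_def)
  have ms: "2 powr (n * R j k) \<le> msize n R j k" for j k
    unfolding msize_def by (simp add: of_nat_nat) 
  have "n * (R j\<^sub>1 k\<^sub>1 + R j\<^sub>2 k\<^sub>2) * ln 2 = ln (2 powr (n * R j\<^sub>1 k\<^sub>1) * 2 powr (n * R j\<^sub>2 k\<^sub>2))"
    by (simp add: powr_add[symmetric] ln_powr algebra_simps)
  also have "\<dots> \<le> ln (msize n R j\<^sub>1 k\<^sub>1 * msize n R j\<^sub>2 k\<^sub>2)"
    by (subst ln_le_cancel_iff) (auto intro!: mult_mono ms simp: msize_pos)
  finally have "(1 - err_prob c h R n) * (n * (R j\<^sub>1 k\<^sub>1 + R j\<^sub>2 k\<^sub>2) * ln 2) \<le> n * B + 1"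
    using mult_left_mono[OF _ e] assms by (meson order_trans)
  then have "(1 - err_prob c h R n) * (R j\<^sub>1 k\<^sub>1 + R j\<^sub>2 k\<^sub>2) \<le> (n * B + 1) / (n * ln 2)"
    using n_pos by (subst pos_le_divide_eq) (simp_all add: mult_ac)
  then show ?thesis using n_pos by (simp add: add_divide_distrib)
qed

text \<open>Covers the cuts whose only innovation is the noise at \<open>q\<close> plus a linear
  form in two simultaneous inputs. The current noise does not influence these inputs, so the
  innovation has variance 1 plus the power of the form.\<close>

lemma single_cut_bound:
  fixes S :: "node set" and F :: "(node \<Rightarrow> real) \<Rightarrow> (node \<Rightarrow> real) \<Rightarrow> node \<Rightarrow> real"
  assumes "Usr k\<^sub>1 \<in> S" "Usr k\<^sub>2 \<in> S" "Usr j\<^sub>1 \<notin> S" "Usr j\<^sub>2 \<notin> S" "(j\<^sub>1, k\<^sub>1) \<noteq> (j\<^sub>2, k\<^sub>2)"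
    and "\<And>a. measurable_map (\<lambda>x \<zeta>. F x \<zeta> a)"
    and "\<And>a x x' \<zeta>. a \<in> S \<Longrightarrow> (\<And>b. b \<in> S \<Longrightarrow> x' b = x b) \<Longrightarrow> F x' \<zeta> a = F x \<zeta> a"
    and F_obs: "\<And>a x \<zeta>. a \<in> S \<Longrightarrow> F x (\<zeta>(q := \<zeta> q + (\<alpha> * x b + \<beta> * x b'))) a = obs h x \<zeta> a"
  shows "(1 - err_prob c h R n) * (R j\<^sub>1 k\<^sub>1 + R j\<^sub>2 k\<^sub>2)
    \<le> log 2 (1 + (\<alpha>\<^sup>2 * P + 2 * \<alpha> * \<beta> * correlation b b' + \<beta>\<^sup>2 * P)) / 2 + 1 / (n * ln 2)"
proof -
  let ?V = "\<alpha>\<^sup>2 * P + 2 * \<alpha> * \<beta> * correlation b b' + \<beta>\<^sup>2 * P"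
  let ?sh = "\<lambda>(q :: node) x (\<zeta> :: node \<Rightarrow> real). \<alpha> * x b + \<beta> * x b'"
  interpret N: prob_space noise by (rule prob_space_PiM_stdN)
  have V: "?V \<ge> 0" by (rule linear_power_nonneg)
  have "(1 - err_prob c h R n) * ln (msize n R j\<^sub>1 k\<^sub>1 * msize n R j\<^sub>2 k\<^sub>2) \<le> n * (\<Sum>q\<in>set [q]. ln (sqrt (1 + ?V))) + 1"
  proof (rule cut_bound[where sh = ?sh and F = F and S = S and qs = "[q]" and \<sigma> = "\<lambda>_. sqrt (1 + ?V)", OF assms(1-6) _ _ _ _ assms(7)])
    show "measurable_map (?sh q)" for q by (simp add: measurable_map_def)
    show "F x (\<lambda>d. if d \<in> set [q] then \<zeta> d + ?sh d x \<zeta> else \<zeta> d) a = obs h x \<zeta> a" if "a \<in> S" for a x \<zeta>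
      using F_obs[OF that, of x \<zeta>] by (simp add: fun_upd_def if_distrib cong: if_cong)
    show "sqrt (1 + ?V) > 0" using V by simp
    fix r assume "r \<in> set [q]"
    have "(\<integral>\<^sup>+ z. ennreal ((z (r, t) + ?sh r (X m z t) (\<lambda>b. z (b, t)))\<^sup>2) \<partial>noise)
        = (\<integral>\<^sup>+ z. ennreal ((\<alpha> * X m z t b + \<beta> * X m z t b')\<^sup>2) \<partial>noise) + 1" for m t
      using nn_integral_add_coord_square[of "\<lambda>z. \<alpha> * X m z t b + \<beta> * X m z t b'" "(r, t)" 1] borel_signal
      by (simp add: signal_fun_upd add.commute)
    then have "(\<Sum>m\<in>Msgs n R. \<Sum>t<n. \<integral>\<^sup>+ z. ennreal ((z (r, t) + ?sh r (X m z t) (\<lambda>b. z (b, t)))\<^sup>2) \<partial>noise)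
       = (\<Sum>m\<in>Msgs n R. \<Sum>t<n. \<integral>\<^sup>+ z. ennreal ((\<alpha> * X m z t b + \<beta> * X m z t b')\<^sup>2) \<partial>noise) + ennreal (card (Msgs n R) * n)"
      by (simp add: sum.distrib ennreal_of_nat_eq_real_of_nat ennreal_mult)
    also have "\<dots> \<le> ennreal (card (Msgs n R) * (n * ?V)) + ennreal (card (Msgs n R) * n)"
      by (intro add_right_mono linear_power_le)
    also have "\<dots> = ennreal (card (Msgs n R) * (n * (sqrt (1 + ?V))\<^sup>2))"
    proof -
      have "0 \<le> card (Msgs n R) * (n * ?V)" using V by (intro mult_nonneg_nonneg) auto
      moreover have "card (Msgs n R) * (n * (sqrt (1 + ?V))\<^sup>2) = card (Msgs n R) * (n * ?V) + card (Msgs n R) * n"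
        using V by (simp only: real_sqrt_pow2 add_nonneg_nonneg zero_le_one distrib_left) simp
      ultimately show ?thesis by (simp add: ennreal_plus del: real_sqrt_pow2_iff)
    qed
    finally show "(\<Sum>m\<in>Msgs n R. \<Sum>t<n. \<integral>\<^sup>+ z. ennreal ((z (r, t) + ?sh r (X m z t) (\<lambda>b. z (b, t)))\<^sup>2) \<partial>noise)
       \<le> ennreal (card (Msgs n R) * (n * (sqrt (1 + ?V))\<^sup>2))" .
  qed simp_all
  moreover have "(\<Sum>q\<in>set [q]. ln (sqrt (1 + ?V))) = ln (1 + ?V) / 2"
    using V by (simp add: ln_sqrt del: real_sqrt_ge_1_iff)
  ultimately have "(1 - err_prob c h R n) * ln (msize n R j\<^sub>1 k\<^sub>1 * msize n R j\<^sub>2 k\<^sub>2) \<le> n * (ln (1 + ?V) / 2) + 1"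
    by (simp only:)
  from rate_sum_bound[OF this] show ?thesis unfolding log_def by (simp only: divide_divide_eq_left mult.commute)
qed

text \<open>The receiving side produces the input of \<open>l\<close> itself and can subtract the
  prediction \<beta> X_l of X_j. The innovation at the relay is h_j (X_j - \<beta> X_l) + Z_r, and
  \<open>?F\<close> adds the prediction back. Every \<beta> gives a valid bound: 0 ignores the
  correlation, and the limiting correlation coefficient is used later.\<close>

lemma uplink_out:
  assumes d: "j \<noteq> k" "j \<noteq> l" "k \<noteq> l"
  shows "(1 - err_prob c h R n) * (R j k + R j l)
    \<le> log 2 (1 + (h j)\<^sup>2 * (P - 2 * \<beta> * correlation (Usr j) (Usr l) + \<beta>\<^sup>2 * P)) / 2 + 1 / (n * ln 2)"
proof -
  let ?F = "\<lambda>x \<zeta> a. case a of Rly \<Rightarrow> h k * x (Usr k) + (h l + h j * \<beta>) * x (Usr l) + \<zeta> Rly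
    | Usr i \<Rightarrow> h i * x Rly + \<zeta> (Usr i)"
  have "(1 - err_prob c h R n) * (R j k + R j l)
    \<le> log 2 (1 + ((h j)\<^sup>2 * P + 2 * h j * (- h j * \<beta>) * correlation (Usr j) (Usr l) + (- h j * \<beta>)\<^sup>2 * P)) / 2 + 1 / (n * ln 2)"
  proof (rule single_cut_bound[where S = "{Usr k, Usr l, Rly}" and F = ?F and q = Rly])
    show "measurable_map (\<lambda>x \<zeta>. ?F x \<zeta> a)" for a by (cases a) (simp_all add: measurable_map_def)
  qed (use d in \<open>auto simp: obs_Rly[OF d] obs_Usr algebra_simps\<close>)
  then show ?thesis by (simp add: power2_eq_square algebra_simps)
qed

text \<open>The receiving side controls neither transmitter, so the whole term h_j X_j + h_k X_k
  counts as innovation and the correlation can increase the bound.\<close>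

lemma uplink_in:
  assumes d: "j \<noteq> k" "j \<noteq> l" "k \<noteq> l"
  shows "(1 - err_prob c h R n) * (R j l + R k l)
    \<le> log 2 (1 + ((h j)\<^sup>2 * P + 2 * h j * h k * correlation (Usr j) (Usr k) + (h k)\<^sup>2 * P)) / 2 + 1 / (n * ln 2)"
proof -
  let ?F = "\<lambda>x \<zeta> a. case a of Rly \<Rightarrow> h l * x (Usr l) + \<zeta> Rly | Usr i \<Rightarrow> h i * x Rly + \<zeta> (Usr i)"
  show ?thesis
  proof (rule single_cut_bound[where S = "{Usr l, Rly}" and F = ?F and q = Rly])
    show "measurable_map (\<lambda>x \<zeta>. ?F x \<zeta> a)" for a by (cases a) (simp_all add: measurable_map_def)
  qed (use d in \<open>auto simp: obs_Rly[OF d] obs_Usr algebra_simps\<close>)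
qed

lemma downlink_in:
  assumes d: "j \<noteq> k" "j \<noteq> l" "k \<noteq> l"
  shows "(1 - err_prob c h R n) * (R j l + R k l) \<le> log 2 (1 + (h l)\<^sup>2 * P) / 2 + 1 / (n * ln 2)"
proof -
  have "(1 - err_prob c h R n) * (R j l + R k l)
    \<le> log 2 (1 + ((h l)\<^sup>2 * P + 2 * h l * 0 * correlation Rly Rly + 0\<^sup>2 * P)) / 2 + 1 / (n * ln 2)"
  proof (rule single_cut_bound[where S = "{Usr l}" and F = "\<lambda>x \<zeta> a. \<zeta> (Usr l)" and q = "Usr l"])
    show "measurable_map (\<lambda>x \<zeta>. \<zeta> (Usr l))" for a :: node by (simp add: measurable_map_def)
  qed (use d in \<open>auto simp: obs_Usr algebra_simps\<close>)
  then show ?thesis by simp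
qed

text \<open>The output at \<open>k\<close> is used to predict the one at \<open>l\<close>: \<open>b\<close> is the regression coefficient of
  \<open>Y\<^sub>l\<close> on \<open>Y\<^sub>k\<close> for a relay input of power exactly \<open>P\<close>.\<close>
lemma downlink_out:
  assumes d: "j \<noteq> k" "j \<noteq> l" "k \<noteq> l"
  shows "(1 - err_prob c h R n) * (R j k + R j l) \<le> log 2 (1 + (h k)\<^sup>2 * P + (h l)\<^sup>2 * P) / 2 + 1 / (n * ln 2)"
proof -
  interpret N: prob_space noise by (rule prob_space_PiM_stdN)
  define b where "b = h l * h k * P / (1 + (h k)\<^sup>2 * P)"
  define g where "g = h l - b * h k"
  \<comment> \<open>The variances of the two innovations for relay power exactly P, hence upper
    bounds for the power actually used.\<close>
  define V where "V q = (if q = Usr k then 1 + (h k)\<^sup>2 * P else 1 + b\<^sup>2 + g\<^sup>2 * P)" for q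
  have V: "V q > 0" for q using P_pos by (auto simp: V_def intro!: add_pos_nonneg)
  \<comment> \<open>The innovations are Y_k and Y_l - b Y_k = g X_r + Z_l - b Z_k. The second shift
    reads the noise at \<open>k\<close>, so \<open>Usr k\<close> has to precede \<open>Usr l\<close>
    in \<open>qs\<close>.\<close>
  define sh where "sh q x \<zeta> = (if q = Usr k then h k * x Rly else g * x Rly - b * \<zeta> (Usr k))"
    for q :: node and x \<zeta> :: "node \<Rightarrow> real"
  let ?F = "\<lambda>(x :: node \<Rightarrow> real) \<zeta> a. if a = Usr k then \<zeta> (Usr k) else \<zeta> (Usr l) + b * \<zeta> (Usr k)"
  have lk: "Usr l \<noteq> Usr k" using d by simp
  have "(1 - err_prob c h R n) * ln (msize n R j k * msize n R j l) \<le> n * (\<Sum>q\<in>set [Usr k, Usr l]. ln (sqrt (V q))) + 1"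
  proof (rule cut_bound[where S = "{Usr k, Usr l}" and F = ?F and sh = sh])
    show "measurable_map (sh q)" for q by (cases "q = Usr k") (simp_all add: measurable_map_def sh_def)
    show "measurable_map (\<lambda>x \<zeta>. ?F x \<zeta> a)" for a by (cases "a = Usr k") (simp_all add: measurable_map_def)
    show "?F x (\<lambda>d. if d \<in> set [Usr k, Usr l] then \<zeta> d + sh d x \<zeta> else \<zeta> d) a = obs h x \<zeta> a"
      if "a \<in> {Usr k, Usr l}" for a x \<zeta>
      using that lk by (auto simp: sh_def obs_Usr g_def algebra_simps)
    show "sqrt (V q) > 0" for q using V by simp
    fix q assume q: "q \<in> set [Usr k, Usr l]"
    define \<alpha> where "\<alpha> = (if q = Usr k then h k else g)"
    define \<gamma> where "\<gamma> = (if q = Usr k then 0 else - b)"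
    have Vq: "V q = \<alpha>\<^sup>2 * P + (1 + \<gamma>\<^sup>2)" by (simp add: V_def \<alpha>_def \<gamma>_def)
    have "(\<integral>\<^sup>+ z. ennreal ((z (q, t) + sh q (X m z t) (\<lambda>b. z (b, t)))\<^sup>2) \<partial>noise)
        = (\<integral>\<^sup>+ z. ennreal ((\<alpha> * X m z t Rly + 0 * X m z t Rly)\<^sup>2) \<partial>noise) + ennreal (1 + \<gamma>\<^sup>2)" for m t
    proof -
      have "(\<integral>\<^sup>+ z. ennreal ((z (q, t) + sh q (X m z t) (\<lambda>b. z (b, t)))\<^sup>2) \<partial>noise)
        = (\<integral>\<^sup>+ z. ennreal (((\<alpha> * X m z t Rly + \<gamma> * z (Usr k, t)) + 1 * z (q, t))\<^sup>2) \<partial>noise)"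
        by (intro nn_integral_cong) (simp add: sh_def \<alpha>_def \<gamma>_def add_ac)
      also have "\<dots> = (\<integral>\<^sup>+ z. ennreal ((\<alpha> * X m z t Rly + \<gamma> * z (Usr k, t))\<^sup>2) \<partial>noise) + ennreal (1\<^sup>2)"
        using borel_signal by (intro nn_integral_add_coord_square) (auto simp: signal_fun_upd \<gamma>_def)
      also have "(\<integral>\<^sup>+ z. ennreal ((\<alpha> * X m z t Rly + \<gamma> * z (Usr k, t))\<^sup>2) \<partial>noise)
          = (\<integral>\<^sup>+ z. ennreal ((\<alpha> * X m z t Rly)\<^sup>2) \<partial>noise) + ennreal (\<gamma>\<^sup>2)"
        using borel_signal by (intro nn_integral_add_coord_square) (auto simp: signal_fun_upd)
      finally show ?thesis by (simp add: add_ac ennreal_plus)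
    qed
    then have "(\<Sum>m\<in>Msgs n R. \<Sum>t<n. \<integral>\<^sup>+ z. ennreal ((z (q, t) + sh q (X m z t) (\<lambda>b. z (b, t)))\<^sup>2) \<partial>noise)
       = (\<Sum>m\<in>Msgs n R. \<Sum>t<n. \<integral>\<^sup>+ z. ennreal ((\<alpha> * X m z t Rly + 0 * X m z t Rly)\<^sup>2) \<partial>noise)
         + ennreal (card (Msgs n R) * (n * (1 + \<gamma>\<^sup>2)))"
      by (simp only: sum.distrib sum_constant) (simp add: ennreal_of_nat_eq_real_of_nat ennreal_mult)
    also have "\<dots> \<le> ennreal (card (Msgs n R) * (n * (\<alpha>\<^sup>2 * P + 2 * \<alpha> * 0 * correlation Rly Rly + 0\<^sup>2 * P)))
         + ennreal (card (Msgs n R) * (n * (1 + \<gamma>\<^sup>2)))"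
      by (intro add_right_mono linear_power_le)
    also have "\<dots> = ennreal (card (Msgs n R) * (n * (sqrt (V q))\<^sup>2))"
      using V[of q] P_pos by (simp add: ennreal_plus[symmetric] Vq distrib_left del: ennreal_plus)
    finally show "(\<Sum>m\<in>Msgs n R. \<Sum>t<n. \<integral>\<^sup>+ z. ennreal ((z (q, t) + sh q (X m z t) (\<lambda>b. z (b, t)))\<^sup>2) \<partial>noise)
       \<le> ennreal (card (Msgs n R) * (n * (sqrt (V q))\<^sup>2))" .
  qed (use d in \<open>auto simp: sh_def\<close>)
  from rate_sum_bound[OF this]
  have "(1 - err_prob c h R n) * (R j k + R j l) \<le> (ln (V (Usr k)) / 2 + ln (V (Usr l)) / 2) / ln 2 + 1 / (n * ln 2)"
    using d by (simp add: ln_sqrt[OF less_imp_le[OF V]])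
  moreover have "V (Usr k) * V (Usr l) = 1 + (h k)\<^sup>2 * P + (h l)\<^sup>2 * P"
  proof -
    have "(1 + (h k)\<^sup>2 * P) * (1 + b\<^sup>2 + g\<^sup>2 * P) = 1 + (h k)\<^sup>2 * P + (h l)\<^sup>2 * P"
      unfolding g_def b_def by (rule regression_identity[OF P_pos])
    then show ?thesis using lk by (simp add: V_def)
  qed
  moreover have "ln (V (Usr k)) / 2 + ln (V (Usr l)) / 2 = ln (V (Usr k) * V (Usr l)) / 2"
    using V[of "Usr k"] V[of "Usr l"] by (simp add: ln_mult)
  ultimately show ?thesis by (simp add: log_def)
qed

end

section \<open>Mutual information over additive Gaussian noise\<close>

lemma nn_integral_lborel_translate:
  fixes c :: "'b::euclidean_space"
  assumes [measurable]: "g \<in> borel_measurable borel"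
  shows "(\<integral>\<^sup>+ x. g (x - c) \<partial>lborel) = (\<integral>\<^sup>+ x. g x \<partial>lborel)"
proof -
  have "(\<integral>\<^sup>+ x. g x \<partial>lborel) = (\<integral>\<^sup>+ x. g x \<partial>distr lborel borel ((+) (- c)))"
    by (simp add: lborel_distr_plus)
  also have "\<dots> = (\<integral>\<^sup>+ x. g (x - c) \<partial>lborel)"
    by (subst nn_integral_distr) simp_all
  finally show ?thesis ..
qed

text \<open>The library notion \<open>indep_var\<close> forces both variables to have values in the same type.\<close>
definition indep_laws :: "'a measure \<Rightarrow> 'b measure \<Rightarrow> ('a \<Rightarrow> 'b) \<Rightarrow> 'c measure \<Rightarrow> ('a \<Rightarrow> 'c) \<Rightarrow> bool" where
  "indep_laws M S X T Y \<longleftrightarrow> X \<in> M \<rightarrow>\<^sub>M S \<and> Y \<in> M \<rightarrow>\<^sub>M T \<and>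
    distr M (S \<Otimes>\<^sub>M T) (\<lambda>\<omega>. (X \<omega>, Y \<omega>)) = distr M S X \<Otimes>\<^sub>M distr M T Y"

text \<open>The reference measure is Lebesgue measure times the law of \<open>W\<close>, so
  \<open>W\<close> needs no density. This matters because \<open>W\<close> will be a tuple of
  inputs, whose law is degenerate when \<rho>^2 = 1.\<close>

lemma (in prob_space) distr_additive_noise:
  fixes N :: "'a \<Rightarrow> 'b::euclidean_space" and r :: "'b \<Rightarrow> ennreal"
  assumes indep: "indep_laws M T W borel N" and N: "distributed M lborel N r" and f[measurable]: "f \<in> T \<rightarrow>\<^sub>M borel"
  shows "distr M (borel \<Otimes>\<^sub>M T) (\<lambda>\<omega>. (f (W \<omega>) + N \<omega>, W \<omega>))
    = density (lborel \<Otimes>\<^sub>M distr M T W) (\<lambda>(b, w). r (b - f w))" (is "?L = ?R")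
proof (rule measure_eqI)
  have W[measurable]: "W \<in> M \<rightarrow>\<^sub>M T" and Nm[measurable]: "N \<in> M \<rightarrow>\<^sub>M borel"
    using indep by (simp_all add: indep_laws_def)
  have r[measurable]: "r \<in> borel_measurable borel" using distributed_borel_measurable[OF N] by simp
  have sets_eq: "sets (lborel \<Otimes>\<^sub>M distr M T W) = sets (borel \<Otimes>\<^sub>M T)" by (intro sets_pair_measure_cong) simp_all
  show "sets ?L = sets ?R" by (simp add: sets_eq)
  fix A assume "A \<in> sets ?L"
  then have A[measurable]: "A \<in> sets (borel \<Otimes>\<^sub>M T)" by simp
  interpret D: prob_space "distr M T W" by (rule prob_space_distr) simp
  have "distr M borel N = density lborel r"
    using distributed_distr_eq_density[OF N] by (metis distr_cong sets_lborel)
  then have joint: "distr M (T \<Otimes>\<^sub>M borel) (\<lambda>\<omega>. (W \<omega>, N \<omega>)) = distr M T W \<Otimes>\<^sub>M density lborel r"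
    using indep by (simp add: indep_laws_def)
  interpret R: prob_space "density lborel r"
    using \<open>distr M borel N = density lborel r\<close> prob_space_distr[OF Nm] by simp
  interpret LD: pair_sigma_finite "lborel :: 'b measure" "distr M T W" ..
  have "emeasure ?L A = (\<integral>\<^sup>+ p. indicator A p \<partial>?L)" by simp
  also have "\<dots> = (\<integral>\<^sup>+ \<omega>. indicator A (f (W \<omega>) + N \<omega>, W \<omega>) \<partial>M)" by (subst nn_integral_distr) simp_all
  also have "\<dots> = (\<integral>\<^sup>+ p. indicator A (f (fst p) + snd p, fst p) \<partial>distr M (T \<Otimes>\<^sub>M borel) (\<lambda>\<omega>. (W \<omega>, N \<omega>)))"
    by (subst nn_integral_distr) simp_all
  also have "\<dots> = (\<integral>\<^sup>+ w. (\<integral>\<^sup>+ x. indicator A (f w + x, w) \<partial>density lborel r) \<partial>distr M T W)"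
    unfolding joint by (subst R.nn_integral_fst[symmetric]) (simp_all cong: measurable_cong_sets)
  also have "\<dots> = (\<integral>\<^sup>+ w. (\<integral>\<^sup>+ b. r (b - f w) * indicator A (b, w) \<partial>lborel) \<partial>distr M T W)"
  proof (rule nn_integral_cong)
    fix w assume "w \<in> space (distr M T W)"
    then have w: "w \<in> space T" by simp
    have m[measurable]: "(\<lambda>x. indicator A (f w + x, w) :: ennreal) \<in> borel_measurable borel"
    proof -
      have "(\<lambda>x. (f w + x, w)) \<in> borel \<rightarrow>\<^sub>M borel \<Otimes>\<^sub>M T" using w by (intro measurable_Pair) simp_all
      from measurable_compose[OF this borel_measurable_indicator[OF A]] show ?thesis .
    qed
    have "(\<integral>\<^sup>+ x. indicator A (f w + x, w) \<partial>density lborel r) = (\<integral>\<^sup>+ x. r x * indicator A (f w + x, w) \<partial>lborel)"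
      by (rule nn_integral_density) simp_all
    also have "\<dots> = (\<integral>\<^sup>+ b. r (b - f w) * indicator A (f w + (b - f w), w) \<partial>lborel)"
      by (rule nn_integral_lborel_translate[symmetric]) simp
    finally show "(\<integral>\<^sup>+ x. indicator A (f w + x, w) \<partial>density lborel r) = (\<integral>\<^sup>+ b. r (b - f w) * indicator A (b, w) \<partial>lborel)" by simp
  qed
  also have "\<dots> = (\<integral>\<^sup>+ p. r (fst p - f (snd p)) * indicator A p \<partial>(lborel \<Otimes>\<^sub>M distr M T W))"
    by (subst LD.nn_integral_snd[symmetric]) (simp_all add: case_prod_unfold sets_eq cong: measurable_cong_sets)
  also have "\<dots> = emeasure ?R A"
    by (subst emeasure_density) (simp_all add: case_prod_unfold sets_eq cong: measurable_cong_sets)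
  finally show "emeasure ?L A = emeasure ?R A" .
qed

text \<open>The joint law and the product of the marginals have densities r (b - f w) and q b
  relative to the same measure, so their divergence is an expected log ratio. Positivity of
  \<open>q\<close> makes the ratio meaningful everywhere.\<close>

lemma (in prob_space) mutual_information_additive_noise:
  fixes N :: "'a \<Rightarrow> 'b::euclidean_space" and r q :: "'b \<Rightarrow> real"
  assumes indep: "indep_laws M T W borel N" and N: "distributed M lborel N r" and f[measurable]: "f \<in> T \<rightarrow>\<^sub>M borel"
    and B: "distributed M lborel (\<lambda>\<omega>. f (W \<omega>) + N \<omega>) q"
    and r: "\<And>x. r x \<ge> 0" and q: "\<And>x. q x > 0" and [measurable]: "r \<in> borel_measurable borel" "q \<in> borel_measurable borel"
  shows "mutual_information 2 borel T (\<lambda>\<omega>. f (W \<omega>) + N \<omega>) W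
    = expectation (\<lambda>\<omega>. log 2 (r (N \<omega>) / q (f (W \<omega>) + N \<omega>)))"
proof -
  have W[measurable]: "W \<in> M \<rightarrow>\<^sub>M T" and Nm[measurable]: "N \<in> M \<rightarrow>\<^sub>M borel"
    using indep by (simp_all add: indep_laws_def)
  let ?D = "distr M T W"
  interpret D: prob_space ?D by (rule prob_space_distr) simp
  interpret LD: pair_sigma_finite "lborel :: 'b measure" ?D ..
  have sets_eq[measurable_cong]: "sets (lborel \<Otimes>\<^sub>M ?D) = sets (borel \<Otimes>\<^sub>M T)" by (intro sets_pair_measure_cong) simp_all
  have dB: "distr M borel (\<lambda>\<omega>. f (W \<omega>) + N \<omega>) = density lborel q"
    using distributed_distr_eq_density[OF B] by (metis distr_cong sets_lborel)
  interpret Q: prob_space "density lborel q"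
    unfolding dB[symmetric] by (rule prob_space_distr) simp
  have "density lborel q \<Otimes>\<^sub>M ?D = density lborel q \<Otimes>\<^sub>M density ?D (\<lambda>_. 1)" by (simp add: density_1)
  also have "\<dots> = density (lborel \<Otimes>\<^sub>M ?D) (\<lambda>(x, y). ennreal (q x) * 1)"
    by (rule pair_measure_density) (simp_all add: density_1 D.sigma_finite_measure_axioms)
  finally have prod: "density lborel q \<Otimes>\<^sub>M ?D = density (lborel \<Otimes>\<^sub>M ?D) (\<lambda>p. ennreal (q (fst p)))"
    by (simp add: case_prod_unfold)
  have joint: "distr M (borel \<Otimes>\<^sub>M T) (\<lambda>\<omega>. (f (W \<omega>) + N \<omega>, W \<omega>))
      = density (lborel \<Otimes>\<^sub>M ?D) (\<lambda>p. ennreal (r (fst p - f (snd p))))"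
    using distr_additive_noise[OF indep N f] by (simp add: case_prod_unfold)
  have "mutual_information 2 borel T (\<lambda>\<omega>. f (W \<omega>) + N \<omega>) W
     = (\<integral>p. r (fst p - f (snd p)) * log 2 (r (fst p - f (snd p)) / q (fst p)) \<partial>(lborel \<Otimes>\<^sub>M ?D))"
    unfolding mutual_information_def dB prod joint
    by (rule LD.KL_density_density) (use r q in \<open>auto simp: less_imp_le less_imp_neq[symmetric]\<close>)
  also have "\<dots> = (\<integral>p. log 2 (r (fst p - f (snd p)) / q (fst p)) \<partial>density (lborel \<Otimes>\<^sub>M ?D) (\<lambda>p. ennreal (r (fst p - f (snd p)))))"
    using r by (subst integral_real_density) simp_all
  also have "\<dots> = (\<integral>\<omega>. log 2 (r (N \<omega>) / q (f (W \<omega>) + N \<omega>)) \<partial>M)"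
    unfolding joint[symmetric] by (subst integral_distr) simp_all
  finally show ?thesis .
qed

lemma (in prob_space) normal_second_moment:
  assumes \<sigma>: "0 < \<sigma>" and X: "distributed M lborel X (normal_density 0 \<sigma>)"
  shows "has_bochner_integral M (\<lambda>\<omega>. (X \<omega>)\<^sup>2) (\<sigma>\<^sup>2)"
proof -
  have "expectation (\<lambda>\<omega>. (X \<omega>)\<^sup>2) = \<sigma>\<^sup>2"
    using normal_distributed_variance[OF \<sigma> X] normal_distributed_expectation[OF \<sigma> X] by simp
  moreover have "integrable M (\<lambda>\<omega>. (X \<omega>)\<^sup>2)"
    using integrable_normal_moment[OF \<sigma>, of 0 2] \<sigma>
    by (subst distributed_integrable[OF X, symmetric]) simp_all
  ultimately show ?thesis by (simp add: has_bochner_integral_iff)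
qed

text \<open>In natural logarithms both quadratic exponents have mean 1/2 and cancel, whatever the
  dependence between \<open>X\<close> and \<open>Y\<close>. What remains is the ratio of the
  normalising constants.\<close>

lemma (in prob_space) expectation_log_normal_ratio:
  assumes "0 < s" "0 < \<tau>" and X: "distributed M lborel X (normal_density 0 s)" and Y: "distributed M lborel Y (normal_density 0 \<tau>)"
  shows "has_bochner_integral M (\<lambda>\<omega>. log 2 (normal_density 0 s (X \<omega>) / normal_density 0 \<tau> (Y \<omega>))) (log 2 (\<tau> / s))"
proof -
  have eq: "log 2 (normal_density 0 s x / normal_density 0 \<tau> y)
      = log 2 (\<tau> / s) + (y\<^sup>2 * (1 / (2 * \<tau>\<^sup>2 * ln 2)) - x\<^sup>2 * (1 / (2 * s\<^sup>2 * ln 2)))" for x y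
  proof -
    have "ln (normal_density 0 s x / normal_density 0 \<tau> y) = ln (\<tau> / s) + (y\<^sup>2 / (2 * \<tau>\<^sup>2) - x\<^sup>2 / (2 * s\<^sup>2))"
      using assms(1,2) normal_density_pos[of s 0 x] normal_density_pos[of \<tau> 0 y]
      by (simp add: ln_div ln_normal_density)
    then show ?thesis by (simp add: log_def add_divide_distrib diff_divide_distrib)
  qed
  have "has_bochner_integral M (\<lambda>\<omega>. log 2 (\<tau> / s) + ((Y \<omega>)\<^sup>2 * (1 / (2 * \<tau>\<^sup>2 * ln 2)) - (X \<omega>)\<^sup>2 * (1 / (2 * s\<^sup>2 * ln 2))))
     (log 2 (\<tau> / s) + (\<tau>\<^sup>2 * (1 / (2 * \<tau>\<^sup>2 * ln 2)) - s\<^sup>2 * (1 / (2 * s\<^sup>2 * ln 2))))"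
    by (intro has_bochner_integral_add has_bochner_integral_diff has_bochner_integral_mult_left
        normal_second_moment[OF assms(1) X] normal_second_moment[OF assms(2) Y])
       (simp add: has_bochner_integral_iff prob_space)
  then show ?thesis using assms(1,2) by (simp add: eq)
qed

section \<open>Linear functionals of independent standard Gaussians\<close>

lemma indep_vars_coords: "prob_space.indep_vars (\<Pi>\<^sub>M i\<in>UNIV. stdN) (\<lambda>_. borel) (\<lambda>i z. z i) (UNIV :: 'i set)"
proof -
  let ?N = "\<Pi>\<^sub>M i\<in>(UNIV :: 'i set). stdN"
  interpret N: prob_space ?N by (rule prob_space_PiM_stdN)
  have c: "distr ?N borel (\<lambda>z. z i) = stdN" for i
    using distr_PiM_component[of UNIV "\<lambda>_. stdN" i] prob_space_stdN
    by (simp cong: distr_cong)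
  have "distr ?N (\<Pi>\<^sub>M i\<in>UNIV. borel) (\<lambda>z. \<lambda>i\<in>UNIV. z i) = ?N"
    by (simp add: restrict_def distr_id2 sets_PiM_stdN)
  then show ?thesis
    by (subst N.indep_vars_iff_distr_eq_PiM) (simp_all add: c)
qed

lemma indep_laws_coords:
  fixes f :: "('i \<Rightarrow> real) \<Rightarrow> 'a" and g :: "('i \<Rightarrow> real) \<Rightarrow> 'b"
  assumes f: "f \<in> (\<Pi>\<^sub>M i\<in>UNIV. borel) \<rightarrow>\<^sub>M T" and g: "g \<in> (\<Pi>\<^sub>M i\<in>UNIV. borel) \<rightarrow>\<^sub>M S"
    and "A \<inter> B = {}"
    and fA: "\<And>z z'. (\<And>i. i \<in> A \<Longrightarrow> z i = z' i) \<Longrightarrow> f z = f z'"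
    and gB: "\<And>z z'. (\<And>i. i \<in> B \<Longrightarrow> z i = z' i) \<Longrightarrow> g z = g z'"
  shows "indep_laws (\<Pi>\<^sub>M i\<in>UNIV. stdN) T f S g"
proof -
  interpret N: prob_space "\<Pi>\<^sub>M i\<in>(UNIV :: 'i set). stdN" by (rule prob_space_PiM_stdN)
  \<comment> \<open>Extension by 0 turns a function that only looks at a block of coordinates into a
    measurable function of the restriction to that block, to which the independence of disjoint
    blocks applies.\<close>
  let ?ext = "\<lambda>C x i. if i \<in> C then x i else (0::real)"
  have ext: "?ext C \<in> (\<Pi>\<^sub>M i\<in>C. borel) \<rightarrow>\<^sub>M (\<Pi>\<^sub>M i\<in>(UNIV :: 'i set). borel)" for C
  proof (rule measurable_PiM_single')
    fix i show "(\<lambda>x. ?ext C x i) \<in> borel_measurable (\<Pi>\<^sub>M i\<in>C. borel)" by (cases "i \<in> C") simp_all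
  qed simp
  let ?rA = "\<lambda>z. restrict z A" and ?rB = "\<lambda>z. restrict z B"
  let ?MA = "\<Pi>\<^sub>M i\<in>A. borel :: real measure" and ?MB = "\<Pi>\<^sub>M i\<in>B. borel :: real measure"
  let ?N = "\<Pi>\<^sub>M i\<in>(UNIV :: 'i set). stdN"
  have [measurable]: "?rA \<in> ?N \<rightarrow>\<^sub>M ?MA" "?rB \<in> ?N \<rightarrow>\<^sub>M ?MB" by (auto intro!: measurable_restrict)
  have fe[measurable]: "(\<lambda>x. f (?ext A x)) \<in> ?MA \<rightarrow>\<^sub>M T" and ge[measurable]: "(\<lambda>x. g (?ext B x)) \<in> ?MB \<rightarrow>\<^sub>M S"
    using measurable_compose[OF ext f] measurable_compose[OF ext g] by simp_all
  have fr: "f (?ext A (?rA z)) = f z" and gr: "g (?ext B (?rB z)) = g z" for z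
    by (rule fA, simp) (rule gB, simp)
  have fm: "f \<in> ?N \<rightarrow>\<^sub>M T" and gm: "g \<in> ?N \<rightarrow>\<^sub>M S"
    using f g by (simp_all add: sets_PiM_stdN cong: measurable_cong_sets)
  interpret G: prob_space "distr (distr ?N ?MB ?rB) S (\<lambda>x. g (?ext B x))"
    by (intro prob_space.prob_space_distr N.prob_space_distr) simp_all
  have "N.indep_var ?MA ?rA ?MB ?rB"
    using N.indep_var_restrict[OF indep_vars_coords \<open>A \<inter> B = {}\<close>] by simp
  then have AB: "distr ?N (?MA \<Otimes>\<^sub>M ?MB) (\<lambda>z. (?rA z, ?rB z)) = distr ?N ?MA ?rA \<Otimes>\<^sub>M distr ?N ?MB ?rB"
    by (simp add: N.indep_var_distribution_eq)
  have "distr ?N (T \<Otimes>\<^sub>M S) (\<lambda>z. (f z, g z))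
      = distr (distr ?N (?MA \<Otimes>\<^sub>M ?MB) (\<lambda>z. (?rA z, ?rB z))) (T \<Otimes>\<^sub>M S) (\<lambda>(x, y). (f (?ext A x), g (?ext B y)))"
    by (subst distr_distr) (simp_all add: comp_def fr gr)
  also have "\<dots> = distr (distr ?N ?MA ?rA) T (\<lambda>x. f (?ext A x)) \<Otimes>\<^sub>M distr (distr ?N ?MB ?rB) S (\<lambda>x. g (?ext B x))"
    unfolding AB by (rule pair_measure_distr[symmetric]) (simp_all add: G.sigma_finite_measure_axioms)
  also have "\<dots> = distr ?N T f \<Otimes>\<^sub>M distr ?N S g"
    by (simp add: distr_distr comp_def fr gr)
  finally show ?thesis using fm gm by (simp add: indep_laws_def)
qed

lemma distributed_stdN_coord: "distributed (\<Pi>\<^sub>M i\<in>UNIV. stdN) lborel (\<lambda>z. z i) std_normal_density"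
  unfolding distributed_def
proof (intro conjI)
  have "distr (\<Pi>\<^sub>M i\<in>UNIV. stdN) lborel (\<lambda>z. z i) = distr (\<Pi>\<^sub>M i\<in>UNIV. stdN) stdN (\<lambda>z. z i)"
    by (rule distr_cong) simp_all
  then show "distr (\<Pi>\<^sub>M i\<in>UNIV. stdN) lborel (\<lambda>z. z i) = density lborel (\<lambda>x. ennreal (std_normal_density x))"
    using distr_PiM_component[of UNIV "\<lambda>_. stdN" i] prob_space_stdN by (simp add: stdN_def)
qed simp_all

lemma distributed_linear:
  fixes a :: "'i::finite \<Rightarrow> real"
  assumes pos: "(\<Sum>i\<in>J. (a i)\<^sup>2) > 0"
  shows "distributed (\<Pi>\<^sub>M i\<in>UNIV. stdN) lborel (\<lambda>z. \<Sum>i\<in>J. a i * z i) (normal_density 0 (sqrt (\<Sum>i\<in>J. (a i)\<^sup>2)))"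
proof -
  interpret N: prob_space "\<Pi>\<^sub>M i\<in>(UNIV :: 'i set). stdN" by (rule prob_space_PiM_stdN)
  \<comment> \<open>Vanishing coefficients are dropped, since a summand of standard deviation 0 has
    no normal density.\<close>
  let ?J = "{i \<in> J. a i \<noteq> 0}"
  have 1: "(\<Sum>i\<in>J. a i * z i) = (\<Sum>i\<in>?J. a i * z i)" for z
    by (rule sum.mono_neutral_right) auto
  have 2: "(\<Sum>i\<in>J. (a i)\<^sup>2) = (\<Sum>i\<in>?J. (a i)\<^sup>2)"
    by (rule sum.mono_neutral_right) auto
  have ne: "?J \<noteq> {}"
  proof
    assume "?J = {}"
    with 2 have "(\<Sum>i\<in>J. (a i)\<^sup>2) = 0" by (simp only: sum.empty)
    with pos show False by simp
  qed
  have "distributed (\<Pi>\<^sub>M i\<in>UNIV. stdN) lborel (\<lambda>z. \<Sum>i\<in>?J. a i * z i)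
     (normal_density (\<Sum>i\<in>?J. 0) (sqrt (\<Sum>i\<in>?J. \<bar>a i\<bar>\<^sup>2)))"
  proof (rule N.sum_indep_normal)
    show "N.indep_vars (\<lambda>i. borel) (\<lambda>i z. a i * z i) ?J"
      using N.indep_vars_compose2[OF N.indep_vars_subset[OF indep_vars_coords], of ?J "\<lambda>i x. a i * x" "\<lambda>_. borel"]
      by simp
    fix i assume "i \<in> ?J"
    then show "distributed (\<Pi>\<^sub>M i\<in>UNIV. stdN) lborel (\<lambda>z. a i * z i) (normal_density 0 \<bar>a i\<bar>)"
      using N.normal_density_affine[OF distributed_stdN_coord, of "a i" 0 i] by simp
  qed (use ne in auto)
  then show ?thesis by (simp add: 1 2)
qed

text \<open>\<open>W\<close> need not determine the coordinates in \<open>A\<close>, only their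
  contribution to the sum, through \<open>f\<close>. The remaining coordinates then act as
  independent additive noise. This formulation stays valid when the inputs do not determine the
  underlying coordinates, as for \<rho>^2 = 1.\<close>

lemma mutual_information_linear:
  fixes a :: "'i::finite \<Rightarrow> real"
  assumes W: "W \<in> (\<Pi>\<^sub>M i\<in>UNIV. borel) \<rightarrow>\<^sub>M T" and f: "f \<in> borel_measurable T"
    and WA: "\<And>z z'. (\<And>i. i \<in> A \<Longrightarrow> z i = z' i) \<Longrightarrow> W z = W z'"
    and fW: "\<And>z. f (W z) = (\<Sum>i\<in>A. a i * z i)"
    and pos: "(\<Sum>i\<in>-A. (a i)\<^sup>2) > 0"
  shows "prob_space.mutual_information (\<Pi>\<^sub>M i\<in>UNIV. stdN) 2 borel T (\<lambda>z. \<Sum>i\<in>UNIV. a i * z i) W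
    = log 2 (sqrt (\<Sum>i\<in>UNIV. (a i)\<^sup>2) / sqrt (\<Sum>i\<in>-A. (a i)\<^sup>2))"
proof -
  interpret N: prob_space "\<Pi>\<^sub>M i\<in>(UNIV :: 'i set). stdN" by (rule prob_space_PiM_stdN)
  let ?s = "sqrt (\<Sum>i\<in>-A. (a i)\<^sup>2)" and ?\<tau> = "sqrt (\<Sum>i\<in>UNIV. (a i)\<^sup>2)"
  have "(\<Sum>i\<in>-A. (a i)\<^sup>2) \<le> (\<Sum>i\<in>UNIV. (a i)\<^sup>2)" by (rule sum_mono2) auto
  with pos have pos': "(\<Sum>i\<in>UNIV. (a i)\<^sup>2) > 0" by linarith
  have split: "(\<Sum>i\<in>UNIV. a i * z i) = f (W z) + (\<Sum>i\<in>-A. a i * z i)" for z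
    using sum.union_disjoint[of A "-A" "\<lambda>i. a i * z i"] by (simp add: fW)
  have X: "distributed (\<Pi>\<^sub>M i\<in>UNIV. stdN) lborel (\<lambda>z. \<Sum>i\<in>-A. a i * z i) (normal_density 0 ?s)"
    by (rule distributed_linear[OF pos])
  have Y: "distributed (\<Pi>\<^sub>M i\<in>UNIV. stdN) lborel (\<lambda>z. f (W z) + (\<Sum>i\<in>-A. a i * z i)) (normal_density 0 ?\<tau>)"
    unfolding split[symmetric] by (rule distributed_linear[OF pos'])
  have "N.mutual_information 2 borel T (\<lambda>z. f (W z) + (\<Sum>i\<in>-A. a i * z i)) W
    = N.expectation (\<lambda>z. log 2 (normal_density 0 ?s (\<Sum>i\<in>-A. a i * z i) / normal_density 0 ?\<tau> (f (W z) + (\<Sum>i\<in>-A. a i * z i))))"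
  proof (rule N.mutual_information_additive_noise[OF _ X f Y])
    show "indep_laws (\<Pi>\<^sub>M i\<in>UNIV. stdN) T W borel (\<lambda>z. \<Sum>i\<in>-A. a i * z i)"
      by (rule indep_laws_coords[OF W, of _ _ A "- A"]) (auto intro!: WA sum.cong)
  qed (use pos' in \<open>auto simp: normal_density_pos\<close>)
  also have "\<dots> = log 2 (?\<tau> / ?s)"
    using N.expectation_log_normal_ratio[OF _ _ X Y] pos pos' by (simp add: has_bochner_integral_iff)
  finally show ?thesis by (simp add: split)
qed

section \<open>Invariance of Gaussian pairs under reflections, and Gaussian pairs in regression
  form\<close>

lemma nn_integral_lborel_reflect:
  fixes \<rho> r :: real and K :: "real \<Rightarrow> real \<Rightarrow> ennreal"
  assumes one: "\<rho>\<^sup>2 + r\<^sup>2 = 1" and K: "(\<lambda>p. K (fst p) (snd p)) \<in> borel_measurable (borel \<Otimes>\<^sub>M borel)"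
  shows "(\<integral>\<^sup>+ y. \<integral>\<^sup>+ x. K (\<rho> * x + r * y) (r * x - \<rho> * y) \<partial>lborel \<partial>lborel) = (\<integral>\<^sup>+ y. \<integral>\<^sup>+ x. K x y \<partial>lborel \<partial>lborel)"
proof (cases "r = 0")
  \<comment> \<open>The map is then (x, y) to (\<rho> x, - \<rho> y) with \<bar>\<rho>\<bar> = 1;
    the other case divides by \<open>r\<close>.\<close>
  case True
  have Kc: "(\<lambda>z. K (u z) (v z)) \<in> borel_measurable M" if [measurable]: "u \<in> borel_measurable M" "v \<in> borel_measurable M" for u v and M :: "'z measure"
    using measurable_compose[OF _ K, of "\<lambda>z. (u z, v z)" M] by simp
  have \<rho>: "\<bar>\<rho>\<bar> = 1" "\<rho> \<noteq> 0" using one True by (auto simp: power2_eq_1_iff)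
  have "(\<integral>\<^sup>+ x. K (\<rho> * x) w \<partial>lborel) = (\<integral>\<^sup>+ x. K x w \<partial>lborel)" for w
    using nn_integral_real_affine[of "\<lambda>x. K x w" \<rho> 0] \<rho> by (simp add: Kc)
  moreover have "(\<integral>\<^sup>+ y. (\<integral>\<^sup>+ x. K x (- (\<rho> * y)) \<partial>lborel) \<partial>lborel) = (\<integral>\<^sup>+ y. \<integral>\<^sup>+ x. K x y \<partial>lborel \<partial>lborel)"
    using nn_integral_real_affine[of "\<lambda>y. \<integral>\<^sup>+ x. K x y \<partial>lborel" "-\<rho>" 0] \<rho>
    by (simp add: Kc lborel.borel_measurable_nn_integral case_prod_unfold)
  ultimately show ?thesis using True by simp
next
  case False
  have Kc[measurable (raw)]: "(\<lambda>z. K (u z) (v z)) \<in> borel_measurable M" if [measurable]: "u \<in> borel_measurable M" "v \<in> borel_measurable M" for u v and M :: "'z measure"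
    using measurable_compose[OF _ K, of "\<lambda>z. (u z, v z)" M] by simp
  \<comment> \<open>For fixed y substitute v = r x - \<rho> y; by \<rho>^2 + r^2 = 1 the first
    argument becomes (\<rho> v + y) / r. After exchanging the integrals, substituting for y absorbs
    exactly the factor \<bar>1 / r\<bar> left by the first substitution.\<close>
  have "(\<integral>\<^sup>+ y. \<integral>\<^sup>+ x. K (\<rho> * x + r * y) (r * x - \<rho> * y) \<partial>lborel \<partial>lborel)
      = (\<integral>\<^sup>+ y. \<integral>\<^sup>+ v. \<bar>1 / r\<bar> * K (\<rho> / r * v + 1 / r * y) v \<partial>lborel \<partial>lborel)"
  proof (rule nn_integral_cong)
    fix y
    have u: "\<rho> * (\<rho> * y / r + 1 / r * v) + r * y = \<rho> / r * v + 1 / r * y" for v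
    proof -
      have "\<rho> * (\<rho> * y / r + 1 / r * v) + r * y = \<rho> / r * v + (\<rho>\<^sup>2 + r\<^sup>2) / r * y"
        using False by (simp add: field_simps power2_eq_square)
      then show ?thesis by (simp add: one)
    qed
    have v: "r * (\<rho> * y / r + 1 / r * v) - \<rho> * y = v" for v using False by (simp add: field_simps)
    show "(\<integral>\<^sup>+ x. K (\<rho> * x + r * y) (r * x - \<rho> * y) \<partial>lborel) = (\<integral>\<^sup>+ v. \<bar>1 / r\<bar> * K (\<rho> / r * v + 1 / r * y) v \<partial>lborel)"
      using False by (subst nn_integral_real_affine[where c = "1 / r" and t = "\<rho> * y / r"])
        (simp_all only: u v, auto simp: nn_integral_cmult)
  qed
  also have "\<dots> = (\<integral>\<^sup>+ v. \<integral>\<^sup>+ y. \<bar>1 / r\<bar> * K (\<rho> / r * v + 1 / r * y) v \<partial>lborel \<partial>lborel)"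
    by (rule lborel_pair.Fubini') simp
  also have "\<dots> = (\<integral>\<^sup>+ v. \<integral>\<^sup>+ x. K x v \<partial>lborel \<partial>lborel)"
  proof (rule nn_integral_cong)
    fix v
    show "(\<integral>\<^sup>+ y. \<bar>1 / r\<bar> * K (\<rho> / r * v + 1 / r * y) v \<partial>lborel) = (\<integral>\<^sup>+ x. K x v \<partial>lborel)"
      using nn_integral_real_affine[of "\<lambda>x. K x v" "1 / r" "\<rho> / r * v"] False by (simp add: nn_integral_cmult)
  qed
  finally show ?thesis .
qed

lemma nn_integral_stdN_reflect:
  fixes \<rho> r :: real and K :: "real \<Rightarrow> real \<Rightarrow> ennreal"
  assumes one: "\<rho>\<^sup>2 + r\<^sup>2 = 1" and K: "(\<lambda>p. K (fst p) (snd p)) \<in> borel_measurable (borel \<Otimes>\<^sub>M borel)"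
  shows "(\<integral>\<^sup>+ y. \<integral>\<^sup>+ x. K (\<rho> * x + r * y) (r * x - \<rho> * y) \<partial>stdN \<partial>stdN) = (\<integral>\<^sup>+ y. \<integral>\<^sup>+ x. K x y \<partial>stdN \<partial>stdN)"
proof -
  have Kc[measurable (raw)]: "(\<lambda>z. K (u z) (v z)) \<in> borel_measurable M" if [measurable]: "u \<in> borel_measurable M" "v \<in> borel_measurable M" for u v and M :: "'z measure"
    using measurable_compose[OF _ K, of "\<lambda>z. (u z, v z)" M] by simp
  let ?w = "\<lambda>x y. ennreal (std_normal_density y) * ennreal (std_normal_density x)"
  have exp2: "(\<integral>\<^sup>+ y. \<integral>\<^sup>+ x. L x y \<partial>stdN \<partial>stdN) = (\<integral>\<^sup>+ y. \<integral>\<^sup>+ x. ?w x y * L x y \<partial>lborel \<partial>lborel)"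
    if L: "(\<lambda>p. L (fst p) (snd p)) \<in> borel_measurable (borel \<Otimes>\<^sub>M borel)" for L :: "real \<Rightarrow> real \<Rightarrow> ennreal"
  proof -
    have Lc[measurable (raw)]: "(\<lambda>z. L (u z) (v z)) \<in> borel_measurable M"
      if [measurable]: "u \<in> borel_measurable M" "v \<in> borel_measurable M" for u v and M :: "'z measure"
      using measurable_compose[OF _ L, of "\<lambda>z. (u z, v z)" M] by simp
    show ?thesis unfolding stdN_def
      by (simp add: nn_integral_density nn_integral_cmult[symmetric] mult.assoc lborel.borel_measurable_nn_integral)
  qed
  have w: "?w x y = ?w (\<rho> * x + r * y) (r * x - \<rho> * y)" for x y
  proof -
    have "(\<rho> * x + r * y)\<^sup>2 + (r * x - \<rho> * y)\<^sup>2 = (\<rho>\<^sup>2 + r\<^sup>2) * (x\<^sup>2 + y\<^sup>2)"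
      by (simp add: power2_eq_square algebra_simps)
    then have "(\<rho> * x + r * y)\<^sup>2 + (r * x - \<rho> * y)\<^sup>2 = x\<^sup>2 + y\<^sup>2" by (simp add: one)
    then have e: "- (r * x - \<rho> * y)\<^sup>2 / 2 + - (\<rho> * x + r * y)\<^sup>2 / 2 = - y\<^sup>2 / 2 + - x\<^sup>2 / 2" by (simp add: field_simps)
    have dd: "std_normal_density v * std_normal_density u = exp (- v\<^sup>2 / 2 + - u\<^sup>2 / 2) / (2 * pi)" for u v :: real
      by (simp add: std_normal_density_def exp_add[symmetric])
    have "std_normal_density y * std_normal_density x = std_normal_density (r * x - \<rho> * y) * std_normal_density (\<rho> * x + r * y)"
      unfolding dd e ..
    then show ?thesis by (simp add: ennreal_mult[symmetric])
  qed
  have "(\<integral>\<^sup>+ y. \<integral>\<^sup>+ x. K (\<rho> * x + r * y) (r * x - \<rho> * y) \<partial>stdN \<partial>stdN)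
     = (\<integral>\<^sup>+ y. \<integral>\<^sup>+ x. ?w (\<rho> * x + r * y) (r * x - \<rho> * y) * K (\<rho> * x + r * y) (r * x - \<rho> * y) \<partial>lborel \<partial>lborel)"
    by (subst exp2) (simp_all add: w[symmetric])
  also have "\<dots> = (\<integral>\<^sup>+ y. \<integral>\<^sup>+ x. ?w x y * K x y \<partial>lborel \<partial>lborel)"
    using nn_integral_lborel_reflect[OF one, of "\<lambda>x y. ?w x y * K x y"] by simp
  also have "\<dots> = (\<integral>\<^sup>+ y. \<integral>\<^sup>+ x. K x y \<partial>stdN \<partial>stdN)"
    by (subst exp2) simp_all
  finally show ?thesis .
qed

text \<open>Serves two purposes: exchanging the roles of \<open>p\<close> and \<open>q\<close> in
  the input law, and turning the two uncorrelated parts of the downlink outputs into functions of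
  disjoint coordinates.\<close>

definition reflect :: "'i \<Rightarrow> 'i \<Rightarrow> real \<Rightarrow> real \<Rightarrow> ('i \<Rightarrow> real) \<Rightarrow> 'i \<Rightarrow> real" where
  "reflect p q \<rho> r z = z(p := \<rho> * z p + r * z q, q := r * z p - \<rho> * z q)"

lemma measurable_reflect: "reflect p q \<rho> r \<in> (\<Pi>\<^sub>M i\<in>UNIV. borel) \<rightarrow>\<^sub>M (\<Pi>\<^sub>M i\<in>UNIV. borel)"
proof (rule measurable_PiM_single')
  fix i show "(\<lambda>z. reflect p q \<rho> r z i) \<in> borel_measurable (\<Pi>\<^sub>M i\<in>UNIV. borel)"
    by (cases "i = q"; cases "i = p") (simp_all add: reflect_def)
qed simp

lemma nn_integral_PiM_two_coords:
  fixes F :: "('i \<Rightarrow> real) \<Rightarrow> ennreal"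
  assumes F[measurable]: "F \<in> borel_measurable (\<Pi>\<^sub>M i\<in>UNIV. borel)"
  shows "(\<integral>\<^sup>+ z. F z \<partial>(\<Pi>\<^sub>M i\<in>UNIV. stdN))
    = (\<integral>\<^sup>+ z. \<integral>\<^sup>+ y. \<integral>\<^sup>+ x. F (z(q := y, p := x)) \<partial>stdN \<partial>stdN \<partial>(\<Pi>\<^sub>M i\<in>UNIV. stdN))"
proof -
  interpret S: prob_space stdN by (rule prob_space_stdN)
  have upd: "(\<lambda>(z, x). F (z(p := x))) \<in> borel_measurable ((\<Pi>\<^sub>M i\<in>UNIV. borel) \<Otimes>\<^sub>M stdN)"
    using measurable_compose[OF measurable_fun_upd2 F, of p]
    by (simp add: case_prod_unfold cong: measurable_cong_sets)
  have "(\<integral>\<^sup>+ z. F z \<partial>(\<Pi>\<^sub>M i\<in>UNIV. stdN)) = (\<integral>\<^sup>+ z. (\<integral>\<^sup>+ x. F (z(p := x)) \<partial>stdN) \<partial>(\<Pi>\<^sub>M i\<in>UNIV. stdN))"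
    by (rule nn_integral_PiM_fun_upd) (simp_all add: prob_space_stdN)
  also have "\<dots> = (\<integral>\<^sup>+ z. (\<integral>\<^sup>+ y. (\<integral>\<^sup>+ x. F ((z(q := y))(p := x)) \<partial>stdN) \<partial>stdN) \<partial>(\<Pi>\<^sub>M i\<in>UNIV. stdN))"
    by (rule nn_integral_PiM_fun_upd) (use S.borel_measurable_nn_integral[OF upd] in \<open>simp_all add: prob_space_stdN\<close>)
  finally show ?thesis .
qed

lemma distr_reflect:
  fixes p q :: 'i
  assumes pq: "p \<noteq> q" and one: "\<rho>\<^sup>2 + r\<^sup>2 = 1"
  shows "distr (\<Pi>\<^sub>M i\<in>UNIV. stdN) (\<Pi>\<^sub>M i\<in>UNIV. stdN) (reflect p q \<rho> r) = (\<Pi>\<^sub>M i\<in>UNIV. stdN)"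
    (is "distr ?N ?N _ = ?N")
proof (rule measure_eqI)
  have R: "reflect p q \<rho> r \<in> ?N \<rightarrow>\<^sub>M ?N"
    using measurable_reflect by (simp add: sets_PiM_stdN cong: measurable_cong_sets)
  fix A assume "A \<in> sets (distr ?N ?N (reflect p q \<rho> r))"
  then have A: "A \<in> sets ?N" "A \<in> sets (\<Pi>\<^sub>M i\<in>UNIV. borel)" by (simp_all add: sets_PiM_stdN)
  let ?F = "indicator A :: ('i \<Rightarrow> real) \<Rightarrow> ennreal"
  have F: "?F \<in> borel_measurable (\<Pi>\<^sub>M i\<in>UNIV. borel)" using A by simp
  have e: "reflect p q \<rho> r (z(q := y, p := x)) = z(q := r * x - \<rho> * y, p := \<rho> * x + r * y)" for z x y
    using pq by (auto simp: reflect_def)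
  have "emeasure (distr ?N ?N (reflect p q \<rho> r)) A = (\<integral>\<^sup>+ z. ?F (reflect p q \<rho> r z) \<partial>?N)"
    using A(1) R by (subst nn_integral_indicator[symmetric], simp, subst nn_integral_distr) simp_all
  also have "\<dots> = (\<integral>\<^sup>+ z. \<integral>\<^sup>+ y. \<integral>\<^sup>+ x. ?F (z(q := r * x - \<rho> * y, p := \<rho> * x + r * y)) \<partial>stdN \<partial>stdN \<partial>?N)"
    by (subst nn_integral_PiM_two_coords[of _ q p]) (use measurable_compose[OF measurable_reflect F] in \<open>simp_all add: e\<close>)
  also have "\<dots> = (\<integral>\<^sup>+ z. \<integral>\<^sup>+ y. \<integral>\<^sup>+ x. ?F (z(q := y, p := x)) \<partial>stdN \<partial>stdN \<partial>?N)"
  proof (rule nn_integral_cong)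
    fix z :: "'i \<Rightarrow> real"
    have "(\<lambda>w. z(q := snd w, p := fst w)) \<in> borel \<Otimes>\<^sub>M borel \<rightarrow>\<^sub>M (\<Pi>\<^sub>M i\<in>UNIV. borel)"
    proof (rule measurable_PiM_single')
      fix i show "(\<lambda>w. (z(q := snd w, p := fst w)) i) \<in> borel_measurable (borel \<Otimes>\<^sub>M borel)"
        by (cases "i = q"; cases "i = p") simp_all
    qed simp
    from measurable_compose[OF this F]
    show "(\<integral>\<^sup>+ y. \<integral>\<^sup>+ x. ?F (z(q := r * x - \<rho> * y, p := \<rho> * x + r * y)) \<partial>stdN \<partial>stdN)
      = (\<integral>\<^sup>+ y. \<integral>\<^sup>+ x. ?F (z(q := y, p := x)) \<partial>stdN \<partial>stdN)"
      by (rule nn_integral_stdN_reflect[OF one, of "\<lambda>x y. ?F (z(q := y, p := x))"])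
  qed
  also have "\<dots> = (\<integral>\<^sup>+ z. ?F z \<partial>?N)" by (rule nn_integral_PiM_two_coords[OF F, symmetric])
  also have "\<dots> = emeasure ?N A" using A(1) by simp
  finally show "emeasure (distr ?N ?N (reflect p q \<rho> r)) A = emeasure ?N A" .
qed simp

text \<open>The bivariate density in regression form, marginal times residual. No covariance matrix
  has to be inverted, and the logarithm splits into two one-dimensional terms.\<close>

lemma (in prob_space) distributed_normal_pair:
  assumes indep: "indep_laws M borel W borel V" and "s > 0" "t > 0"
    and V: "distributed M lborel V (normal_density 0 s)" and W: "distributed M lborel W (normal_density 0 t)"
  shows "distributed M lborel (\<lambda>\<omega>. (b * W \<omega> + V \<omega>, W \<omega>))
    (\<lambda>p. normal_density 0 s (fst p - b * snd p) * normal_density 0 t (snd p))"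
  unfolding distributed_def
proof (intro conjI)
  have [measurable]: "W \<in> borel_measurable M" "V \<in> borel_measurable M"
    using indep by (simp_all add: indep_laws_def)
  have m: "(\<lambda>p :: real \<times> real. normal_density 0 t (snd p)) \<in> borel_measurable borel"
    "(\<lambda>p :: real \<times> real. normal_density 0 s (fst p - b * snd p)) \<in> borel_measurable borel"
    unfolding borel_prod[symmetric] by measurable
  show "(\<lambda>\<omega>. (b * W \<omega> + V \<omega>, W \<omega>)) \<in> M \<rightarrow>\<^sub>M lborel" by simp
  show "(\<lambda>p. ennreal (normal_density 0 s (fst p - b * snd p) * normal_density 0 t (snd p))) \<in> borel_measurable lborel"
    using m by simp
  have dW: "distr M borel W = density lborel (normal_density 0 t)"
    using distributed_distr_eq_density[OF W] by (metis distr_cong sets_lborel)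
  interpret T: prob_space "density lborel (normal_density 0 t)" using \<open>t > 0\<close> by (rule prob_space_normal_density)
  have "lborel \<Otimes>\<^sub>M density lborel (normal_density 0 t) = density lborel (\<lambda>_. 1) \<Otimes>\<^sub>M density lborel (normal_density 0 t)"
    by (simp add: density_1)
  also have "\<dots> = density (lborel \<Otimes>\<^sub>M lborel) (\<lambda>(x, y). 1 * ennreal (normal_density 0 t y))"
    by (rule pair_measure_density) (simp_all add: T.sigma_finite_measure_axioms sigma_finite_lborel)
  finally have pr: "lborel \<Otimes>\<^sub>M density lborel (normal_density 0 t) = density lborel (\<lambda>p. ennreal (normal_density 0 t (snd p)))"
    by (simp add: case_prod_unfold lborel_prod)
  have "distr M lborel (\<lambda>\<omega>. (b * W \<omega> + V \<omega>, W \<omega>)) = distr M (borel \<Otimes>\<^sub>M borel) (\<lambda>\<omega>. (b * W \<omega> + V \<omega>, W \<omega>))"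
    by (rule distr_cong) (simp_all only: borel_prod sets_lborel)
  also have "\<dots> = density (lborel \<Otimes>\<^sub>M distr M borel W) (\<lambda>(x, w). ennreal (normal_density 0 s (x - b * w)))"
    by (rule distr_additive_noise[OF indep V]) simp
  also have "\<dots> = density lborel (\<lambda>p. ennreal (normal_density 0 s (fst p - b * snd p) * normal_density 0 t (snd p)))"
    unfolding dW pr by (subst density_density_eq) (simp_all add: case_prod_unfold ennreal_mult mult.commute m)
  finally show "distr M lborel (\<lambda>\<omega>. (b * W \<omega> + V \<omega>, W \<omega>))
    = density lborel (\<lambda>p. ennreal (normal_density 0 s (fst p - b * snd p) * normal_density 0 t (snd p)))" .
qed

lemma indep_laws_comp_reflect:
  fixes p q :: 'i
  assumes "p \<noteq> q" "\<rho>\<^sup>2 + r\<^sup>2 = 1" and XY: "indep_laws (\<Pi>\<^sub>M i\<in>UNIV. stdN) S X T Y"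
  shows "indep_laws (\<Pi>\<^sub>M i\<in>UNIV. stdN) S (\<lambda>z. X (reflect p q \<rho> r z)) T (\<lambda>z. Y (reflect p q \<rho> r z))"
proof -
  let ?N = "\<Pi>\<^sub>M i\<in>(UNIV :: 'i set). stdN" and ?R = "reflect p q \<rho> r"
  have R: "?R \<in> ?N \<rightarrow>\<^sub>M ?N" using measurable_reflect by (simp add: sets_PiM_stdN cong: measurable_cong_sets)
  have X: "X \<in> ?N \<rightarrow>\<^sub>M S" and Y: "Y \<in> ?N \<rightarrow>\<^sub>M T" using XY by (simp_all add: indep_laws_def)
  have dX: "distr ?N S (\<lambda>z. X (?R z)) = distr ?N S X"
    using distr_distr[OF X R] distr_reflect[OF assms(1,2)] by (simp add: comp_def)
  have dY: "distr ?N T (\<lambda>z. Y (?R z)) = distr ?N T Y"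
    using distr_distr[OF Y R] distr_reflect[OF assms(1,2)] by (simp add: comp_def)
  have "distr ?N (S \<Otimes>\<^sub>M T) (\<lambda>z. (X (?R z), Y (?R z))) = distr ?N (S \<Otimes>\<^sub>M T) (\<lambda>z. (X z, Y z))"
    using distr_distr[OF measurable_Pair[OF X Y] R] distr_reflect[OF assms(1,2)] by (simp add: comp_def)
  then show ?thesis using XY measurable_compose[OF R X] measurable_compose[OF R Y]
    by (simp add: indep_laws_def dX dY)
qed

section \<open>The Gaussian input law\<close>

text \<open>Built from independent coordinates, with the input of \<open>p\<close> as base and that
  of \<open>q\<close> as \<rho> times it plus an independent part. Conditioning on the input of
  \<open>p\<close> can be read off from the coordinates; conditioning on that of \<open>q\<close>
  goes through \<open>gauss_law_swap\<close>.\<close>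

definition gauss_input :: "real \<Rightarrow> real \<Rightarrow> user \<Rightarrow> user \<Rightarrow> (node \<Rightarrow> real) \<Rightarrow> node \<Rightarrow> real" where
  "gauss_input P \<rho> p q z a = sqrt P * (if a = Usr q then \<rho> * z (Usr p) + sqrt (1 - \<rho>\<^sup>2) * z (Usr q) else z a)"

definition gauss_law :: "real \<Rightarrow> real \<Rightarrow> user \<Rightarrow> user \<Rightarrow> (node \<Rightarrow> real) measure" where
  "gauss_law P \<rho> p q = distr (\<Pi>\<^sub>M a\<in>UNIV. stdN) (\<Pi>\<^sub>M a\<in>UNIV. borel) (gauss_input P \<rho> p q)"

lemma measurable_gauss_input: "gauss_input P \<rho> p q \<in> (\<Pi>\<^sub>M a\<in>UNIV. borel) \<rightarrow>\<^sub>M (\<Pi>\<^sub>M a\<in>UNIV. borel)"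
proof (rule measurable_PiM_single')
  fix a show "(\<lambda>z. gauss_input P \<rho> p q z a) \<in> borel_measurable (\<Pi>\<^sub>M a\<in>UNIV. borel)"
    by (cases "a = Usr q") (simp_all add: gauss_input_def)
qed simp

lemma measurable_gauss_input_stdN: "gauss_input P \<rho> p q \<in> (\<Pi>\<^sub>M a\<in>UNIV. stdN) \<rightarrow>\<^sub>M (\<Pi>\<^sub>M a\<in>UNIV. borel)"
  using measurable_gauss_input by (simp add: sets_PiM_stdN cong: measurable_cong_sets)

lemma prob_space_gauss_law: "prob_space (gauss_law P \<rho> p q)"
  unfolding gauss_law_def
  by (intro prob_space.prob_space_distr prob_space_PiM_stdN measurable_gauss_input_stdN)

lemma sets_gauss_law: "sets (gauss_law P \<rho> p q) = sets (\<Pi>\<^sub>M a\<in>UNIV. borel)"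
  by (simp add: gauss_law_def)

lemma gauss_law_power:
  assumes "P > 0" "\<rho>\<^sup>2 \<le> 1" "p \<noteq> q"
  shows "(\<integral>\<^sup>+ x. ennreal ((x a)\<^sup>2) \<partial>gauss_law P \<rho> p q) = ennreal P"
proof -
  interpret N: prob_space "\<Pi>\<^sub>M a\<in>(UNIV :: node set). stdN" by (rule prob_space_PiM_stdN)
  have one: "(\<integral>\<^sup>+ z. ennreal ((\<alpha> * z (b :: node))\<^sup>2) \<partial>(\<Pi>\<^sub>M a\<in>UNIV. stdN)) = ennreal (\<alpha>\<^sup>2)" for \<alpha> b
    using nn_integral_add_coord_square[of "\<lambda>_. 0" b \<alpha>] by simp
  have "(\<integral>\<^sup>+ x. ennreal ((x a)\<^sup>2) \<partial>gauss_law P \<rho> p q) = (\<integral>\<^sup>+ z. ennreal ((gauss_input P \<rho> p q z a)\<^sup>2) \<partial>(\<Pi>\<^sub>M a\<in>UNIV. stdN))"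
    unfolding gauss_law_def by (subst nn_integral_distr) (simp_all add: measurable_gauss_input_stdN)
  also have "\<dots> = ennreal P"
  proof (cases "a = Usr q")
    case True
    have "(\<integral>\<^sup>+ z. ennreal ((gauss_input P \<rho> p q z a)\<^sup>2) \<partial>(\<Pi>\<^sub>M a\<in>UNIV. stdN))
      = (\<integral>\<^sup>+ z. ennreal (((sqrt P * \<rho>) * z (Usr p) + (sqrt P * sqrt (1 - \<rho>\<^sup>2)) * z (Usr q))\<^sup>2) \<partial>(\<Pi>\<^sub>M a\<in>UNIV. stdN))"
      by (simp add: gauss_input_def True algebra_simps)
    also have "\<dots> = (\<integral>\<^sup>+ z. ennreal (((sqrt P * \<rho>) * z (Usr p))\<^sup>2) \<partial>(\<Pi>\<^sub>M a\<in>UNIV. stdN)) + ennreal ((sqrt P * sqrt (1 - \<rho>\<^sup>2))\<^sup>2)"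
      using assms(3) by (intro nn_integral_add_coord_square) simp_all
    also have "\<dots> = ennreal (P * \<rho>\<^sup>2) + ennreal (P * (1 - \<rho>\<^sup>2))"
      using assms unfolding one by (simp add: power_mult_distrib)
    also have "\<dots> = ennreal P"
      using assms by (subst ennreal_plus[symmetric]) (simp_all add: algebra_simps)
    finally show ?thesis .
  next
    case False
    then show ?thesis using assms(1) by (simp add: gauss_input_def one)
  qed
  finally show ?thesis .
qed

lemma gauss_law_swap:
  assumes "\<rho>\<^sup>2 \<le> 1" "p \<noteq> q"
  shows "gauss_law P \<rho> p q = gauss_law P \<rho> q p"
proof -
  let ?N = "\<Pi>\<^sub>M a\<in>(UNIV :: node set). stdN" and ?s = "sqrt (1 - \<rho>\<^sup>2)"
  have s: "?s\<^sup>2 = 1 - \<rho>\<^sup>2" using assms(1) by simp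
  \<comment> \<open>\<open>?R1\<close> makes the normalised input of \<open>q\<close> a coordinate
    of its own, and \<open>?R2\<close> only flips the sign of the complementary one.\<close>
  let ?R1 = "reflect (Usr p) (Usr q) (- ?s) \<rho>" and ?R2 = "reflect (Usr q) (Usr p) 1 0"
  have R: "reflect a b u v \<in> ?N \<rightarrow>\<^sub>M ?N" for a b u v
    using measurable_reflect by (simp add: sets_PiM_stdN cong: measurable_cong_sets)
  have eq: "gauss_input P \<rho> p q z = gauss_input P \<rho> q p (?R2 (?R1 z))" for z
  proof
    fix a
    have "\<rho> * (\<rho> * z (Usr p) + ?s * z (Usr q)) + ?s * (?s * z (Usr p) - \<rho> * z (Usr q)) = (\<rho>\<^sup>2 + ?s\<^sup>2) * z (Usr p)"
      by (simp add: algebra_simps power2_eq_square)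
    also have "\<dots> = z (Usr p)" by (simp add: s)
    finally show "gauss_input P \<rho> p q z a = gauss_input P \<rho> q p (?R2 (?R1 z)) a"
      using assms(2) by (auto simp: gauss_input_def reflect_def algebra_simps)
  qed
  have "gauss_law P \<rho> p q = distr ?N (\<Pi>\<^sub>M a\<in>UNIV. borel) (\<lambda>z. (\<lambda>z. gauss_input P \<rho> q p (?R2 z)) (?R1 z))"
    unfolding gauss_law_def by (simp add: eq[symmetric])
  also have "\<dots> = distr (distr ?N ?N ?R1) (\<Pi>\<^sub>M a\<in>UNIV. borel) (\<lambda>z. gauss_input P \<rho> q p (?R2 z))"
    by (subst distr_distr[OF measurable_compose[OF R measurable_gauss_input_stdN] R]) (simp add: comp_def)
  also have "distr ?N ?N ?R1 = ?N"
    by (rule distr_reflect) (use assms(2) s in simp_all)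
  also have "distr ?N (\<Pi>\<^sub>M a\<in>UNIV. borel) (\<lambda>z. gauss_input P \<rho> q p (?R2 z))
     = distr (distr ?N ?N ?R2) (\<Pi>\<^sub>M a\<in>UNIV. borel) (gauss_input P \<rho> q p)"
    by (subst distr_distr[OF measurable_gauss_input_stdN R]) (simp add: comp_def)
  also have "distr ?N ?N ?R2 = ?N"
    by (rule distr_reflect) (use assms(2) in simp_all)
  finally show ?thesis by (simp add: gauss_law_def)
qed

section \<open>The joint law of inputs and noises as an image of independent Gaussians\<close>

abbreviation iid :: "(node + node \<Rightarrow> real) measure" where
  "iid \<equiv> \<Pi>\<^sub>M i\<in>UNIV. stdN"

definition joint_map :: "real \<Rightarrow> real \<Rightarrow> user \<Rightarrow> user \<Rightarrow> (node + node \<Rightarrow> real) \<Rightarrow> (node \<Rightarrow> real) \<times> (node \<Rightarrow> real)" where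
  "joint_map P \<rho> p q z = (gauss_input P \<rho> p q (\<lambda>a. z (Inl a)), \<lambda>a. z (Inr a))"

lemma measurable_reindex: "(\<lambda>z a. z (f a)) \<in> (\<Pi>\<^sub>M i\<in>UNIV. borel) \<rightarrow>\<^sub>M (\<Pi>\<^sub>M a\<in>UNIV. borel :: real measure)"
  by (rule measurable_PiM_single') simp_all

lemma measurable_joint_map: "joint_map P \<rho> p q \<in> (\<Pi>\<^sub>M i\<in>UNIV. borel) \<rightarrow>\<^sub>M ((\<Pi>\<^sub>M a\<in>UNIV. borel) \<Otimes>\<^sub>M (\<Pi>\<^sub>M a\<in>UNIV. borel))"
  unfolding joint_map_def
  by (intro measurable_Pair measurable_compose[OF measurable_reindex measurable_gauss_input] measurable_reindex)

lemma Mjoint_gauss_law: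
  "Mjoint (gauss_law P \<rho> p q) = distr iid ((\<Pi>\<^sub>M a\<in>UNIV. borel) \<Otimes>\<^sub>M (\<Pi>\<^sub>M a\<in>UNIV. stdN)) (joint_map P \<rho> p q)"
proof -
  let ?S = "\<Pi>\<^sub>M a\<in>(UNIV :: node set). stdN" and ?T = "\<Pi>\<^sub>M a\<in>(UNIV :: node set). borel :: real measure"
  have re: "distr iid ?S (\<lambda>z a. z (f a)) = ?S" if "inj f" for f :: "node \<Rightarrow> node + node"
    using distr_PiM_reindex[of UNIV "\<lambda>_. stdN" f UNIV] that prob_space_stdN by (simp add: restrict_def)
  have m: "(\<lambda>z a. z (f a)) \<in> iid \<rightarrow>\<^sub>M ?S" for f :: "node \<Rightarrow> node + node"
    using measurable_reindex[of f] by (simp add: sets_PiM_stdN cong: measurable_cong_sets)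
  have "indep_laws iid ?T (\<lambda>z. gauss_input P \<rho> p q (\<lambda>a. z (Inl a))) ?S (\<lambda>z a. z (Inr a))"
  proof (rule indep_laws_coords[where A = "range Inl" and B = "range Inr"])
    show "(\<lambda>z. gauss_input P \<rho> p q (\<lambda>a. z (Inl a))) \<in> (\<Pi>\<^sub>M i\<in>UNIV. borel) \<rightarrow>\<^sub>M ?T"
      by (rule measurable_compose[OF measurable_reindex measurable_gauss_input])
    show "(\<lambda>z a. z (Inr a)) \<in> (\<Pi>\<^sub>M i\<in>UNIV. borel) \<rightarrow>\<^sub>M ?S"
      using measurable_reindex[of Inr] by (simp add: sets_PiM_stdN cong: measurable_cong_sets)
  qed auto
  then have "distr iid (?T \<Otimes>\<^sub>M ?S) (joint_map P \<rho> p q)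
     = distr iid ?T (\<lambda>z. gauss_input P \<rho> p q (\<lambda>a. z (Inl a))) \<Otimes>\<^sub>M distr iid ?S (\<lambda>z a. z (Inr a))"
    unfolding joint_map_def[abs_def] indep_laws_def by blast
  also have "distr iid ?S (\<lambda>z a. z (Inr a)) = ?S" by (rule re) simp
  also have "distr iid ?T (\<lambda>z. gauss_input P \<rho> p q (\<lambda>a. z (Inl a)))
      = distr (distr iid ?S (\<lambda>z a. z (Inl a))) ?T (gauss_input P \<rho> p q)"
    by (subst distr_distr[OF measurable_gauss_input_stdN m]) (simp add: comp_def)
  also have "distr iid ?S (\<lambda>z a. z (Inl a)) = ?S" by (rule re) simp
  finally show ?thesis by (simp add: Mjoint_def gauss_law_def)
qed

lemma mutual_information_distr_space:
  assumes "prob_space M" and g: "g \<in> M \<rightarrow>\<^sub>M K" and X: "X \<in> K \<rightarrow>\<^sub>M S" and Y: "Y \<in> K \<rightarrow>\<^sub>M T"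
  shows "prob_space.mutual_information (distr M K g) b S T X Y = prob_space.mutual_information M b S T (\<lambda>z. X (g z)) (\<lambda>z. Y (g z))"
proof -
  interpret M: prob_space M by fact
  interpret K: prob_space "distr M K g" by (rule M.prob_space_distr[OF g])
  show ?thesis
    unfolding M.mutual_information_def K.mutual_information_def
    using distr_distr[OF X g] distr_distr[OF Y g] distr_distr[OF measurable_Pair[OF X Y] g]
    by (simp add: comp_def)
qed

lemma CMI_gauss_law:
  fixes P \<rho> :: real and p q :: user
  assumes A: "A \<in> ((\<Pi>\<^sub>M a\<in>UNIV. borel) \<Otimes>\<^sub>M (\<Pi>\<^sub>M a\<in>UNIV. borel)) \<rightarrow>\<^sub>M MA"
    and B: "B \<in> ((\<Pi>\<^sub>M a\<in>UNIV. borel) \<Otimes>\<^sub>M (\<Pi>\<^sub>M a\<in>UNIV. borel)) \<rightarrow>\<^sub>M MB"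
    and C: "C \<in> ((\<Pi>\<^sub>M a\<in>UNIV. borel) \<Otimes>\<^sub>M (\<Pi>\<^sub>M a\<in>UNIV. borel)) \<rightarrow>\<^sub>M MC"
  defines "e \<equiv> joint_map P \<rho> p q"
  shows "CMI (gauss_law P \<rho> p q) MA MB MC A B C
    = prob_space.mutual_information iid 2 MB (MA \<Otimes>\<^sub>M MC) (\<lambda>z. B (e z)) (\<lambda>z. (A (e z), C (e z)))
      - prob_space.mutual_information iid 2 MB MC (\<lambda>z. B (e z)) (\<lambda>z. C (e z))"
proof -
  interpret N: prob_space iid by (rule prob_space_PiM_stdN)
  let ?K = "(\<Pi>\<^sub>M a\<in>(UNIV :: node set). borel :: real measure) \<Otimes>\<^sub>M (\<Pi>\<^sub>M a\<in>(UNIV :: node set). stdN)"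
  have sK: "sets ?K = sets ((\<Pi>\<^sub>M a\<in>UNIV. borel) \<Otimes>\<^sub>M (\<Pi>\<^sub>M a\<in>UNIV. borel))"
    by (intro sets_pair_measure_cong) (simp_all add: sets_PiM_stdN)
  note mc = measurable_cong_sets[OF sK refl]
  have e: "e \<in> iid \<rightarrow>\<^sub>M ?K"
    unfolding e_def using measurable_joint_map
    by (subst measurable_cong_sets[OF sets_PiM_stdN sK])
  have ABC: "A \<in> ?K \<rightarrow>\<^sub>M MA" "B \<in> ?K \<rightarrow>\<^sub>M MB" "C \<in> ?K \<rightarrow>\<^sub>M MC" using A B C by (simp_all only: mc)
  interpret K: prob_space "distr iid ?K e" by (rule N.prob_space_distr[OF e])
  show ?thesis
    unfolding CMI_def Mjoint_gauss_law e_def[symmetric] K.conditional_mutual_information_def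
    by (simp add: mutual_information_distr_space[OF N.prob_space_axioms e] ABC measurable_Pair)
qed

text \<open>Both mutual informations concern the same scalar output, so its total variance cancels
  in the difference. What remains is the residual variance given \<open>C\<close> over that given
  \<open>(A, C)\<close>, and the latter is 1, the receiver noise. \<open>f\<^sub>1\<close> and
  \<open>f\<^sub>2\<close> certify that the conditioning reveals the parts of the output carried by
  \<open>S\<^sub>1\<close> and \<open>S\<^sub>2\<close>.\<close>

lemma CMI_linear:
  fixes a :: "node + node \<Rightarrow> real"
  assumes A: "A \<in> ((\<Pi>\<^sub>M a\<in>UNIV. borel) \<Otimes>\<^sub>M (\<Pi>\<^sub>M a\<in>UNIV. borel)) \<rightarrow>\<^sub>M MA"
    and B: "B \<in> ((\<Pi>\<^sub>M a\<in>UNIV. borel) \<Otimes>\<^sub>M (\<Pi>\<^sub>M a\<in>UNIV. borel)) \<rightarrow>\<^sub>M borel"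
    and C: "C \<in> ((\<Pi>\<^sub>M a\<in>UNIV. borel) \<Otimes>\<^sub>M (\<Pi>\<^sub>M a\<in>UNIV. borel)) \<rightarrow>\<^sub>M MC"
    and lin: "\<And>z. B (joint_map P \<rho> p q z) = (\<Sum>i\<in>UNIV. a i * z i)"
    and dep1: "\<And>z z'. (\<And>i. i \<in> S\<^sub>1 \<Longrightarrow> z i = z' i) \<Longrightarrow> (A (joint_map P \<rho> p q z), C (joint_map P \<rho> p q z)) = (A (joint_map P \<rho> p q z'), C (joint_map P \<rho> p q z'))"
    and dep2: "\<And>z z'. (\<And>i. i \<in> S\<^sub>2 \<Longrightarrow> z i = z' i) \<Longrightarrow> C (joint_map P \<rho> p q z) = C (joint_map P \<rho> p q z')"
    and f1: "f\<^sub>1 \<in> borel_measurable (MA \<Otimes>\<^sub>M MC)" "\<And>z. f\<^sub>1 (A (joint_map P \<rho> p q z), C (joint_map P \<rho> p q z)) = (\<Sum>i\<in>S\<^sub>1. a i * z i)"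
    and f2: "f\<^sub>2 \<in> borel_measurable MC" "\<And>z. f\<^sub>2 (C (joint_map P \<rho> p q z)) = (\<Sum>i\<in>S\<^sub>2. a i * z i)"
    and pos: "(\<Sum>i\<in>-S\<^sub>1. (a i)\<^sup>2) = 1" "(\<Sum>i\<in>-S\<^sub>2. (a i)\<^sup>2) = v" "v > 0"
  shows "CMI (gauss_law P \<rho> p q) MA borel MC A B C = log 2 v / 2"
proof -
  let ?e = "joint_map P \<rho> p q"
  note mA = measurable_compose[OF measurable_joint_map[of P \<rho> p q] A]
  note mC = measurable_compose[OF measurable_joint_map[of P \<rho> p q] C]
  let ?t = "\<Sum>i\<in>UNIV. (a i)\<^sup>2"
  have "(\<Sum>i\<in>-S\<^sub>1. (a i)\<^sup>2) \<le> ?t" by (rule sum_mono2) auto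
  then have t: "?t > 0" using pos by simp
  have 1: "prob_space.mutual_information iid 2 borel (MA \<Otimes>\<^sub>M MC) (\<lambda>z. \<Sum>i\<in>UNIV. a i * z i) (\<lambda>z. (A (?e z), C (?e z)))
     = log 2 (sqrt ?t / sqrt (\<Sum>i\<in>-S\<^sub>1. (a i)\<^sup>2))"
    by (rule mutual_information_linear[OF measurable_Pair[OF mA mC] f1(1) dep1 f1(2)]) (simp_all add: pos(1))
  have 2: "prob_space.mutual_information iid 2 borel MC (\<lambda>z. \<Sum>i\<in>UNIV. a i * z i) (\<lambda>z. C (?e z))
     = log 2 (sqrt ?t / sqrt (\<Sum>i\<in>-S\<^sub>2. (a i)\<^sup>2))"
    by (rule mutual_information_linear[OF mC f2(1) dep2 f2(2)]) (simp_all add: pos)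
  show ?thesis
    unfolding CMI_gauss_law[OF A B C] lin 1 2 pos(1,2)
    using t pos(3) by (simp add: log_divide log_def ln_sqrt ln_div diff_divide_distrib)
qed

lemma sum_UNIV_user:
  fixes f :: "user \<Rightarrow> real"
  assumes "j \<noteq> k" "j \<noteq> l" "k \<noteq> l"
  shows "(\<Sum>u\<in>UNIV. f u) = f j + f k + f (l :: user)"
proof -
  have u: "(UNIV :: user set) = {j, k, l}" using assms by (cases j; cases k; cases l) (auto simp: UNIV_user)
  show ?thesis unfolding u using assms by (simp add: add.assoc)
qed

lemma sum_UNIV_node:
  fixes f :: "node \<Rightarrow> real"
  assumes "j \<noteq> k" "j \<noteq> l" "k \<noteq> l"
  shows "(\<Sum>a\<in>UNIV. f a) = f Rly + f (Usr j) + f (Usr k) + f (Usr l)"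
proof -
  have "(\<Sum>a\<in>UNIV. f a) = f Rly + (\<Sum>a\<in>Usr ` UNIV. f a)"
    unfolding UNIV_node by (subst sum.insert) auto
  also have "(\<Sum>a\<in>Usr ` UNIV. f a) = (\<Sum>u\<in>UNIV. f (Usr u))"
    by (subst sum.reindex) (auto simp: inj_on_def)
  finally show ?thesis by (simp add: sum_UNIV_user[OF assms])
qed

text \<open>Expands a sum over any set of coordinates under an arbitrary labelling of the users, so
  the closed forms below need no case split over the six labellings.\<close>

lemma sum_node_node:
  fixes f :: "node + node \<Rightarrow> real"
  assumes "j \<noteq> k" "j \<noteq> l" "k \<noteq> l"
  shows "(\<Sum>i\<in>S. f i) = (\<Sum>a\<in>{Rly, Usr j, Usr k, Usr l}. (if Inl a \<in> S then f (Inl a) else 0) + (if Inr a \<in> S then f (Inr a) else 0))"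
proof -
  have "(\<Sum>i\<in>S. f i) = (\<Sum>i\<in>UNIV. if i \<in> S then f i else 0)"
    by (simp add: sum.If_cases)
  also have "\<dots> = (\<Sum>a\<in>UNIV. (if Inl a \<in> S then f (Inl a) else 0)) + (\<Sum>a\<in>UNIV. (if Inr a \<in> S then f (Inr a) else 0))"
    unfolding UNIV_Plus_UNIV[symmetric] by (subst sum.Plus) auto
  also have "\<dots> = (\<Sum>a\<in>{Rly, Usr j, Usr k, Usr l}. (if Inl a \<in> S then f (Inl a) else 0) + (if Inr a \<in> S then f (Inr a) else 0))"
    using assms by (simp add: sum_UNIV_node[OF assms] sum.distrib)
  finally show ?thesis .
qed

lemma mem_image_Inl [simp]: "Inl a \<in> Inl ` S \<longleftrightarrow> a \<in> S" "Inr b \<notin> Inl ` S"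
  by auto

section \<open>Closed forms of the conditional mutual informations\<close>

lemma measurable_Xv: "Xv a \<in> borel_measurable ((\<Pi>\<^sub>M a\<in>UNIV. borel) \<Otimes>\<^sub>M (\<Pi>\<^sub>M a\<in>UNIV. borel))"
  unfolding Xv_def by simp

lemma measurable_Yv: "Yv h a \<in> borel_measurable ((\<Pi>\<^sub>M a\<in>UNIV. borel) \<Otimes>\<^sub>M (\<Pi>\<^sub>M a\<in>UNIV. borel))"
  unfolding Yv_def by (cases a) simp_all

lemma Xv_joint_map: "Xv a (joint_map P \<rho> p q z) = sqrt P * (if a = Usr q then \<rho> * z (Inl (Usr p)) + sqrt (1 - \<rho>\<^sup>2) * z (Inl (Usr q)) else z (Inl a))"
  by (simp add: Xv_def joint_map_def gauss_input_def)

lemma Yv_Rly_joint_map: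
  assumes "j \<noteq> k" "j \<noteq> l" "k \<noteq> l"
  shows "Yv h Rly (joint_map P \<rho> p q z) = h j * Xv (Usr j) (joint_map P \<rho> p q z) + h k * Xv (Usr k) (joint_map P \<rho> p q z)
    + h l * Xv (Usr l) (joint_map P \<rho> p q z) + z (Inr Rly)"
proof -
  have "Yv h Rly \<omega> = obs h (fst \<omega>) (snd \<omega>) Rly" for \<omega> by (simp add: Yv_def obs_def)
  then show ?thesis by (simp add: obs_Rly[OF assms] Xv_def joint_map_def)
qed

lemma Yv_Usr_joint_map: "Yv h (Usr l) (joint_map P \<rho> p q z) = h l * (sqrt P * z (Inl Rly)) + z (Inr (Usr l))"
  by (simp add: Yv_def joint_map_def gauss_input_def)

text \<open>The coefficients of the relay output in the independent coordinates. The coordinate of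
  \<open>p\<close> also feeds the input of \<open>q\<close>, hence its weight h_p + \<rho>
  h_q.\<close>

definition relay_coef :: "real \<Rightarrow> real \<Rightarrow> user \<Rightarrow> user \<Rightarrow> (user \<Rightarrow> real) \<Rightarrow> node + node \<Rightarrow> real" where
  "relay_coef P \<rho> p q h i = (case i of
      Inl a \<Rightarrow> (case a of Rly \<Rightarrow> 0 | Usr u \<Rightarrow>
        sqrt P * (if u = p then h p + \<rho> * h q else if u = q then sqrt (1 - \<rho>\<^sup>2) * h q else h u))
    | Inr a \<Rightarrow> if a = Rly then 1 else 0)"

text \<open>The transmitter is the user whose input is built on that of \<open>p\<close>. Given the
  input of \<open>p\<close>, only its independent part, of power P (1 - \<rho>^2), stays unknown;
  the predictable part is the extra weight \<rho> h_j in \<open>f\<^sub>2\<close>.\<close>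

lemma CMI_uplink_out_correlated:
  assumes d: "j \<noteq> k" "j \<noteq> l" "k \<noteq> l" and p: "p = k \<or> p = l" and P: "P > 0" and \<rho>: "\<rho>\<^sup>2 \<le> 1"
  shows "CMI (gauss_law P \<rho> p j) borel borel (borel \<Otimes>\<^sub>M (borel \<Otimes>\<^sub>M borel))
      (Xv (Usr j)) (Yv h Rly) (\<lambda>\<omega>. (Xv (Usr k) \<omega>, Xv (Usr l) \<omega>, Xv Rly \<omega>))
    = log 2 (1 + (h j)\<^sup>2 * (P * (1 - \<rho>\<^sup>2))) / 2"
proof (rule CMI_linear[where a = "relay_coef P \<rho> p j h" and S\<^sub>1 = "range Inl" and S\<^sub>2 = "Inl ` {Usr k, Usr l, Rly}"
    and f\<^sub>1 = "\<lambda>(x, y, w, v). h j * x + h k * y + h l * w"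
    and f\<^sub>2 = "\<lambda>(y, w, v). (if p = k then h k + \<rho> * h j else h k) * y + (if p = l then h l + \<rho> * h j else h l) * w"])
  note [measurable] = measurable_Xv measurable_Yv
  show "(Xv (Usr j)) \<in> ((\<Pi>\<^sub>M a\<in>UNIV. borel) \<Otimes>\<^sub>M (\<Pi>\<^sub>M a\<in>UNIV. borel)) \<rightarrow>\<^sub>M borel"
    "Yv h Rly \<in> borel_measurable ((\<Pi>\<^sub>M a\<in>UNIV. borel) \<Otimes>\<^sub>M (\<Pi>\<^sub>M a\<in>UNIV. borel))"
    "(\<lambda>\<omega>. (Xv (Usr k) \<omega>, Xv (Usr l) \<omega>, Xv Rly \<omega>)) \<in> ((\<Pi>\<^sub>M a\<in>UNIV. borel) \<Otimes>\<^sub>M (\<Pi>\<^sub>M a\<in>UNIV. borel)) \<rightarrow>\<^sub>M (borel \<Otimes>\<^sub>M (borel \<Otimes>\<^sub>M borel))"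
    by measurable
  show "Yv h Rly (joint_map P \<rho> p j z) = (\<Sum>i\<in>UNIV. relay_coef P \<rho> p j h i * z i)" for z
    using d p by (auto simp: Yv_Rly_joint_map[OF d] Xv_joint_map sum_node_node[OF d] relay_coef_def algebra_simps)
  show "(\<Sum>i\<in>- range Inl. (relay_coef P \<rho> p j h i)\<^sup>2) = 1"
    using d by (simp add: sum_node_node[OF d] relay_coef_def)
  have s: "(sqrt P)\<^sup>2 = P" "(sqrt (1 - \<rho>\<^sup>2))\<^sup>2 = 1 - \<rho>\<^sup>2" using P \<rho> by simp_all
  show v: "(\<Sum>i\<in>- Inl ` {Usr k, Usr l, Rly}. (relay_coef P \<rho> p j h i)\<^sup>2) = 1 + (h j)\<^sup>2 * (P * (1 - \<rho>\<^sup>2))"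
    using d p by (auto simp: sum_node_node[OF d] relay_coef_def power_mult_distrib s power2_sum algebra_simps)
  have "1 \<le> (\<Sum>i\<in>- Inl ` {Usr k, Usr l, Rly}. (relay_coef P \<rho> p j h i)\<^sup>2)"
    using member_le_sum[of "Inr Rly" "- Inl ` {Usr k, Usr l, Rly}" "\<lambda>i. (relay_coef P \<rho> p j h i)\<^sup>2"]
    by (simp add: relay_coef_def)
  then show "1 + (h j)\<^sup>2 * (P * (1 - \<rho>\<^sup>2)) > 0" unfolding v by linarith
  show "(\<lambda>(x, y, w, v). h j * x + h k * y + h l * w) (Xv (Usr j) (joint_map P \<rho> p j z), Xv (Usr k) (joint_map P \<rho> p j z), Xv (Usr l) (joint_map P \<rho> p j z), Xv Rly (joint_map P \<rho> p j z)) = (\<Sum>i\<in>range Inl. relay_coef P \<rho> p j h i * z i)" for z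
    using d p by (auto simp: Xv_joint_map sum_node_node[OF d] relay_coef_def algebra_simps)
  show "(\<lambda>(y, w, v). (if p = k then h k + \<rho> * h j else h k) * y + (if p = l then h l + \<rho> * h j else h l) * w) (Xv (Usr k) (joint_map P \<rho> p j z), Xv (Usr l) (joint_map P \<rho> p j z), Xv Rly (joint_map P \<rho> p j z))
     = (\<Sum>i\<in>Inl ` {Usr k, Usr l, Rly}. relay_coef P \<rho> p j h i * z i)" for z
    using d p by (auto simp: Xv_joint_map sum_node_node[OF d] relay_coef_def algebra_simps)
qed (use d p in \<open>auto simp: Xv_joint_map\<close>)

text \<open>Both correlated inputs are conditioned on, and the transmitter is independent of them,
  so it keeps its full power.\<close>

lemma CMI_uplink_out_independent:
  assumes d: "j \<noteq> k" "j \<noteq> l" "k \<noteq> l" and pq: "(p, q) = (k, l) \<or> (p, q) = (l, k)" and P: "P > 0" and \<rho>: "\<rho>\<^sup>2 \<le> 1"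
  shows "CMI (gauss_law P \<rho> p q) borel borel (borel \<Otimes>\<^sub>M (borel \<Otimes>\<^sub>M borel))
      (Xv (Usr j)) (Yv h Rly) (\<lambda>\<omega>. (Xv (Usr k) \<omega>, Xv (Usr l) \<omega>, Xv Rly \<omega>))
    = log 2 (1 + (h j)\<^sup>2 * P) / 2"
proof (rule CMI_linear[where a = "relay_coef P \<rho> p q h" and S\<^sub>1 = "range Inl" and S\<^sub>2 = "Inl ` {Usr k, Usr l, Rly}"
    and f\<^sub>1 = "\<lambda>(x, y, w, v). h j * x + h k * y + h l * w"
    and f\<^sub>2 = "\<lambda>(y, w, v). h k * y + h l * w"])
  note [measurable] = measurable_Xv measurable_Yv
  show "(Xv (Usr j)) \<in> ((\<Pi>\<^sub>M a\<in>UNIV. borel) \<Otimes>\<^sub>M (\<Pi>\<^sub>M a\<in>UNIV. borel)) \<rightarrow>\<^sub>M borel"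
    "Yv h Rly \<in> borel_measurable ((\<Pi>\<^sub>M a\<in>UNIV. borel) \<Otimes>\<^sub>M (\<Pi>\<^sub>M a\<in>UNIV. borel))"
    "(\<lambda>\<omega>. (Xv (Usr k) \<omega>, Xv (Usr l) \<omega>, Xv Rly \<omega>)) \<in> ((\<Pi>\<^sub>M a\<in>UNIV. borel) \<Otimes>\<^sub>M (\<Pi>\<^sub>M a\<in>UNIV. borel)) \<rightarrow>\<^sub>M (borel \<Otimes>\<^sub>M (borel \<Otimes>\<^sub>M borel))"
    by measurable
  show "Yv h Rly (joint_map P \<rho> p q z) = (\<Sum>i\<in>UNIV. relay_coef P \<rho> p q h i * z i)" for z
    using d pq by (auto simp: Yv_Rly_joint_map[OF d] Xv_joint_map sum_node_node[OF d] relay_coef_def algebra_simps)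
  show "(\<Sum>i\<in>- range Inl. (relay_coef P \<rho> p q h i)\<^sup>2) = 1"
    using d by (simp add: sum_node_node[OF d] relay_coef_def)
  have s: "(sqrt P)\<^sup>2 = P" "(sqrt (1 - \<rho>\<^sup>2))\<^sup>2 = 1 - \<rho>\<^sup>2" using P \<rho> by simp_all
  show v: "(\<Sum>i\<in>- Inl ` {Usr k, Usr l, Rly}. (relay_coef P \<rho> p q h i)\<^sup>2) = 1 + (h j)\<^sup>2 * P"
    using d pq by (auto simp: sum_node_node[OF d] relay_coef_def power_mult_distrib s power2_sum algebra_simps)
  have "1 \<le> (\<Sum>i\<in>- Inl ` {Usr k, Usr l, Rly}. (relay_coef P \<rho> p q h i)\<^sup>2)"
    using member_le_sum[of "Inr Rly" "- Inl ` {Usr k, Usr l, Rly}" "\<lambda>i. (relay_coef P \<rho> p q h i)\<^sup>2"]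
    by (simp add: relay_coef_def)
  then show "1 + (h j)\<^sup>2 * P > 0" unfolding v by linarith
  show "(\<lambda>(x, y, w, v). h j * x + h k * y + h l * w) (Xv (Usr j) (joint_map P \<rho> p q z), Xv (Usr k) (joint_map P \<rho> p q z), Xv (Usr l) (joint_map P \<rho> p q z), Xv Rly (joint_map P \<rho> p q z)) = (\<Sum>i\<in>range Inl. relay_coef P \<rho> p q h i * z i)" for z
    using d pq by (auto simp: Xv_joint_map sum_node_node[OF d] relay_coef_def algebra_simps)
  show "(\<lambda>(y, w, v). h k * y + h l * w) (Xv (Usr k) (joint_map P \<rho> p q z), Xv (Usr l) (joint_map P \<rho> p q z), Xv Rly (joint_map P \<rho> p q z))
     = (\<Sum>i\<in>Inl ` {Usr k, Usr l, Rly}. relay_coef P \<rho> p q h i * z i)" for z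
    using d pq by (auto simp: Xv_joint_map sum_node_node[OF d] relay_coef_def algebra_simps)
qed (use d pq in \<open>auto simp: Xv_joint_map\<close>)

text \<open>The receiver \<open>l\<close> is the base of the correlated pair. Knowing its input
  removes the share \<rho>^2 of the power of \<open>q\<close>, while the other transmitter keeps all
  of its power.\<close>

lemma CMI_uplink_in_correlated:
  assumes d: "j \<noteq> k" "j \<noteq> l" "k \<noteq> l" and q: "q = j \<or> q = k" and P: "P > 0" and \<rho>: "\<rho>\<^sup>2 \<le> 1"
  shows "CMI (gauss_law P \<rho> l q) (borel \<Otimes>\<^sub>M borel) borel (borel \<Otimes>\<^sub>M borel)
      (\<lambda>\<omega>. (Xv (Usr j) \<omega>, Xv (Usr k) \<omega>)) (Yv h Rly) (\<lambda>\<omega>. (Xv (Usr l) \<omega>, Xv Rly \<omega>))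
    = log 2 (1 + P * ((h j)\<^sup>2 + (h k)\<^sup>2 - \<rho>\<^sup>2 * (h q)\<^sup>2)) / 2"
proof (rule CMI_linear[where a = "relay_coef P \<rho> l q h" and S\<^sub>1 = "range Inl" and S\<^sub>2 = "Inl ` {Usr l, Rly}"
    and f\<^sub>1 = "\<lambda>w. h j * fst (fst w) + h k * snd (fst w) + h l * fst (snd w)"
    and f\<^sub>2 = "\<lambda>(w, v). (h l + \<rho> * h q) * w"])
  note [measurable] = measurable_Xv measurable_Yv
  show "(\<lambda>\<omega>. (Xv (Usr j) \<omega>, Xv (Usr k) \<omega>)) \<in> ((\<Pi>\<^sub>M a\<in>UNIV. borel) \<Otimes>\<^sub>M (\<Pi>\<^sub>M a\<in>UNIV. borel)) \<rightarrow>\<^sub>M (borel \<Otimes>\<^sub>M borel)"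
    "Yv h Rly \<in> borel_measurable ((\<Pi>\<^sub>M a\<in>UNIV. borel) \<Otimes>\<^sub>M (\<Pi>\<^sub>M a\<in>UNIV. borel))"
    "(\<lambda>\<omega>. (Xv (Usr l) \<omega>, Xv Rly \<omega>)) \<in> ((\<Pi>\<^sub>M a\<in>UNIV. borel) \<Otimes>\<^sub>M (\<Pi>\<^sub>M a\<in>UNIV. borel)) \<rightarrow>\<^sub>M (borel \<Otimes>\<^sub>M borel)"
    by measurable
  show "Yv h Rly (joint_map P \<rho> l q z) = (\<Sum>i\<in>UNIV. relay_coef P \<rho> l q h i * z i)" for z
    using d q by (auto simp: Yv_Rly_joint_map[OF d] Xv_joint_map sum_node_node[OF d] relay_coef_def algebra_simps)
  show "(\<Sum>i\<in>- range Inl. (relay_coef P \<rho> l q h i)\<^sup>2) = 1"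
    using d by (simp add: sum_node_node[OF d] relay_coef_def)
  have s: "(sqrt P)\<^sup>2 = P" "(sqrt (1 - \<rho>\<^sup>2))\<^sup>2 = 1 - \<rho>\<^sup>2" using P \<rho> by simp_all
  show v: "(\<Sum>i\<in>- Inl ` {Usr l, Rly}. (relay_coef P \<rho> l q h i)\<^sup>2) = 1 + P * ((h j)\<^sup>2 + (h k)\<^sup>2 - \<rho>\<^sup>2 * (h q)\<^sup>2)"
    using d q by (auto simp: sum_node_node[OF d] relay_coef_def power_mult_distrib s power2_sum algebra_simps)
  have "1 \<le> (\<Sum>i\<in>- Inl ` {Usr l, Rly}. (relay_coef P \<rho> l q h i)\<^sup>2)"
    using member_le_sum[of "Inr Rly" "- Inl ` {Usr l, Rly}" "\<lambda>i. (relay_coef P \<rho> l q h i)\<^sup>2"]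
    by (simp add: relay_coef_def)
  then show "1 + P * ((h j)\<^sup>2 + (h k)\<^sup>2 - \<rho>\<^sup>2 * (h q)\<^sup>2) > 0" unfolding v by linarith
  show "(\<lambda>w. h j * fst (fst w) + h k * snd (fst w) + h l * fst (snd w)) ((Xv (Usr j) (joint_map P \<rho> l q z), Xv (Usr k) (joint_map P \<rho> l q z)), Xv (Usr l) (joint_map P \<rho> l q z), Xv Rly (joint_map P \<rho> l q z)) = (\<Sum>i\<in>range Inl. relay_coef P \<rho> l q h i * z i)" for z
    using d q by (auto simp: Xv_joint_map sum_node_node[OF d] relay_coef_def algebra_simps)
  show "(\<lambda>(w, v). (h l + \<rho> * h q) * w) (Xv (Usr l) (joint_map P \<rho> l q z), Xv Rly (joint_map P \<rho> l q z))
     = (\<Sum>i\<in>Inl ` {Usr l, Rly}. relay_coef P \<rho> l q h i * z i)" for z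
    using d q by (auto simp: Xv_joint_map sum_node_node[OF d] relay_coef_def algebra_simps)
qed (use d q in \<open>auto simp: Xv_joint_map\<close>)

text \<open>The transmitters are the correlated pair and the receiver is independent of both, so the
  residual is the full variance of h_j X_j + h_k X_k, cross term included.\<close>

lemma CMI_uplink_in_independent:
  assumes d: "j \<noteq> k" "j \<noteq> l" "k \<noteq> l" and pq: "(p, q) = (j, k) \<or> (p, q) = (k, j)" and P: "P > 0" and \<rho>: "\<rho>\<^sup>2 \<le> 1"
  shows "CMI (gauss_law P \<rho> p q) (borel \<Otimes>\<^sub>M borel) borel (borel \<Otimes>\<^sub>M borel)
      (\<lambda>\<omega>. (Xv (Usr j) \<omega>, Xv (Usr k) \<omega>)) (Yv h Rly) (\<lambda>\<omega>. (Xv (Usr l) \<omega>, Xv Rly \<omega>))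
    = log 2 (1 + P * ((h j)\<^sup>2 + (h k)\<^sup>2 + 2 * \<rho> * h j * h k)) / 2"
proof (rule CMI_linear[where a = "relay_coef P \<rho> p q h" and S\<^sub>1 = "range Inl" and S\<^sub>2 = "Inl ` {Usr l, Rly}"
    and f\<^sub>1 = "\<lambda>w. h j * fst (fst w) + h k * snd (fst w) + h l * fst (snd w)"
    and f\<^sub>2 = "\<lambda>(w, v). h l * w"])
  note [measurable] = measurable_Xv measurable_Yv
  show "(\<lambda>\<omega>. (Xv (Usr j) \<omega>, Xv (Usr k) \<omega>)) \<in> ((\<Pi>\<^sub>M a\<in>UNIV. borel) \<Otimes>\<^sub>M (\<Pi>\<^sub>M a\<in>UNIV. borel)) \<rightarrow>\<^sub>M (borel \<Otimes>\<^sub>M borel)"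
    "Yv h Rly \<in> borel_measurable ((\<Pi>\<^sub>M a\<in>UNIV. borel) \<Otimes>\<^sub>M (\<Pi>\<^sub>M a\<in>UNIV. borel))"
    "(\<lambda>\<omega>. (Xv (Usr l) \<omega>, Xv Rly \<omega>)) \<in> ((\<Pi>\<^sub>M a\<in>UNIV. borel) \<Otimes>\<^sub>M (\<Pi>\<^sub>M a\<in>UNIV. borel)) \<rightarrow>\<^sub>M (borel \<Otimes>\<^sub>M borel)"
    by measurable
  show "Yv h Rly (joint_map P \<rho> p q z) = (\<Sum>i\<in>UNIV. relay_coef P \<rho> p q h i * z i)" for z
    using d pq by (auto simp: Yv_Rly_joint_map[OF d] Xv_joint_map sum_node_node[OF d] relay_coef_def algebra_simps)
  show "(\<Sum>i\<in>- range Inl. (relay_coef P \<rho> p q h i)\<^sup>2) = 1"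
    using d by (simp add: sum_node_node[OF d] relay_coef_def)
  have s: "(sqrt P)\<^sup>2 = P" "(sqrt (1 - \<rho>\<^sup>2))\<^sup>2 = 1 - \<rho>\<^sup>2" using P \<rho> by simp_all
  show v: "(\<Sum>i\<in>- Inl ` {Usr l, Rly}. (relay_coef P \<rho> p q h i)\<^sup>2) = 1 + P * ((h j)\<^sup>2 + (h k)\<^sup>2 + 2 * \<rho> * h j * h k)"
    using d pq by (auto simp: sum_node_node[OF d] relay_coef_def power_mult_distrib s power2_sum algebra_simps)
  have "1 \<le> (\<Sum>i\<in>- Inl ` {Usr l, Rly}. (relay_coef P \<rho> p q h i)\<^sup>2)"
    using member_le_sum[of "Inr Rly" "- Inl ` {Usr l, Rly}" "\<lambda>i. (relay_coef P \<rho> p q h i)\<^sup>2"]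
    by (simp add: relay_coef_def)
  then show "1 + P * ((h j)\<^sup>2 + (h k)\<^sup>2 + 2 * \<rho> * h j * h k) > 0" unfolding v by linarith
  show "(\<lambda>w. h j * fst (fst w) + h k * snd (fst w) + h l * fst (snd w)) ((Xv (Usr j) (joint_map P \<rho> p q z), Xv (Usr k) (joint_map P \<rho> p q z)), Xv (Usr l) (joint_map P \<rho> p q z), Xv Rly (joint_map P \<rho> p q z)) = (\<Sum>i\<in>range Inl. relay_coef P \<rho> p q h i * z i)" for z
    using d pq by (auto simp: Xv_joint_map sum_node_node[OF d] relay_coef_def algebra_simps)
  show "(\<lambda>(w, v). h l * w) (Xv (Usr l) (joint_map P \<rho> p q z), Xv Rly (joint_map P \<rho> p q z))
     = (\<Sum>i\<in>Inl ` {Usr l, Rly}. relay_coef P \<rho> p q h i * z i)" for z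
    using d pq by (auto simp: Xv_joint_map sum_node_node[OF d] relay_coef_def algebra_simps)
qed (use d pq in \<open>auto simp: Xv_joint_map\<close>)

lemma CMI_downlink_in:
  assumes P: "P > 0"
  shows "CMI (gauss_law P \<rho> p q) borel borel borel (Xv Rly) (Yv h (Usr l)) (Xv (Usr l)) = log 2 (1 + (h l)\<^sup>2 * P) / 2"
proof -
  let ?a = "\<lambda>i :: node + node. if i = Inl Rly then h l * sqrt P else if i = Inr (Usr l) then 1 else 0"
  obtain j k where d: "j \<noteq> k" "j \<noteq> l" "k \<noteq> l" using that[of U1 U2] that[of U1 U3] that[of U2 U3] by (cases l) auto
  show ?thesis
  \<comment> \<open>The conditioning input may involve two user coordinates, but the downlink output
    involves none. All user coordinates are therefore put into \<open>S\<^sub>2\<close>, with known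
    part 0.\<close>
  proof (rule CMI_linear[where a = ?a and S\<^sub>1 = "range Inl" and S\<^sub>2 = "Inl ` range Usr"
      and f\<^sub>1 = "\<lambda>(x, y). h l * x" and f\<^sub>2 = "\<lambda>_. 0"])
    show "Yv h (Usr l) (joint_map P \<rho> p q z) = (\<Sum>i\<in>UNIV. ?a i * z i)" for z
      using d by (simp add: Yv_Usr_joint_map sum_node_node[OF d])
    show "(\<lambda>(x, y). h l * x) (Xv Rly (joint_map P \<rho> p q z), Xv (Usr l) (joint_map P \<rho> p q z)) = (\<Sum>i\<in>range Inl. ?a i * z i)" for z
      using d by (simp add: Xv_joint_map sum_node_node[OF d])
    show "(\<Sum>i\<in>- range Inl. (?a i)\<^sup>2) = 1"
      using d by (simp add: sum_node_node[OF d])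
    show "(\<Sum>i\<in>- Inl ` range Usr. (?a i)\<^sup>2) = 1 + (h l)\<^sup>2 * P"
      using d P by (auto simp: sum_node_node[OF d] power_mult_distrib)
    show "0 < 1 + (h l)\<^sup>2 * P" using P by (simp add: add_pos_nonneg)
    show "0 = (\<Sum>i\<in>Inl ` range Usr. ?a i * z i)" for z
      using d by (auto simp: sum_node_node[OF d])
  qed (auto simp: Xv_joint_map measurable_Xv measurable_Yv)
qed

text \<open>The output is a pair, so \<open>CMI_linear\<close> does not apply. Instead Y_k is split
  into b Y_l and the residual V; the two are independent, and the log density ratio separates into a
  term for V and one for Y_l.\<close>

lemma CMI_downlink_out:
  assumes P: "P > 0" and kl: "k \<noteq> l"
  shows "CMI (gauss_law P \<rho> p q) borel (borel \<Otimes>\<^sub>M borel) (borel \<Otimes>\<^sub>M borel)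
      (Xv Rly) (\<lambda>\<omega>. (Yv h (Usr k) \<omega>, Yv h (Usr l) \<omega>)) (\<lambda>\<omega>. (Xv (Usr k) \<omega>, Xv (Usr l) \<omega>))
    = log 2 (1 + (h k)\<^sup>2 * P + (h l)\<^sup>2 * P) / 2"
proof -
  interpret N: prob_space iid by (rule prob_space_PiM_stdN)
  let ?e = "joint_map P \<rho> p q"
  let ?r = "Inl Rly :: node + node" and ?k = "Inr (Usr k) :: node + node" and ?l = "Inr (Usr l) :: node + node"
  define \<sigma> where "\<sigma> = sqrt (1 + (h l)\<^sup>2 * P)"
  define b where "b = h k * h l * P / (1 + (h l)\<^sup>2 * P)"
  define g where "g = h k - b * h l"
  define s where "s = sqrt (1 + b\<^sup>2 + g\<^sup>2 * P)"
  define Y where "Y j z = h j * (sqrt P * z ?r) + z (Inr (Usr j))" for j and z :: "node + node \<Rightarrow> real"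
  define V where "V z = Y k z - b * Y l z" for z
  have lP: "1 + (h l)\<^sup>2 * P > 0" using P by (simp add: add_pos_nonneg)
  have \<sigma>2: "\<sigma>\<^sup>2 = 1 + (h l)\<^sup>2 * P" and \<sigma>: "\<sigma> > 0" using lP by (simp_all add: \<sigma>_def)
  have sP: "1 + b\<^sup>2 + g\<^sup>2 * P > 0" using P by (simp add: add_pos_nonneg)
  then have s: "s > 0" by (simp add: s_def)
  have [measurable]: "Y j \<in> borel_measurable iid" "V \<in> borel_measurable iid" for j
    unfolding Y_def V_def by measurable
  have Yl: "distributed iid lborel (Y l) (normal_density 0 \<sigma>)"
  proof -
    have *: "(\<Sum>i\<in>{?r, ?l}. (if i = ?r then h l * sqrt P else 1)\<^sup>2) = 1 + (h l)\<^sup>2 * P"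
      using P by (simp add: power_mult_distrib)
    show ?thesis
      using distributed_linear[of "\<lambda>i. if i = ?r then h l * sqrt P else 1" "{?r, ?l}"] lP
      unfolding * by (simp add: Y_def[abs_def] \<sigma>_def mult.assoc)
  qed
  have Vd: "distributed iid lborel V (normal_density 0 s)"
  proof -
    let ?a = "\<lambda>i. if i = ?r then g * sqrt P else if i = ?k then 1 else - b"
    have *: "(\<Sum>i\<in>{?r, ?k, ?l}. (?a i)\<^sup>2) = 1 + b\<^sup>2 + g\<^sup>2 * P"
      using P kl by (simp add: power_mult_distrib)
    have "V z = (\<Sum>i\<in>{?r, ?k, ?l}. ?a i * z i)" for z
      using kl by (simp add: V_def Y_def g_def algebra_simps)
    then have "V = (\<lambda>z. \<Sum>i\<in>{?r, ?k, ?l}. ?a i * z i)" by (rule ext)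
    then show ?thesis using distributed_linear[of ?a "{?r, ?k, ?l}"] sP unfolding * by (simp only: s_def)
  qed
  have ind: "indep_laws iid borel (Y l) borel V"
  proof -
    \<comment> \<open>(u, v) is the unit vector along Y_l in the plane of the relay coordinate and
      the noise at \<open>l\<close>. After reflection Y_l is \<sigma> times the first coordinate,
      and V uses only the second one and the noise at \<open>k\<close>.\<close>
    let ?u = "h l * sqrt P / \<sigma>" and ?v = "1 / \<sigma>"
    have one: "?u\<^sup>2 + ?v\<^sup>2 = 1"
    proof -
      have "?u\<^sup>2 + ?v\<^sup>2 = ((h l)\<^sup>2 * P + 1) / \<sigma>\<^sup>2" using P by (simp add: power_divide power_mult_distrib add_divide_distrib)
      then show ?thesis using lP by (simp add: \<sigma>2)
    qed
    have "indep_laws iid borel (\<lambda>z. \<sigma> * z ?r) borel (\<lambda>z. h k * sqrt P / \<sigma> * z ?l + z ?k)"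
      by (rule indep_laws_coords[where A = "{?r}" and B = "{?l, ?k}"]) simp_all
    from indep_laws_comp_reflect[OF _ one this, of ?r ?l]
    have "indep_laws iid borel (\<lambda>z. \<sigma> * reflect ?r ?l ?u ?v z ?r) borel
      (\<lambda>z. h k * sqrt P / \<sigma> * reflect ?r ?l ?u ?v z ?l + reflect ?r ?l ?u ?v z ?k)" by simp
    moreover have "(\<lambda>z. \<sigma> * reflect ?r ?l ?u ?v z ?r) = Y l"
      using \<sigma> by (auto simp: reflect_def Y_def field_simps)
    moreover have "(\<lambda>z. h k * sqrt P / \<sigma> * reflect ?r ?l ?u ?v z ?l + reflect ?r ?l ?u ?v z ?k) = V"
    proof
      fix z :: "node + node \<Rightarrow> real"
      have "g = h k / \<sigma>\<^sup>2" unfolding \<sigma>2 g_def b_def using lP by (simp add: field_simps power2_eq_square)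
      moreover have "b = h k * (sqrt P * sqrt P) * h l / \<sigma>\<^sup>2" using P by (simp add: b_def \<sigma>2)
      moreover have "V z = g * sqrt P * z ?r + z ?k - b * z ?l" by (simp add: V_def Y_def g_def algebra_simps)
      ultimately show "h k * sqrt P / \<sigma> * reflect ?r ?l ?u ?v z ?l + reflect ?r ?l ?u ?v z ?k = V z"
        using \<sigma> kl by (simp add: reflect_def power2_eq_square diff_divide_distrib right_diff_distrib mult_ac)
    qed
    ultimately show ?thesis by simp
  qed
  let ?q = "\<lambda>w :: real \<times> real. normal_density 0 s (fst w - b * snd w) * normal_density 0 \<sigma> (snd w)"
  \<comment> \<open>The factor 0 brings the independent noise pair into the form of
    \<open>distributed_normal_pair\<close>, with regression coefficient 0.\<close>
  let ?n = "\<lambda>w :: real \<times> real. normal_density 0 1 (fst w - 0 * snd w) * normal_density 0 1 (snd w)"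
  let ?N = "\<lambda>z :: node + node \<Rightarrow> real. (0 * z ?l + z ?k, z ?l)"
  have pair: "(b * Y l z + V z, Y l z) = (Y k z, Y l z)" for z by (simp add: V_def)
  have Bd: "distributed iid lborel (\<lambda>z. (Y k z, Y l z)) ?q"
    using N.distributed_normal_pair[OF ind s \<sigma> Vd Yl, of b] unfolding pair .
  have Nd: "distributed iid lborel ?N ?n"
  proof (rule N.distributed_normal_pair)
    show "indep_laws iid borel (\<lambda>z. z ?l) borel (\<lambda>z. z ?k)"
      by (rule indep_laws_coords[where A = "{?l}" and B = "{?k}"]) (use kl in simp_all)
  qed (simp_all add: distributed_stdN_coord)
  have qn: "?q \<in> borel_measurable borel" "?n \<in> borel_measurable borel"
    unfolding borel_prod[symmetric] by measurable
  have qpos: "?q w > 0" for w using s \<sigma> by (simp add: normal_density_pos)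
  have Xk: "(\<lambda>z. Xv a (?e z)) \<in> borel_measurable (\<Pi>\<^sub>M i\<in>UNIV. borel)" for a
    by (rule measurable_compose[OF measurable_joint_map measurable_Xv])
  let ?T = "borel \<Otimes>\<^sub>M (borel \<Otimes>\<^sub>M borel) :: (real \<times> real \<times> real) measure"
  let ?W = "\<lambda>z. (Xv Rly (?e z), Xv (Usr k) (?e z), Xv (Usr l) (?e z))"
  let ?f = "\<lambda>w :: real \<times> real \<times> real. (h k * fst w, h l * fst w)"
  have fW: "?f (?W z) + ?N z = (Y k z, Y l z)" for z
    by (simp add: Y_def Xv_joint_map)
  have 1: "N.mutual_information 2 borel ?T (\<lambda>z. (Y k z, Y l z)) ?W = log 2 (1 + (h k)\<^sup>2 * P + (h l)\<^sup>2 * P) / 2"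
  proof -
    have "N.mutual_information 2 borel ?T (\<lambda>z. ?f (?W z) + ?N z) ?W
      = N.expectation (\<lambda>z. log 2 (?n (?N z) / ?q (?f (?W z) + ?N z)))"
    proof (rule N.mutual_information_additive_noise[OF _ Nd])
      show "indep_laws iid ?T ?W borel ?N"
      proof (rule indep_laws_coords[where A = "range Inl" and B = "{?k, ?l}"])
        show "?W \<in> (\<Pi>\<^sub>M i\<in>UNIV. borel) \<rightarrow>\<^sub>M ?T" by (intro measurable_Pair Xk)
        show "?N \<in> (\<Pi>\<^sub>M i\<in>UNIV. borel) \<rightarrow>\<^sub>M borel" by (intro borel_measurable_Pair) simp_all
      qed (auto simp: Xv_joint_map)
      show "?f \<in> ?T \<rightarrow>\<^sub>M borel" by (intro borel_measurable_Pair) simp_all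
      show "distributed iid lborel (\<lambda>z. ?f (?W z) + ?N z) ?q" unfolding fW by (rule Bd)
    qed (use qn qpos in auto)
    also have "\<dots> = N.expectation (\<lambda>z. log 2 (normal_density 0 1 (z ?k) / normal_density 0 s (V z))
        + log 2 (normal_density 0 1 (z ?l) / normal_density 0 \<sigma> (Y l z)))"
    proof (rule Bochner_Integration.integral_cong[OF refl])
      fix z
      have "?q (?f (?W z) + ?N z) = normal_density 0 s (V z) * normal_density 0 \<sigma> (Y l z)"
        unfolding fW by (simp add: V_def)
      moreover have "?n (?N z) = normal_density 0 1 (z ?k) * normal_density 0 1 (z ?l)" by simp
      ultimately show "log 2 (?n (?N z) / ?q (?f (?W z) + ?N z)) = log 2 (normal_density 0 1 (z ?k) / normal_density 0 s (V z))
        + log 2 (normal_density 0 1 (z ?l) / normal_density 0 \<sigma> (Y l z))"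
        using normal_density_pos[OF s, of 0 "V z"] normal_density_pos[OF \<sigma>, of 0 "Y l z"]
          normal_density_pos[of 1 0 "z ?k"] normal_density_pos[of 1 0 "z ?l"]
        by (simp only: log_def ln_div ln_mult) (simp add: ln_div ln_mult add_divide_distrib diff_divide_distrib)
    qed
    also have "\<dots> = log 2 (s / 1) + log 2 (\<sigma> / 1)"
      using has_bochner_integral_add[OF N.expectation_log_normal_ratio[OF _ s distributed_stdN_coord Vd, of ?k]
          N.expectation_log_normal_ratio[OF _ \<sigma> distributed_stdN_coord Yl, of ?l]]
      by (simp add: has_bochner_integral_iff)
    also have "\<dots> = log 2 (\<sigma>\<^sup>2 * s\<^sup>2) / 2"
      using s \<sigma> by (simp add: log_mult log_nat_power)
    also have "\<sigma>\<^sup>2 * s\<^sup>2 = 1 + (h k)\<^sup>2 * P + (h l)\<^sup>2 * P"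
      using regression_identity[OF P, of "h l" "h k"] sP by (simp add: \<sigma>2 s_def g_def b_def)
    finally show ?thesis unfolding fW .
  qed
  let ?W2 = "\<lambda>z. (Xv (Usr k) (?e z), Xv (Usr l) (?e z))"
  let ?T2 = "borel \<Otimes>\<^sub>M borel :: (real \<times> real) measure"
  \<comment> \<open>The outputs are independent of the user inputs, since the relay input is.
    Formally the whole output pair is taken as noise added to the constant 0.\<close>
  have 2: "N.mutual_information 2 borel ?T2 (\<lambda>z. (Y k z, Y l z)) ?W2 = 0"
  proof -
    have "N.mutual_information 2 borel ?T2 (\<lambda>z. (\<lambda>_. 0) (?W2 z) + (Y k z, Y l z)) ?W2
      = N.expectation (\<lambda>z. log 2 (?q (Y k z, Y l z) / ?q ((\<lambda>_. 0) (?W2 z) + (Y k z, Y l z))))"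
    proof (rule N.mutual_information_additive_noise[OF _ Bd])
      show "indep_laws iid ?T2 ?W2 borel (\<lambda>z. (Y k z, Y l z))"
      proof (rule indep_laws_coords[where A = "Inl ` range Usr" and B = "{?r, ?k, ?l}"])
        show "?W2 \<in> (\<Pi>\<^sub>M i\<in>UNIV. borel) \<rightarrow>\<^sub>M ?T2" by (intro measurable_Pair Xk)
        show "(\<lambda>z. (Y k z, Y l z)) \<in> (\<Pi>\<^sub>M i\<in>UNIV. borel) \<rightarrow>\<^sub>M borel"
          unfolding Y_def by (intro borel_measurable_Pair) simp_all
      qed (auto simp: Xv_joint_map Y_def)
      show "distributed iid lborel (\<lambda>z. 0 + (Y k z, Y l z)) ?q" using Bd by simp
    qed (use qn qpos in \<open>auto intro: less_imp_le\<close>)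
    also have "\<dots> = N.expectation (\<lambda>z. 0)"
      by (intro Bochner_Integration.integral_cong refl)
         (simp add: less_imp_neq[OF normal_density_pos[OF s], symmetric] less_imp_neq[OF normal_density_pos[OF \<sigma>], symmetric])
    finally show ?thesis by simp
  qed
  note [measurable] = measurable_Xv measurable_Yv
  have eqY: "(Yv h (Usr k) (?e z), Yv h (Usr l) (?e z)) = (Y k z, Y l z)" for z
    by (simp add: Yv_Usr_joint_map Y_def)
  have "CMI (gauss_law P \<rho> p q) borel (borel \<Otimes>\<^sub>M borel) (borel \<Otimes>\<^sub>M borel)
      (Xv Rly) (\<lambda>\<omega>. (Yv h (Usr k) \<omega>, Yv h (Usr l) \<omega>)) (\<lambda>\<omega>. (Xv (Usr k) \<omega>, Xv (Usr l) \<omega>))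
    = N.mutual_information 2 (borel \<Otimes>\<^sub>M borel) ?T (\<lambda>z. (Y k z, Y l z)) ?W
      - N.mutual_information 2 (borel \<Otimes>\<^sub>M borel) ?T2 (\<lambda>z. (Y k z, Y l z)) ?W2"
    by (subst CMI_gauss_law) (measurable, simp only: eqY)
  also have "(borel \<Otimes>\<^sub>M borel) = (borel :: (real \<times> real) measure)" by (rule borel_prod)
  finally show ?thesis using 1 2 by (simp only: borel_prod diff_zero)
qed

section \<open>The rate bounds in the limit\<close>

lemma rate_limit:
  fixes N :: "nat \<Rightarrow> nat" and err a :: "nat \<Rightarrow> real"
  assumes N: "filterlim N at_top sequentially" and err: "err \<longlonglongrightarrow> 0" and a: "a \<longlonglongrightarrow> A" and A: "A \<ge> 0"
    and le: "\<And>n. (1 - err n) * r \<le> log 2 (1 + a n) / 2 + 1 / (N n * ln 2)"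
  shows "r \<le> log 2 (1 + A) / 2"
proof (rule LIMSEQ_le)
  have "(\<lambda>n. (1 - err n) * r) \<longlonglongrightarrow> (1 - 0) * r" by (intro tendsto_intros err)
  then show "(\<lambda>n. (1 - err n) * r) \<longlonglongrightarrow> r" by simp
  have "filterlim (\<lambda>n. real (N n)) at_top sequentially"
    by (rule filterlim_compose[OF filterlim_real_sequentially N])
  then have "(\<lambda>n. 1 / ln 2 * inverse (real (N n))) \<longlonglongrightarrow> 1 / ln 2 * 0"
    by (intro tendsto_mult tendsto_const tendsto_inverse_0_at_top)
  then have "(\<lambda>n. 1 / (N n * ln 2)) \<longlonglongrightarrow> 0" by (simp add: field_simps)
  moreover have "(\<lambda>n. log 2 (1 + a n)) \<longlonglongrightarrow> log 2 (1 + A)"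
    using A by (intro tendsto_log tendsto_add tendsto_const a) auto
  ultimately have "(\<lambda>n. log 2 (1 + a n) / 2 + 1 / (N n * ln 2)) \<longlonglongrightarrow> log 2 (1 + A) / 2 + 0"
    by (intro tendsto_add tendsto_divide tendsto_const) auto
  then show "(\<lambda>n. log 2 (1 + a n) / 2 + 1 / (N n * ln 2)) \<longlonglongrightarrow> log 2 (1 + A) / 2" by simp
  show "\<exists>M. \<forall>n\<ge>M. (1 - err n) * r \<le> log 2 (1 + a n) / 2 + 1 / (N n * ln 2)" using le by blast
qed

lemma strongest_user:
  fixes h :: "user \<Rightarrow> real"
  obtains j p q where "j \<noteq> p" "j \<noteq> q" "p \<noteq> q" "\<And>u. (h u)\<^sup>2 \<le> (h j)\<^sup>2"
proof -
  obtain j where j: "\<And>u. (h u)\<^sup>2 \<le> (h j)\<^sup>2"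
  proof -
    have "finite (range (\<lambda>u. (h u)\<^sup>2))" by simp
    then have "Max (range (\<lambda>u. (h u)\<^sup>2)) \<in> range (\<lambda>u. (h u)\<^sup>2)" by (rule Max_in) simp
    then obtain j where "Max (range (\<lambda>u. (h u)\<^sup>2)) = (h j)\<^sup>2" by (rule imageE)
    then have "(h u)\<^sup>2 \<le> (h j)\<^sup>2" for u using Max_ge[of "range (\<lambda>u. (h u)\<^sup>2)" "(h u)\<^sup>2"] by simp
    then show thesis by (rule that)
  qed
  obtain p q where "j \<noteq> p" "j \<noteq> q" "p \<noteq> q"
    by (cases j) (use that[of U2 U3] that[of U1 U3] that[of U1 U2] in auto)
  with j show thesis by (intro that)
qed

text \<open>The rates are fixed numbers, so it suffices to have the cut bounds along one
  subsequence. The subsequence is chosen once, by compactness of [-P, P], and the same \<rho> then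
  appears in every bound that depends on the correlation.\<close>

lemma achievable_rate_bounds:
  assumes P: "P > 0" and ach: "achievable h P R"
    and d0: "j\<^sub>0 \<noteq> p" "j\<^sub>0 \<noteq> q" "p \<noteq> q"
  obtains \<rho> where "\<rho>\<^sup>2 \<le> 1"
    and "R p j\<^sub>0 + R p q \<le> log 2 (1 + (h p)\<^sup>2 * (P * (1 - \<rho>\<^sup>2))) / 2"
    and "R q j\<^sub>0 + R q p \<le> log 2 (1 + (h q)\<^sup>2 * (P * (1 - \<rho>\<^sup>2))) / 2"
    and "R p j\<^sub>0 + R q j\<^sub>0 \<le> log 2 (1 + P * ((h p)\<^sup>2 + (h q)\<^sup>2 + 2 * \<rho> * h p * h q)) / 2"
    and "\<And>j k l. j \<noteq> k \<Longrightarrow> j \<noteq> l \<Longrightarrow> k \<noteq> l \<Longrightarrow> R j k + R j l \<le> log 2 (1 + (h j)\<^sup>2 * P) / 2"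
    and "\<And>j k l. j \<noteq> k \<Longrightarrow> j \<noteq> l \<Longrightarrow> k \<noteq> l \<Longrightarrow> R j k + R j l \<le> log 2 (1 + (h k)\<^sup>2 * P + (h l)\<^sup>2 * P) / 2"
    and "\<And>j k l. j \<noteq> k \<Longrightarrow> j \<noteq> l \<Longrightarrow> k \<noteq> l \<Longrightarrow> R j l + R k l \<le> log 2 (1 + (h l)\<^sup>2 * P) / 2"
proof -
  obtain c where c: "\<And>n. code_measurable (c n)" "\<And>n. power_ok (c n) h P R n"
    and err: "(\<lambda>n. err_prob (c n) h R n) \<longlonglongrightarrow> 0"
    using ach unfolding achievable_def by blast
  \<comment> \<open>Block length 0 is skipped, because the averages over time divide by the
    length.\<close>
  have code: "y_code (c (Suc n)) h P R (Suc n)" for n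
    by unfold_locales (use c P in simp_all)
  define C where "C n = y_code.correlation (c (Suc n)) h R (Suc n) (Usr p) (Usr q)" for n
  have "C n \<in> {-P..P}" for n
    using y_code.abs_correlation_le[OF code, of n "Usr p" "Usr q"] by (simp add: C_def abs_le_iff minus_le_iff)
  then obtain L s where L: "L \<in> {-P..P}" and s: "strict_mono s" and lim: "(C \<circ> s) \<longlonglongrightarrow> L"
    using compact_Icc[of "-P" P] unfolding compact_def by metis
  define \<rho> where "\<rho> = L / P"
  have LP: "L = \<rho> * P" using P by (simp add: \<rho>_def)
  have "\<bar>\<rho>\<bar> \<le> 1" using L P by (simp add: \<rho>_def abs_le_iff field_simps)
  then have \<rho>: "\<rho>\<^sup>2 \<le> 1" by (simp add: abs_square_le_1)
  define N where "N n = Suc (s n)" for n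
  have smN: "strict_mono N" using s by (simp add: strict_mono_def N_def)
  then have N: "filterlim N at_top sequentially" by (rule filterlim_subseq)
  have errN: "(\<lambda>n. err_prob (c (N n)) h R (N n)) \<longlonglongrightarrow> 0"
    using LIMSEQ_subseq_LIMSEQ[OF err smN] by (simp add: comp_def)
  have codeN: "y_code (c (N n)) h P R (N n)" for n unfolding N_def by (rule code)
  have CN: "(\<lambda>n. y_code.correlation (c (N n)) h R (N n) (Usr p) (Usr q)) \<longlonglongrightarrow> L"
    using lim by (simp add: comp_def C_def N_def)
  note limit = rate_limit[OF N errN]
  have out: "R i k + R i l \<le> log 2 (1 + (h i)\<^sup>2 * (P * (1 - \<rho>\<^sup>2))) / 2"
    if d: "i \<noteq> k" "i \<noteq> l" "k \<noteq> l" and il: "(\<lambda>n. y_code.correlation (c (N n)) h R (N n) (Usr i) (Usr l)) \<longlonglongrightarrow> L" for i k l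
  proof (rule limit)
    \<comment> \<open>The coefficient \<rho> = L / P minimises P - 2 \<beta> L + \<beta>^2 P over
      \<beta>, with minimum P (1 - \<rho>^2).\<close>
    let ?a = "\<lambda>n. (h i)\<^sup>2 * (P - 2 * \<rho> * y_code.correlation (c (N n)) h R (N n) (Usr i) (Usr l) + \<rho>\<^sup>2 * P)"
    have "?a \<longlonglongrightarrow> (h i)\<^sup>2 * (P - 2 * \<rho> * L + \<rho>\<^sup>2 * P)" by (intro tendsto_intros il)
    then show "?a \<longlonglongrightarrow> (h i)\<^sup>2 * (P * (1 - \<rho>\<^sup>2))" by (simp add: LP power2_eq_square algebra_simps)
    show "0 \<le> (h i)\<^sup>2 * (P * (1 - \<rho>\<^sup>2))" using P \<rho> by simp
    show "(1 - err_prob (c (N n)) h R (N n)) * (R i k + R i l) \<le> log 2 (1 + ?a n) / 2 + 1 / (N n * ln 2)" for n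
      using y_code.uplink_out[OF codeN d] .
  qed
  show thesis
  proof (rule that[OF \<rho>])
    show "R p j\<^sub>0 + R p q \<le> log 2 (1 + (h p)\<^sup>2 * (P * (1 - \<rho>\<^sup>2))) / 2"
      by (rule out) (use d0 CN in auto)
    show "R q j\<^sub>0 + R q p \<le> log 2 (1 + (h q)\<^sup>2 * (P * (1 - \<rho>\<^sup>2))) / 2"
      by (rule out) (use d0 CN in \<open>auto simp: y_code.correlation_commute[OF codeN, of _ "Usr q"]\<close>)
    show "R p j\<^sub>0 + R q j\<^sub>0 \<le> log 2 (1 + P * ((h p)\<^sup>2 + (h q)\<^sup>2 + 2 * \<rho> * h p * h q)) / 2"
    proof (rule limit)
      let ?a = "\<lambda>n. (h p)\<^sup>2 * P + 2 * h p * h q * y_code.correlation (c (N n)) h R (N n) (Usr p) (Usr q) + (h q)\<^sup>2 * P"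
      have *: "P * ((h p)\<^sup>2 + (h q)\<^sup>2 + 2 * \<rho> * h p * h q) = (h p)\<^sup>2 * P + 2 * h p * h q * L + (h q)\<^sup>2 * P"
        by (simp add: LP algebra_simps)
      show a: "?a \<longlonglongrightarrow> P * ((h p)\<^sup>2 + (h q)\<^sup>2 + 2 * \<rho> * h p * h q)"
        unfolding * by (intro tendsto_intros CN)
      show "0 \<le> P * ((h p)\<^sup>2 + (h q)\<^sup>2 + 2 * \<rho> * h p * h q)"
        by (rule LIMSEQ_le_const[OF a]) (use y_code.linear_power_nonneg[OF codeN] in blast)
      show "(1 - err_prob (c (N n)) h R (N n)) * (R p j\<^sub>0 + R q j\<^sub>0) \<le> log 2 (1 + ?a n) / 2 + 1 / (N n * ln 2)" for n
        by (rule y_code.uplink_in[OF codeN]) (use d0 in auto)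
    qed
    fix j k l :: user assume d: "j \<noteq> k" "j \<noteq> l" "k \<noteq> l"
    \<comment> \<open>With prediction coefficient 0 the correlation drops out, so this bound holds
      for every labelling of the users.\<close>
    show "R j k + R j l \<le> log 2 (1 + (h j)\<^sup>2 * P) / 2"
      by (rule limit[OF tendsto_const]) (use y_code.uplink_out[OF codeN d, of _ 0] P in simp_all)
    show "R j l + R k l \<le> log 2 (1 + (h l)\<^sup>2 * P) / 2"
      by (rule limit[OF tendsto_const]) (use y_code.downlink_in[OF codeN d] P in simp_all)
    have "R j k + R j l \<le> log 2 (1 + ((h k)\<^sup>2 * P + (h l)\<^sup>2 * P)) / 2"
      by (rule limit[OF tendsto_const]) (use y_code.downlink_out[OF codeN d] P in \<open>simp_all add: add.assoc\<close>)
    then show "R j k + R j l \<le> log 2 (1 + (h k)\<^sup>2 * P + (h l)\<^sup>2 * P) / 2" by (simp add: add.assoc)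
  qed
qed

theorem theorem1:
  fixes h :: "user \<Rightarrow> real" and P :: real and R :: "user \<Rightarrow> user \<Rightarrow> real"
  assumes "P > 0"
    and "achievable h P R"
  shows "\<exists>\<mu> :: (node \<Rightarrow> real) measure.
    prob_space \<mu> \<and> sets \<mu> = sets (\<Pi>\<^sub>M a\<in>UNIV. (borel :: real measure)) \<and>
    (\<forall>a. (\<integral>\<^sup>+ x. ennreal ((x a)\<^sup>2) \<partial>\<mu>) \<le> ennreal P) \<and>
    (\<forall>j k l. j \<noteq> k \<and> j \<noteq> l \<and> k \<noteq> l \<longrightarrow>
       R j k + R j l \<le>
         min (CMI \<mu> borel borel (borel \<Otimes>\<^sub>M (borel \<Otimes>\<^sub>M borel))
                (Xv (Usr j)) (Yv h Rly)
                (\<lambda>\<omega>. (Xv (Usr k) \<omega>, Xv (Usr l) \<omega>, Xv Rly \<omega>)))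
             (CMI \<mu> borel (borel \<Otimes>\<^sub>M borel) (borel \<Otimes>\<^sub>M borel)
                (Xv Rly) (\<lambda>\<omega>. (Yv h (Usr k) \<omega>, Yv h (Usr l) \<omega>))
                (\<lambda>\<omega>. (Xv (Usr k) \<omega>, Xv (Usr l) \<omega>))) \<and>
       R j l + R k l \<le>
         min (CMI \<mu> (borel \<Otimes>\<^sub>M borel) borel (borel \<Otimes>\<^sub>M borel)
                (\<lambda>\<omega>. (Xv (Usr j) \<omega>, Xv (Usr k) \<omega>)) (Yv h Rly)
                (\<lambda>\<omega>. (Xv (Usr l) \<omega>, Xv Rly \<omega>)))
             (CMI \<mu> borel borel borel
                (Xv Rly) (Yv h (Usr l)) (Xv (Usr l))))"
proof -
  obtain j\<^sub>0 p q where d0: "j\<^sub>0 \<noteq> p" "j\<^sub>0 \<noteq> q" "p \<noteq> q" and strongest: "\<And>u. (h u)\<^sup>2 \<le> (h j\<^sub>0)\<^sup>2"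
    using strongest_user[of h] by metis
  have user: "u = j\<^sub>0 \<or> u = p \<or> u = q" for u using d0 by (cases u; cases j\<^sub>0; cases p; cases q) auto
  obtain \<rho> where \<rho>: "\<rho>\<^sup>2 \<le> 1"
    and out_p: "R p j\<^sub>0 + R p q \<le> log 2 (1 + (h p)\<^sup>2 * (P * (1 - \<rho>\<^sup>2))) / 2"
    and out_q: "R q j\<^sub>0 + R q p \<le> log 2 (1 + (h q)\<^sup>2 * (P * (1 - \<rho>\<^sup>2))) / 2"
    and in_0: "R p j\<^sub>0 + R q j\<^sub>0 \<le> log 2 (1 + P * ((h p)\<^sup>2 + (h q)\<^sup>2 + 2 * \<rho> * h p * h q)) / 2"
    and out: "\<And>j k l. j \<noteq> k \<Longrightarrow> j \<noteq> l \<Longrightarrow> k \<noteq> l \<Longrightarrow> R j k + R j l \<le> log 2 (1 + (h j)\<^sup>2 * P) / 2"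
    and down_out: "\<And>j k l. j \<noteq> k \<Longrightarrow> j \<noteq> l \<Longrightarrow> k \<noteq> l \<Longrightarrow> R j k + R j l \<le> log 2 (1 + (h k)\<^sup>2 * P + (h l)\<^sup>2 * P) / 2"
    and down_in: "\<And>j k l. j \<noteq> k \<Longrightarrow> j \<noteq> l \<Longrightarrow> k \<noteq> l \<Longrightarrow> R j l + R k l \<le> log 2 (1 + (h l)\<^sup>2 * P) / 2"
    by (rule achievable_rate_bounds[OF assms d0]) (rule that; blast)
  let ?\<mu> = "gauss_law P \<rho> p q"
  have swap: "?\<mu> = gauss_law P \<rho> q p" by (rule gauss_law_swap[OF \<rho> d0(3)])
  have up_out: "R j k + R j l \<le> CMI ?\<mu> borel borel (borel \<Otimes>\<^sub>M (borel \<Otimes>\<^sub>M borel)) (Xv (Usr j)) (Yv h Rly)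
      (\<lambda>\<omega>. (Xv (Usr k) \<omega>, Xv (Usr l) \<omega>, Xv Rly \<omega>))" if d: "j \<noteq> k" "j \<noteq> l" "k \<noteq> l" for j k l
  proof -
    \<comment> \<open>The transmitter is the uncorrelated user, or \<open>q\<close>, whose input the
      law builds on that of \<open>p\<close>, or \<open>p\<close>, for which the law is first
      rewritten with \<open>q\<close> as base.\<close>
    consider "j = j\<^sub>0" "(p, q) = (k, l) \<or> (p, q) = (l, k)"
      | "j = q" "(k, l) = (j\<^sub>0, p) \<or> (k, l) = (p, j\<^sub>0)"
      | "j = p" "(k, l) = (j\<^sub>0, q) \<or> (k, l) = (q, j\<^sub>0)"
      using user[of j] user[of k] user[of l] d by auto
    then show ?thesis
    proof cases
      case 1
      then show ?thesis using out[OF d] CMI_uplink_out_independent[OF d 1(2) assms(1) \<rho>, of h] by simp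
    next
      case 2
      then have "p = k \<or> p = l" by auto
      from CMI_uplink_out_correlated[OF d this assms(1) \<rho>, of h] 2 show ?thesis using out_q by (auto simp: add.commute)
    next
      case 3
      then have "q = k \<or> q = l" by auto
      from CMI_uplink_out_correlated[OF d this assms(1) \<rho>, of h] 3 show ?thesis
        using out_p unfolding swap by (auto simp: add.commute)
    qed
  qed
  have up_in: "R j l + R k l \<le> CMI ?\<mu> (borel \<Otimes>\<^sub>M borel) borel (borel \<Otimes>\<^sub>M borel)
      (\<lambda>\<omega>. (Xv (Usr j) \<omega>, Xv (Usr k) \<omega>)) (Yv h Rly) (\<lambda>\<omega>. (Xv (Usr l) \<omega>, Xv Rly \<omega>))"
    if d: "j \<noteq> k" "j \<noteq> l" "k \<noteq> l" for j k l
  proof -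
    \<comment> \<open>Here \<open>u\<close> is the second transmitter besides
      \<open>j\<^sub>0\<close>. The input of \<open>j\<^sub>0\<close> is independent of the others
      and keeps its full power, so its term alone reaches the downlink bound into \<open>l\<close>;
      the remaining (1 - \<rho>^2) (h u)^2 is nonnegative.\<close>
    have dom: "R j l + R k l \<le> log 2 (1 + P * ((h j)\<^sup>2 + (h k)\<^sup>2 - \<rho>\<^sup>2 * (h u)\<^sup>2)) / 2"
      if "(j, k) = (j\<^sub>0, u) \<or> (j, k) = (u, j\<^sub>0)" for u
    proof -
      have "(h l)\<^sup>2 * P \<le> P * ((h j\<^sub>0)\<^sup>2 + (1 - \<rho>\<^sup>2) * (h u)\<^sup>2)"
        using strongest[of l] \<rho> assms(1) by (subst mult.commute) (auto intro!: mult_left_mono add_increasing2)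
      also have "\<dots> = P * ((h j)\<^sup>2 + (h k)\<^sup>2 - \<rho>\<^sup>2 * (h u)\<^sup>2)" using that by (auto simp: algebra_simps)
      finally have "log 2 (1 + (h l)\<^sup>2 * P) \<le> log 2 (1 + P * ((h j)\<^sup>2 + (h k)\<^sup>2 - \<rho>\<^sup>2 * (h u)\<^sup>2))"
        using assms(1) by (intro log_mono add_left_mono) (auto intro!: add_pos_nonneg)
      with down_in[OF d] show ?thesis by linarith
    qed
    consider "l = j\<^sub>0" "(p, q) = (j, k) \<or> (p, q) = (k, j)"
      | "l = p" "(j, k) = (j\<^sub>0, q) \<or> (j, k) = (q, j\<^sub>0)"
      | "l = q" "(j, k) = (j\<^sub>0, p) \<or> (j, k) = (p, j\<^sub>0)"
      using user[of j] user[of k] user[of l] d by auto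
    then show ?thesis
    proof cases
      case 1
      then show ?thesis using in_0 CMI_uplink_in_independent[OF d 1(2) assms(1) \<rho>, of h]
        by (auto simp: algebra_simps)
    next
      case 2
      then have "q = j \<or> q = k" by auto
      from CMI_uplink_in_correlated[OF d this assms(1) \<rho>, of h] 2 show ?thesis using dom[OF 2(2)] by simp
    next
      case 3
      then have "p = j \<or> p = k" by auto
      from CMI_uplink_in_correlated[OF d this assms(1) \<rho>, of h] 3 show ?thesis
        using dom[OF 3(2)] unfolding swap by simp
    qed
  qed
  show ?thesis
  proof (rule exI[of _ ?\<mu>], intro conjI allI impI)
    show "prob_space ?\<mu>" by (rule prob_space_gauss_law)
    show "sets ?\<mu> = sets (\<Pi>\<^sub>M a\<in>UNIV. borel)" by (rule sets_gauss_law)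
    show "(\<integral>\<^sup>+ x. ennreal ((x a)\<^sup>2) \<partial>?\<mu>) \<le> ennreal P" for a
      by (simp add: gauss_law_power[OF assms(1) \<rho> d0(3)])
  next
    fix j k l :: user assume "j \<noteq> k \<and> j \<noteq> l \<and> k \<noteq> l"
    then have d: "j \<noteq> k" "j \<noteq> l" "k \<noteq> l" by simp_all
    show "R j k + R j l \<le> min (CMI ?\<mu> borel borel (borel \<Otimes>\<^sub>M (borel \<Otimes>\<^sub>M borel))
          (Xv (Usr j)) (Yv h Rly) (\<lambda>\<omega>. (Xv (Usr k) \<omega>, Xv (Usr l) \<omega>, Xv Rly \<omega>)))
        (CMI ?\<mu> borel (borel \<Otimes>\<^sub>M borel) (borel \<Otimes>\<^sub>M borel)
          (Xv Rly) (\<lambda>\<omega>. (Yv h (Usr k) \<omega>, Yv h (Usr l) \<omega>)) (\<lambda>\<omega>. (Xv (Usr k) \<omega>, Xv (Usr l) \<omega>)))"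
      unfolding CMI_downlink_out[OF assms(1) d(3)] by (intro min.boundedI up_out down_out d)
    show "R j l + R k l \<le> min (CMI ?\<mu> (borel \<Otimes>\<^sub>M borel) borel (borel \<Otimes>\<^sub>M borel)
          (\<lambda>\<omega>. (Xv (Usr j) \<omega>, Xv (Usr k) \<omega>)) (Yv h Rly) (\<lambda>\<omega>. (Xv (Usr l) \<omega>, Xv Rly \<omega>)))
        (CMI ?\<mu> borel borel borel (Xv Rly) (Yv h (Usr l)) (Xv (Usr l)))"
      unfolding CMI_downlink_in[OF assms(1)] by (intro min.boundedI up_in down_in d)
  qed
qed

end
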